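(* Let $\mathcal P$ be a finite chiral polyhedron of type $\{p, q\}$. Let $\ell_1 = \mathrm{lcm}(p,q)$, and suppose that \[ |\Gamma^+(\mathcal P) \mathbin{\square} \Gamma^+(\overline{\mathcal P})| < \frac{\ell_1^2}{pq} \, |\Gamma^+(\mathcal P) \mathbin{\square} \Gamma^+(\mathcal P^{\delta})|. \] Then $\mathcal P \diamond \mathcal P^{\delta}$ is a properly self-dual chiral polyhedron of type $\{\ell_1, \ell_1\}$.
   Context: An abstract polytope of rank $n$ (an $n$-polytope; a polyhedron is a $3$-polytope) is a ranked poset of faces with ranks from $-1$ to $n$, with a unique least face (rank $-1$) and a unique greatest face (rank $n$), in which every flag (maximal chain) has $n+2$ faces, which satisfies the diamond condition (whenever $F<G$ with ranks $j-1$ and $j+1$ there are exactly two $j$-faces strictly between them), and which is strongly flag-connected (any two flags $\Phi,\Psi$ are joined by a sequence of flags, consecutive ones adjacent, all containing $\Phi\cap\Psi$; two flags are adjacent if they differ in exactly one face). $\Phi^j$ denotes the unique flag differing from $\Phi$ only in its $j$-face, and $\Phi^{i,j}=(\Phi^i)^j$. Each polytope considered has a fixed base flag $\Phi$. $\mathcal P$ is regular if its automorphism group $\Gamma(\mathcal P)$ is transitive on flags; then $\Gamma(\mathcal P)$ is generated by $\rho_0,\dots,\rho_{n-1}$, where $\rho_i$ maps $\Phi$ to $\Phi^i$. Put $\sigma_i=\rho_{i-1}\rho_i$ and $\Gamma^+(\mathcal P)=\langle\sigma_1,\dots,\sigma_{n-1}\rangle$; $\mathcal P$ is directly regular if it is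 regular and $\Gamma^+(\mathcal P)$ has index $2$ in $\Gamma(\mathcal P)$. $\mathcal P$ is chiral if $\Gamma(\mathcal P)$ has exactly two orbits on flags and adjacent flags lie in distinct orbits; then $\Gamma^+(\mathcal P):=\Gamma(\mathcal P)$ is generated by $\sigma_1,\dots,\sigma_{n-1}$, where $\sigma_i$ maps $\Phi$ to $\Phi^{i,i-1}$. In both cases $(\sigma_i\cdots\sigma_j)^2=1$ for $i<j$, and the type of $\mathcal P$ is $\{p_1,\dots,p_{n-1}\}$ where $p_i$ is the order of $\sigma_i$. Let $W^+=\langle \sigma_1,\dots,\sigma_{n-1}\mid (\sigma_i\cdots\sigma_j)^2=1 \text{ for } 1\le i<j\le n-1\rangle$ (here $n=3$). Writing $\Gamma^+(\mathcal P)=W^+/M$ means that $M$ is the kernel of the epimorphism $W^+\to\Gamma^+(\mathcal P)$ preserving the specified generators. For $w\in W^+$, $\overline w$ is obtained by replacing $\sigma_1$ by $\sigma_1^{-1}$, $\sigma_2$ by $\sigma_1^2\sigma_2$ and fixing $\sigma_j$ for $j\ge3$; $\delta(w)$ is obtained by replacing each $\sigma_i$ by $\sigma_{n-i}^{-1}$ (both are automorphisms of $W^+$). Put $\overline M=\{\overline w:w\in M\}$, $\delta(M)=\{\delta(w):w\in M\}$. If $\Gamma^+(\mathcal P)=W^+/M$, then $\mathcal P$ is directly regular if $\overline M=M$ and chiral otherwise; the mirror image $\overline{\mathcal P}$ of a chiral $\mathcal P$ (same faces, base flag $\Phi^0$) has $\Gamma^+(\overline{\mathcal P})=W^+/\overline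 M$; the dual $\mathcal P^\delta$ (reversed order) has $\Gamma^+(\mathcal P^\delta)=W^+/\delta(M)$; $\mathcal P$ is properly self-dual if it has a duality (order-reversing bijection onto itself) fixing the base flag, equivalently $\delta(M)=M$. Intersection property: for a group $G$ with specified generators $\sigma_1,\dots,\sigma_{n-1}$, put $\tau_{i,j}=\sigma_i\cdots\sigma_j$ and, for $I\subseteq\{0,\dots,n-1\}$, $G_I=\langle\tau_{i,j}\mid 1\le i\le j\le n-1,\ i-1,j\in I\rangle$; $G$ has the intersection property if $G_I\cap G_J=G_{I\cap J}$ for all $I,J$ (for $n=3$: $\langle\sigma_1\rangle\cap\langle\sigma_2\rangle=\{1\}$). Known facts: rotation groups of chiral or directly regular polytopes have it; conversely a quotient of $W^+$ with the intersection property is the rotation group of a chiral or directly regular $n$-polytope. Mix and comix: for groups with specified generators $\Gamma=\langle x_1,\dots,x_k\mid R\rangle$, $\Gamma'=\langle x_1',\dots,x_k'\mid S\rangle$, the mix $\Gamma\diamond\Gamma'$ is the subgroup of $\Gamma\times\Gamma'$ with specified generators $(x_i,x_i')$, $i=1,\dots,k$, and the comix $\Gamma\mathbin{\square}\Gamma'$ is the group $\langle x_1,x_1',\dots,x_k,x_k'\mid R,S,x_1^{-1}x_1',\dots,x_k^{-1}x_k'\rangle$. $\mathcal P\diamond\mathcal Q$ is the flag-connected pre-polytope (polytope axioms with strong flag-connectedness weakened to flag-connectedness) built from $\Gamma^+(\mathcal P)\diamond\Gamma^+(\mathcal Q)=\Gamma^+(\mathcal P\diamond\mathcal Q)$; it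 is a polytope if and only if this group has the intersection property, and is then the chiral or directly regular $n$-polytope with this rotation group. *)

theory Defs
  imports "HOL-Algebra.Algebra"
begin

section \<open>Abstract polytopes with a base flag\<close>

record 'a based_poset =
  faces :: "'a set"
  incidence :: "'a rel"
  face_rank :: "'a \<Rightarrow> int"
  poset_rank :: nat
  base_flag :: "'a set"

definition flags :: "'a based_poset \<Rightarrow> 'a set set" where
  "flags P = {C. pred_on.maxchain (faces P) (\<lambda>x y. (x, y) \<in> incidence P) C}"

definition adjacent_flags :: "'a set \<Rightarrow> 'a set \<Rightarrow> bool" where
  "adjacent_flags A B \<longleftrightarrow> card (A - B) = 1 \<and> card (B - A) = 1"

definition diamond_condition :: "'a based_poset \<Rightarrow> bool" where
  "diamond_condition P \<longleftrightarrow>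
     (\<forall>F\<in>faces P. \<forall>G\<in>faces P.
        (F, G) \<in> incidence P \<and> face_rank P G = face_rank P F + 2 \<longrightarrow>
        card {H \<in> faces P. face_rank P H = face_rank P F + 1 \<and>
                (F, H) \<in> incidence P \<and> (H, G) \<in> incidence P} = 2)"

definition strongly_flag_connected :: "'a based_poset \<Rightarrow> bool" where
  "strongly_flag_connected P \<longleftrightarrow>
     (\<forall>A\<in>flags P. \<forall>B\<in>flags P.
        (\<lambda>C D. C \<in> flags P \<and> D \<in> flags P \<and> A \<inter> B \<subseteq> C \<and> A \<inter> B \<subseteq> D \<and>
               adjacent_flags C D)\<^sup>*\<^sup>* A B)"

text \<open>
  Strict monotonicity of the rank, together with the bounds on it and the cardinality of the
  flags, forces every flag to contain exactly one face of each rank, so that the rank increases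
  by exactly 1 along covers.
\<close>

definition abstract_polytope :: "'a based_poset \<Rightarrow> bool" where
  "abstract_polytope P \<longleftrightarrow>
     partial_order_on (faces P) (incidence P) \<and>
     face_rank P ` faces P \<subseteq> {-1..int (poset_rank P)} \<and>
     (\<forall>(F, G)\<in>incidence P. F \<noteq> G \<longrightarrow> face_rank P F < face_rank P G) \<and>
     (\<exists>L\<in>faces P. face_rank P L = -1 \<and> (\<forall>F\<in>faces P. (L, F) \<in> incidence P)) \<and>
     (\<exists>U\<in>faces P. face_rank P U = int (poset_rank P) \<and> (\<forall>F\<in>faces P. (F, U) \<in> incidence P)) \<and>
     (\<forall>C\<in>flags P. card C = poset_rank P + 2) \<and>
     diamond_condition P \<and>
     strongly_flag_connected P \<and>
     base_flag P \<in> flags P"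

definition flag_adj :: "'a based_poset \<Rightarrow> nat \<Rightarrow> 'a set \<Rightarrow> 'a set" where
  "flag_adj P j C =
     (THE D. D \<in> flags P \<and> D \<noteq> C \<and>
        {F \<in> D. face_rank P F \<noteq> int j} = {F \<in> C. face_rank P F \<noteq> int j})"

text \<open>
  Automorphisms act on the right: the product of \<open>f\<close> and \<open>g\<close> applies \<open>f\<close> first. This is the
  convention under which \<open>\<sigma>\<^sub>i = \<rho>\<^bsub>i-1\<^esub> \<rho>\<^sub>i\<close> maps the base flag \<open>\<Phi>\<close> to \<open>(\<Phi>\<^sup>i)\<^bsup>i-1\<^esup>\<close> and
  \<open>(\<sigma>\<^sub>i \<cdots> \<sigma>\<^sub>j)\<^sup>2 = 1\<close> for \<open>i < j\<close>.
\<close>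

definition aut_group :: "'a based_poset \<Rightarrow> ('a \<Rightarrow> 'a) monoid" where
  "aut_group P =
     \<lparr>carrier = {f \<in> Bij (faces P). \<forall>x\<in>faces P. \<forall>y\<in>faces P.
                   (f x, f y) \<in> incidence P \<longleftrightarrow> (x, y) \<in> incidence P},
      monoid.mult = \<lambda>f g. compose (faces P) g f,
      one = \<lambda>x\<in>faces P. x\<rparr>"

definition flag_orbit :: "'a based_poset \<Rightarrow> 'a set \<Rightarrow> 'a set set" where
  "flag_orbit P C = Group_Action.orbit (aut_group P) (\<lambda>f D. f ` D) C"

definition chiral :: "'a based_poset \<Rightarrow> bool" where
  "chiral P \<longleftrightarrow>
     abstract_polytope P \<and>
     card (flag_orbit P ` flags P) = 2 \<and>
     (\<forall>A\<in>flags P. \<forall>B\<in>flags P. adjacent_flags A B \<longrightarrow> flag_orbit P A \<noteq> flag_orbit P B)"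

definition chiral_polyhedron :: "'a based_poset \<Rightarrow> bool" where
  "chiral_polyhedron P \<longleftrightarrow> chiral P \<and> poset_rank P = 3"

text \<open>
  The generator \<open>\<sigma>\<^sub>i\<close>, for \<open>1 \<le> i \<le> n - 1\<close>, of the rotation group. In the regular case
  \<open>\<rho>\<^bsub>i-1\<^esub> \<rho>\<^sub>i\<close> is also the automorphism that maps \<open>\<Phi>\<close> to \<open>(\<Phi>\<^sup>i)\<^bsup>i-1\<^esup>\<close>.
\<close>

definition rot :: "'a based_poset \<Rightarrow> nat \<Rightarrow> 'a \<Rightarrow> 'a" where
  "rot P i =
     (THE f. f \<in> carrier (aut_group P) \<and>
        f ` base_flag P = flag_adj P (i - 1) (flag_adj P i (base_flag P)))"

definition rotation_group :: "'a based_poset \<Rightarrow> ('a \<Rightarrow> 'a) monoid" where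
  "rotation_group P =
     (if chiral P then aut_group P
      else subgroup_generated (aut_group P) (rot P ` {1..<poset_rank P}))"

text \<open>An entry 0 of the type stands for an infinite order.\<close>

definition schlafli_type :: "'a based_poset \<Rightarrow> nat list" where
  "schlafli_type P = map (\<lambda>i. group.ord (rotation_group P) (rot P i)) [1..<poset_rank P]"

definition mirror :: "'a based_poset \<Rightarrow> 'a based_poset" where
  "mirror P = P\<lparr>base_flag := flag_adj P 0 (base_flag P)\<rparr>"

definition dual :: "'a based_poset \<Rightarrow> 'a based_poset" where
  "dual P = P\<lparr>incidence := (incidence P)\<inverse>,
              face_rank := (\<lambda>F. int (poset_rank P) - 1 - face_rank P F)\<rparr>"

definition properly_self_dual :: "'a based_poset \<Rightarrow> bool" where
  "properly_self_dual P \<longleftrightarrow>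
     (\<exists>d. bij_betw d (faces P) (faces P) \<and>
          (\<forall>x\<in>faces P. \<forall>y\<in>faces P. (d x, d y) \<in> incidence P \<longleftrightarrow> (y, x) \<in> incidence P) \<and>
          d ` base_flag P = base_flag P)"


section \<open>Presentations and the comix\<close>

text \<open>The letter \<open>(i, True)\<close> stands for the generator \<open>x\<^sub>i\<close> and \<open>(i, False)\<close> for its inverse.\<close>

type_synonym 'i word = "('i \<times> bool) list"

definition words :: "'i set \<Rightarrow> 'i word set" where
  "words I = lists (I \<times> UNIV)"

inductive word_equiv :: "'i set \<Rightarrow> 'i word set \<Rightarrow> 'i word \<Rightarrow> 'i word \<Rightarrow> bool"
  for I :: "'i set" and R :: "'i word set" where
  refl: "w \<in> words I \<Longrightarrow> word_equiv I R w w"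
| sym: "word_equiv I R u v \<Longrightarrow> word_equiv I R v u"
| trans: "word_equiv I R u v \<Longrightarrow> word_equiv I R v w \<Longrightarrow> word_equiv I R u w"
| cancel: "u \<in> words I \<Longrightarrow> v \<in> words I \<Longrightarrow> i \<in> I \<Longrightarrow>
    word_equiv I R (u @ [(i, b), (i, \<not> b)] @ v) (u @ v)"
| relator: "u \<in> words I \<Longrightarrow> v \<in> words I \<Longrightarrow> r \<in> R \<Longrightarrow> r \<in> words I \<Longrightarrow>
    word_equiv I R (u @ r @ v) (u @ v)"

text \<open>The group with generators indexed by \<open>I\<close> and set of relators \<open>R\<close>.\<close>

definition presented_group :: "'i set \<Rightarrow> 'i word set \<Rightarrow> 'i word set monoid" where
  "presented_group I R =
     \<lparr>carrier = words I // {(u, v). word_equiv I R u v},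
      monoid.mult = \<lambda>A B. {w. \<exists>u\<in>A. \<exists>v\<in>B. word_equiv I R (u @ v) w},
      one = {w. word_equiv I R [] w}\<rparr>"

definition word_value :: "('g, 'm) monoid_scheme \<Rightarrow> ('i \<Rightarrow> 'g) \<Rightarrow> 'i word \<Rightarrow> 'g" where
  "word_value G x w =
     foldr (\<lambda>(i, b) g. (if b then x i else inv\<^bsub>G\<^esub> (x i)) \<otimes>\<^bsub>G\<^esub> g) w \<one>\<^bsub>G\<^esub>"

definition relators :: "'i set \<Rightarrow> ('g, 'm) monoid_scheme \<Rightarrow> ('i \<Rightarrow> 'g) \<Rightarrow> 'i word set" where
  "relators I G x = {w \<in> words I. word_value G x w = \<one>\<^bsub>G\<^esub>}"

text \<open>
  The comix of \<open>\<langle>x\<^sub>i | R\<rangle>\<close> and \<open>\<langle>y\<^sub>i | S\<rangle>\<close> does not depend on the choice of the presentations;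
  here \<open>R\<close> and \<open>S\<close> consist of all relators of the given groups.
\<close>

definition comix :: "'i set \<Rightarrow> ('g, 'm) monoid_scheme \<Rightarrow> ('i \<Rightarrow> 'g) \<Rightarrow>
    ('h, 'n) monoid_scheme \<Rightarrow> ('i \<Rightarrow> 'h) \<Rightarrow> ('i + 'i) word set monoid" where
  "comix I G x H y =
     presented_group (I <+> I)
       (map (map_prod Inl id) ` relators I G x \<union>
        map (map_prod Inr id) ` relators I H y \<union>
        (\<lambda>i. [(Inl i, False), (Inr i, True)]) ` I)"

definition rotation_comix :: "'a based_poset \<Rightarrow> 'b based_poset \<Rightarrow> (nat + nat) word set monoid" where
  "rotation_comix P Q =
     comix {1..<poset_rank P} (rotation_group P) (rot P) (rotation_group Q) (rot Q)"


section \<open>The mix\<close>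

definition mix_group :: "'i set \<Rightarrow> 'g monoid \<Rightarrow> ('i \<Rightarrow> 'g) \<Rightarrow> 'h monoid \<Rightarrow> ('i \<Rightarrow> 'h) \<Rightarrow>
    ('g \<times> 'h) monoid" where
  "mix_group I G x H y = subgroup_generated (G \<times>\<times> H) ((\<lambda>i. (x i, y i)) ` I)"

definition tau :: "('g, 'm) monoid_scheme \<Rightarrow> (nat \<Rightarrow> 'g) \<Rightarrow> nat \<Rightarrow> nat \<Rightarrow> 'g" where
  "tau G s i j = foldr (\<lambda>k g. s k \<otimes>\<^bsub>G\<^esub> g) [i..<Suc j] \<one>\<^bsub>G\<^esub>"

text \<open>The subgroup \<open>G\<^sub>I\<close> of a group with specified generators \<open>s\<^sub>1, \<dots>, s\<^bsub>n-1\<^esub>\<close>.\<close>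

definition tau_subgroup ::
    "nat \<Rightarrow> ('g, 'm) monoid_scheme \<Rightarrow> (nat \<Rightarrow> 'g) \<Rightarrow> nat set \<Rightarrow> 'g set" where
  "tau_subgroup n G s I =
     generate G {tau G s i j | i j. 1 \<le> i \<and> i \<le> j \<and> j < n \<and> i - 1 \<in> I \<and> j \<in> I}"

text \<open>
  The stabiliser of the base face of rank \<open>j\<close>. For \<open>j = -1\<close> and \<open>j = n\<close> it is the group generated
  by \<open>s\<^sub>1, \<dots>, s\<^bsub>n-1\<^esub>\<close>.
\<close>

definition face_stabilizer ::
    "nat \<Rightarrow> ('g, 'm) monoid_scheme \<Rightarrow> (nat \<Rightarrow> 'g) \<Rightarrow> int \<Rightarrow> 'g set" where
  "face_stabilizer n G s j = tau_subgroup n G s {k. k < n \<and> int k \<noteq> j}"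

text \<open>
  The construction by Schulte and Weiss of the poset with rotation group \<open>G\<close>: the \<open>j\<close>-faces
  are the right cosets of the stabiliser of the base \<open>j\<close>-face (the group acts on the right), and
  two faces are incident if the cosets intersect.
\<close>

definition coset_faces ::
    "nat \<Rightarrow> ('g, 'm) monoid_scheme \<Rightarrow> (nat \<Rightarrow> 'g) \<Rightarrow> (int \<times> 'g set) set" where
  "coset_faces n G s =
     (SIGMA j:{-1..int n}. rcosets\<^bsub>G\<^esub> (face_stabilizer n G s j))"

definition coset_poset ::
    "nat \<Rightarrow> ('g, 'm) monoid_scheme \<Rightarrow> (nat \<Rightarrow> 'g) \<Rightarrow> (int \<times> 'g set) based_poset" where
  "coset_poset n G s =
     \<lparr>faces = coset_faces n G s,
      incidence = {((i, A), (j, B)). (i, A) \<in> coset_faces n G s \<and> (j, B) \<in> coset_faces n G s \<and>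
                     i \<le> j \<and> A \<inter> B \<noteq> {}},
      face_rank = fst,
      poset_rank = n,
      base_flag = (\<lambda>j. (j, face_stabilizer n G s j)) ` {-1..int n}\<rparr>"

text \<open>Intended for \<open>P\<close> and \<open>Q\<close> of the same rank.\<close>

definition mix :: "'a based_poset \<Rightarrow> 'b based_poset \<Rightarrow>
    (int \<times> (('a \<Rightarrow> 'a) \<times> ('b \<Rightarrow> 'b)) set) based_poset" where
  "mix P Q =
     coset_poset (poset_rank P)
       (mix_group {1..<poset_rank P} (rotation_group P) (rot P) (rotation_group Q) (rot Q))
       (\<lambda>i. (rot P i, rot Q i))"

end

theory Submission
  imports Defs
begin

text \<open>
  Write \<open>\<Gamma>\<^sup>+(P) = \<langle>a, b\<rangle>\<close> with \<open>a = \<sigma>\<^sub>1\<close> and \<open>b = \<sigma>\<^sub>2\<close>. Inside its automorphism group, the mirror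
  image has the generators \<open>a\<inverse>, a\<^sup>2 b\<close> and the dual has \<open>b\<inverse>, a\<inverse>\<close>. The intersection property of the
  mix with the dual is inherited from the two coordinates, and exchanging the two coordinates is
  an automorphism that induces the duality.

  The order of the comix times the order of the mix is the product of the orders of the two
  groups, so the hypothesis says that the mix with the mirror image has more than \<open>p q / \<ell>\<^sub>1\<^sup>2\<close>
  times as many elements as the mix with the dual. If the latter were not chiral, it would have an
  endomorphism with \<open>\<sigma>\<^sub>1 \<mapsto> \<sigma>\<^sub>1\<inverse>\<close> and \<open>\<sigma>\<^sub>2 \<mapsto> \<sigma>\<^sub>1\<^sup>2 \<sigma>\<^sub>2\<close>, and would therefore map onto the mix with
  the mirror image. The kernel of that map contains \<open>\<sigma>\<^sub>1\<^sup>p\<close> and \<open>\<sigma>\<^sub>2\<^sup>q\<close>, which have orders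
  \<open>\<ell>\<^sub>1 / p\<close> and \<open>\<ell>\<^sub>1 / q\<close> and generate subgroups with trivial intersection, so it has at least
  \<open>\<ell>\<^sub>1\<^sup>2 / (p q)\<close> elements, a contradiction.
\<close>

section \<open>Words and the order of the comix\<close>

text \<open>The constant in the hypothesis measures a difference of types. In the mix with the dual,
  the two coordinates of each generator have orders p and q, so both generators have order lcm(p,
  q). In the mirror image, a (ab) equals a b^-1 a^-1, because ab is an involution; its generators
  therefore still have orders p and q, and so have those of the mix with the mirror image. A map
  between the mixes that respects the generators has to absorb this difference in its kernel. The
  map is k -> (k_1, theta(k)_1), where theta is the endomorphism of the overview and the index
  denotes the first coordinate. Chirality is a statement about orbits of flags, so the group
  argument has to be tied to posets at both ends. The flags of the given polyhedron yield generation
  by a and b, the relation (ab)^2 = 1 and the intersection property. Conversely, for a group with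
  these properties the coset poset is shown to be a polytope whose flags form two copies of the
  group; an automorphism that joins the two copies is the source of theta.\<close>

lemma (in group_hom) order_eq_card_kernel_mult_card_image:
  "order G = card (kernel G H h) * card (h ` carrier G)"
proof -
  interpret N: normal "kernel G H h" G by (rule normal_kernel)
  have "h ` carrier G = (\<lambda>Z. the_elem (h ` Z)) ` carrier (G Mod (kernel G H h))"
  proof -
    have *: "the_elem (h ` (kernel G H h #> g)) = h g" if "g \<in> carrier G" for g
    proof -
      have "h ` (kernel G H h #> g) = {h g}"
        using that N.one_closed unfolding r_coset_def kernel_def by force
      then show ?thesis by simp
    qed
    show ?thesis
      unfolding FactGroup_def RCOSETS_def by (auto simp: * image_iff)
  qed
  then have "card (h ` carrier G) = card (rcosets (kernel G H h))"
    using card_image[OF FactGroup_inj_on] by (simp add: FactGroup_def)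
  then show ?thesis using G.lagrange[OF subgroup_kernel] by (simp add: mult.commute)
qed

section \<open>Signed words, formal inverses and evaluation in a group\<close>

lemma words_Nil [simp]: "[] \<in> words I"
  and words_Cons [simp]: "(i, b) # w \<in> words I \<longleftrightarrow> i \<in> I \<and> w \<in> words I"
  and words_append [simp]: "u @ v \<in> words I \<longleftrightarrow> u \<in> words I \<and> v \<in> words I"
  by (auto simp: words_def)

definition inverse_word :: "'i word \<Rightarrow> 'i word" where
  "inverse_word w = rev (map (map_prod id Not) w)"

lemma inverse_word_Nil [simp]: "inverse_word [] = []"
  and inverse_word_Cons: "inverse_word ((i, b) # w) = inverse_word w @ [(i, \<not> b)]"
  by (simp_all add: inverse_word_def)

lemma inverse_word_words [simp]: "w \<in> words I \<Longrightarrow> inverse_word w \<in> words I"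
  by (induction w) (auto simp: inverse_word_Cons)

lemma inverse_word_map: "map (map_prod f id) (inverse_word w) =
    inverse_word (map (map_prod f id) w)"
  by (simp add: inverse_word_def rev_map map_prod_def case_prod_unfold o_def)

lemma word_value_Nil [simp]: "word_value G x [] = \<one>\<^bsub>G\<^esub>"
  and word_value_Cons: "word_value G x ((i, b) # w) =
    (if b then x i else inv\<^bsub>G\<^esub> (x i)) \<otimes>\<^bsub>G\<^esub> word_value G x w"
  by (simp_all add: word_value_def)

lemma word_value_map:
  "word_value G x (map (map_prod f id) w) = word_value G (x \<circ> f) w"
  by (induction w) (auto simp: word_value_Cons)

context group
begin

lemma word_value_closed:
  "x \<in> I \<rightarrow> carrier G \<Longrightarrow> w \<in> words I \<Longrightarrow> word_value G x w \<in> carrier G"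
  by (induction w) (auto simp: word_value_Cons Pi_iff)

lemma word_value_append:
  "x \<in> I \<rightarrow> carrier G \<Longrightarrow> u \<in> words I \<Longrightarrow> v \<in> words I \<Longrightarrow>
    word_value G x (u @ v) = word_value G x u \<otimes> word_value G x v"
proof (induction u)
  case (Cons l u)
  obtain i b where l: "l = (i, b)" by force
  have "x i \<in> carrier G" using Cons.prems l by auto
  with Cons l word_value_closed[of x I] show ?case by (auto simp: word_value_Cons m_assoc)
qed (simp add: word_value_closed)

lemma word_value_inverse:
  "x \<in> I \<rightarrow> carrier G \<Longrightarrow> w \<in> words I \<Longrightarrow>
    word_value G x (inverse_word w) = inv (word_value G x w)"
proof (induction w)
  case (Cons l w)
  obtain i b where l: "l = (i, b)" by force
  have "x i \<in> carrier G" using Cons.prems l by auto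
  with Cons l word_value_closed[of x I] show ?case
    by (auto simp: word_value_Cons inverse_word_Cons word_value_append[of x I] inv_mult_group)
qed simp

text \<open>Lets an element of a generated subgroup be replaced by a word, so that the same word can
  be evaluated in a second group. This is how relators of one group are compared with elements of
  another.\<close>

lemma generate_eq_word_values:
  assumes x: "x \<in> I \<rightarrow> carrier G"
  shows "generate G (x ` I) = word_value G x ` words I"
proof
  show "generate G (x ` I) \<subseteq> word_value G x ` words I"
  proof
    fix g assume "g \<in> generate G (x ` I)"
    then show "g \<in> word_value G x ` words I"
    proof induction
      case one
      then show ?case by (force intro: image_eqI[of _ _ "[]"])
    next
      case (incl h)
      then obtain i where "i \<in> I" "h = x i" by auto
      with x show ?case
        by (intro image_eqI[of _ _ "[(i, True)]"]) (auto simp: word_value_Cons Pi_iff)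
    next
      case (inv h)
      then obtain i where "i \<in> I" "h = x i" by auto
      with x show ?case
        by (intro image_eqI[of _ _ "[(i, False)]"]) (auto simp: word_value_Cons Pi_iff)
    next
      case (eng h k)
      then obtain u v where "u \<in> words I" "v \<in> words I" "h = word_value G x u" "k =
          word_value G x v"
        by auto
      then show ?case
        using x by (auto intro!: image_eqI[of _ _ "u @ v"] simp: word_value_append)
    qed
  qed
next
  have "word_value G x w \<in> generate G (x ` I)" if "w \<in> words I" for w
    using that
  proof (induction w)
    case (Cons l w)
    obtain i b where l: "l = (i, b)" by force
    with Cons have "x i \<in> x ` I" "word_value G x w \<in> generate G (x ` I)" by auto
    then show ?case
      by (auto simp: l word_value_Cons intro: generate.eng generate.incl generate.inv)
  qed (simp add: generate.one)
  then show "word_value G x ` words I \<subseteq> generate G (x ` I)" by auto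
qed

end

lemma word_value_DirProd:
  assumes "group G" "group H" "x \<in> I \<rightarrow> carrier G" "y \<in> I \<rightarrow> carrier H" "w \<in> words I"
  shows "word_value (G \<times>\<times> H) (\<lambda>i. (x i, y i)) w = (word_value G x w, word_value H y w)"
  using assms(5)
proof (induction w)
  case (Cons l w)
  obtain i b where l: "l = (i, b)" by force
  have "x i \<in> carrier G" "y i \<in> carrier H" using Cons.prems l assms by auto
  with Cons l show ?case by (auto simp: word_value_Cons inv_DirProd[OF assms(1,2)])
qed simp

section \<open>The congruence on words generated by a set of relators\<close>

lemma word_equiv_words: "word_equiv I R u v \<Longrightarrow> u \<in> words I \<and> v \<in> words I"
  by (induction rule: word_equiv.induct) auto

lemma word_equiv_append_left:
  "word_equiv I R u v \<Longrightarrow> w \<in> words I \<Longrightarrow> word_equiv I R (w @ u) (w @ v)"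
proof (induction rule: word_equiv.induct)
  case (cancel u v i b)
  then show ?case using word_equiv.cancel[of "w @ u" I v i R b] by simp
next
  case (relator u v r)
  then show ?case using word_equiv.relator[of "w @ u" I v r R] by simp
qed (auto intro: word_equiv.intros)

lemma word_equiv_append_right:
  "word_equiv I R u v \<Longrightarrow> w \<in> words I \<Longrightarrow> word_equiv I R (u @ w) (v @ w)"
proof (induction rule: word_equiv.induct)
  case (cancel u v i b)
  then show ?case using word_equiv.cancel[of u I "v @ w" i R b] by simp
next
  case (relator u v r)
  then show ?case using word_equiv.relator[of u I "v @ w" r R] by simp
qed (auto intro: word_equiv.intros)

lemma word_equiv_append:
  "word_equiv I R u u' \<Longrightarrow> word_equiv I R v v' \<Longrightarrow> word_equiv I R (u @ v) (u' @ v')"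
  by (meson word_equiv.trans word_equiv_append_left word_equiv_append_right word_equiv_words)

lemma word_equiv_inverse_right:
  "w \<in> words I \<Longrightarrow> word_equiv I R (w @ inverse_word w) []"
proof (induction w)
  case (Cons l w)
  obtain i b where l: "l = (i, b)" by force
  with Cons have w: "w \<in> words I" "i \<in> I" by auto
  have "word_equiv I R ([(i, b)] @ (w @ inverse_word w) @ [(i, \<not> b)]) ([(i, b)] @ [] @ [(i, \<not> b)])"
    using Cons.IH w by (intro word_equiv_append) (auto intro: word_equiv.refl)
  moreover have "word_equiv I R [(i, b), (i, \<not> b)] []"
    using word_equiv.cancel[of "[]" I "[]" i R b] w by simp
  ultimately show ?case by (auto simp: l inverse_word_Cons intro: word_equiv.trans)
qed (simp add: word_equiv.refl)

lemma word_equiv_inverse_left: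
  "w \<in> words I \<Longrightarrow> word_equiv I R (inverse_word w @ w) []"
proof -
  have "inverse_word (inverse_word w) = w" by (induction w) (auto simp: inverse_word_def)
  then show "w \<in> words I \<Longrightarrow> ?thesis"
    using word_equiv_inverse_right[of "inverse_word w" I R] by simp
qed

text \<open>The relators x_i^-1 y_i identify the two alphabets, so every word of the comix can be
  rewritten in the first one; \<open>case_sum id id\<close> forgets from which copy of
  \<open>I\<close> a letter came.\<close>

lemma word_equiv_comix_Inl:
  assumes "w \<in> words (I <+> I)"
    and R: "\<And>i. i \<in> I \<Longrightarrow> [(Inl i, False), (Inr i, True)] \<in> R"
  shows "word_equiv (I <+> I) R w (map (map_prod (\<lambda>k. Inl (case_sum id id k)) id) w)"
  using assms(1)
proof (induction w)
  case (Cons l w)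
  obtain k b where l: "l = (k, b)" by force
  have "word_equiv (I <+> I) R [(k, b)] [(Inl (case_sum id id k), b)]"
  proof (cases k)
    case (Inl i)
    then show ?thesis using Cons.prems l by (auto intro: word_equiv.refl)
  next
    case (Inr i)
    then have i: "i \<in> I" using Cons.prems l by auto
    show ?thesis
    proof (cases b)
      case True
      \<comment> \<open>The word x x^-1 y reduces to y by cancellation and to x by the relator; for
        inverse letters, x^-1 y y^-1 plays the same role below.\<close>
      have "word_equiv (I <+> I) R [(Inl i, True), (Inl i, False), (Inr i, True)] [(Inr i, True)]"
        using word_equiv.cancel[of "[]" "I <+> I" "[(Inr i, True)]" "Inl i" R True] i by auto
      moreover have
        "word_equiv (I <+> I) R [(Inl i, True), (Inl i, False), (Inr i, True)] [(Inl i, True)]"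
        using word_equiv.relator[of "[(Inl i, True)]" "I <+> I" "[]" _ R, OF _ _ R[OF i]] i by auto
      ultimately show ?thesis using True Inr by (auto intro: word_equiv.intros)
    next
      case False
      have "word_equiv (I <+> I) R [(Inl i, False), (Inr i, True), (Inr i, False)] [(Inl i, False)]"
        using word_equiv.cancel[of "[(Inl i, False)]" "I <+> I" "[]" "Inr i" R True] i by auto
      moreover have
        "word_equiv (I <+> I) R [(Inl i, False), (Inr i, True), (Inr i, False)] [(Inr i, False)]"
        using word_equiv.relator[of "[]" "I <+> I" "[(Inr i, False)]" _ R, OF _ _ R[OF i]] i by auto
      ultimately show ?thesis using False Inr by (auto intro: word_equiv.intros)
    qed
  qed
  then have "word_equiv (I <+> I) R ([(k, b)] @ w)
      ([(Inl (case_sum id id k), b)] @ map (map_prod (\<lambda>k. Inl (case_sum id id k)) id) w)"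
    using Cons.IH Cons.prems by (intro word_equiv_append) (simp_all only: l words_Cons)
  then show ?case by (simp add: l id_def)
qed (simp add: word_equiv.refl)

text \<open>
  The comix is the quotient of \<open>G\<close> by the subgroup of values of the relators of \<open>H\<close>, and the mix is
  an extension of \<open>H\<close> by the same subgroup.
\<close>

lemma order_comix_mult_order_mix_group:
  fixes G :: "'g monoid" and H :: "'h monoid"
  assumes G: "group G" and H: "group H"
    and x: "x \<in> I \<rightarrow> carrier G" and y: "y \<in> I \<rightarrow> carrier H"
    and gen_G: "generate G (x ` I) = carrier G" and gen_H: "generate H (y ` I) = carrier H"
  shows "order (comix I G x H y) * order (mix_group I G x H y) = order G * order H"
proof -
  interpret G: group G by fact
  interpret H: group H by fact
  interpret GH: group "G \<times>\<times> H" by (rule DirProd_group[OF G H])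
  define N where "N = word_value G x ` relators I H y"
  have sur: "\<exists>w\<in>words I. g = word_value G x w" if "g \<in> carrier G" for g
    using that gen_G G.generate_eq_word_values[OF x] by auto
  have N: "N \<lhd> G"
  proof (rule G.normal_invI)
    show "subgroup N G"
    proof
      show "N \<subseteq> carrier G"
        by (auto simp: N_def relators_def intro: G.word_value_closed[OF x])
      show "\<one>\<^bsub>G\<^esub> \<in> N"
        unfolding N_def relators_def by (rule image_eqI[of _ _ "[]"]) auto
      show "g \<otimes>\<^bsub>G\<^esub> h \<in> N" if gh: "g \<in> N" "h \<in> N" for g h
      proof -
        obtain u v where "u \<in> relators I H y" "v \<in> relators I H y"
          "g = word_value G x u" "h = word_value G x v"
          using gh unfolding N_def by auto
        then show ?thesis
          unfolding N_def relators_def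
          by (intro image_eqI[of _ _ "u @ v"])
            (auto simp: G.word_value_append[OF x] H.word_value_append[OF y])
      qed
      show "inv\<^bsub>G\<^esub> g \<in> N" if g: "g \<in> N" for g
      proof -
        obtain u where "u \<in> relators I H y" "g = word_value G x u"
          using g unfolding N_def by auto
        then show ?thesis
          unfolding N_def relators_def
          by (intro image_eqI[of _ _ "inverse_word u"])
            (auto simp: G.word_value_inverse[OF x] H.word_value_inverse[OF y])
      qed
    qed
    \<comment> \<open>Since \<open>x\<close> generates \<open>G\<close>, the conjugating element is
      the value of a word u, and u v u^-1 is a relator of \<open>H\<close> together with v.\<close>
    show "g \<otimes>\<^bsub>G\<^esub> h \<otimes>\<^bsub>G\<^esub> inv\<^bsub>G\<^esub> g \<in> N" if g: "g \<in> carrier G" and h: "h \<in> N" for g h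
    proof -
      obtain u v where uv: "u \<in> words I" "v \<in> relators I H y"
        "g = word_value G x u" "h = word_value G x v"
        using sur[OF g] h unfolding N_def by blast
      then have "word_value G x (u @ v @ inverse_word u) = g \<otimes>\<^bsub>G\<^esub> h \<otimes>\<^bsub>G\<^esub> inv\<^bsub>G\<^esub> g"
        using G.word_value_closed[OF x]
        by (auto simp: relators_def G.word_value_append[OF x] G.word_value_inverse[OF x] G.m_assoc)
      moreover have "u @ v @ inverse_word u \<in> relators I H y"
        using uv H.word_value_closed[OF y]
        by (auto simp: relators_def H.word_value_append[OF y] H.word_value_inverse[OF y])
      ultimately show ?thesis unfolding N_def by (metis image_eqI)
    qed
  qed
  interpret N: normal N G by (rule N)
  note sN = N.subgroup_axioms

  have comix: "order (comix I G x H y) * card N = order G"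
  proof -
    define J where "J = I <+> I"
    define R where "R = map (map_prod Inl id) ` relators I G x \<union>
        map (map_prod Inr id) ` relators I H y \<union>
        (\<lambda>i. [(Inl i, False), (Inr i, True)]) ` I"
    \<comment> \<open>Both copies of a generator are evaluated as the generator of \<open>G\<close>,
      and \<open>val\<close> records the coset of \<open>N\<close>. The goal is that two words are
      congruent iff they have the same \<open>val\<close>.\<close>
    define z where "z = case_sum x x"
    have z: "z \<in> J \<rightarrow> carrier G" using x by (auto simp: z_def J_def)
    define val where "val w = N #>\<^bsub>G\<^esub> word_value G z w" for w
    have rel: "word_value G z r \<in> N" if "r \<in> R" for r
    proof -
      have "word_value G z (map (map_prod Inl id) w) = word_value G x w"
        "word_value G z (map (map_prod Inr id) w) = word_value G x w" for w
        by (simp_all add: word_value_map z_def o_def)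
      then show ?thesis
        using that N.one_closed x
        by (auto simp: R_def relators_def word_value_Cons z_def Pi_iff)
          (auto simp: N_def relators_def)
    qed
    have val_eq: "word_equiv J R u v \<Longrightarrow> val u = val v" for u v
    proof (induction rule: word_equiv.induct)
      case (cancel u v i b)
      have "z i \<in> carrier G" using z cancel by auto
      then have "word_value G z [(i, b), (i, \<not> b)] = \<one>\<^bsub>G\<^esub>" by (auto simp: word_value_Cons)
      then show ?case
        using cancel G.word_value_append[OF z] G.word_value_closed[OF z]
        by (simp add: val_def del: append_Cons)
    next
      case (relator u v r)
      let ?u = "word_value G z u" and ?v = "word_value G z v" and ?r = "word_value G z r"
      have c: "?u \<in> carrier G" "?v \<in> carrier G" "?r \<in> carrier G"
        using relator G.word_value_closed[OF z] by auto
      \<comment> \<open>A relator in the middle of a word is moved to the front by conjugation,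
        where the normal subgroup \<open>N\<close> absorbs it.\<close>
      have "?u \<otimes>\<^bsub>G\<^esub> (?r \<otimes>\<^bsub>G\<^esub> ?v) = (?u \<otimes>\<^bsub>G\<^esub> ?r \<otimes>\<^bsub>G\<^esub> inv\<^bsub>G\<^esub> ?u) \<otimes>\<^bsub>G\<^esub> (?u \<otimes>\<^bsub>G\<^esub> ?v)"
        using c by (simp add: G.m_assoc G.inv_solve_left)
      moreover have "?u \<otimes>\<^bsub>G\<^esub> ?r \<otimes>\<^bsub>G\<^esub> inv\<^bsub>G\<^esub> ?u \<in> N"
        using N.inv_op_closed2 c rel relator by simp
      ultimately have "N #>\<^bsub>G\<^esub> (?u \<otimes>\<^bsub>G\<^esub> (?r \<otimes>\<^bsub>G\<^esub> ?v)) = N #>\<^bsub>G\<^esub> (?u \<otimes>\<^bsub>G\<^esub> ?v)"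
        using c by (metis G G.coset_mult_assoc G.m_closed N.mem_carrier N.rcos_const N.subset)
      then show ?case
        using relator by (simp add: val_def G.word_value_append[OF z])
    qed auto
    have inl: "word_equiv J R w (map (map_prod (\<lambda>k. Inl (case_sum id id k)) id) w)"
        if "w \<in> words J" for w
      using that unfolding J_def by (rule word_equiv_comix_Inl) (auto simp: R_def)
    have Inl_words: "map (map_prod Inl id) w \<in> words J" "map (map_prod Inr id) w \<in> words J"
      if "w \<in> words I" for w
      using that by (induction w) (auto simp: J_def)
    \<comment> \<open>Relators of \<open>H\<close>, imposed in the second alphabet, vanish also when
      spelled in the first one, by \<open>inl\<close>.\<close>
    have triv: "word_equiv J R (map (map_prod Inl id) w) []" if "w \<in> relators I G x \<union> relators I H
        y" for w
    proof -
      from that have w: "w \<in> words I" by (auto simp: relators_def)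
      show ?thesis
      proof (cases "w \<in> relators I G x")
        case True
        then have "map (map_prod Inl id) w \<in> R" by (auto simp: R_def)
        then show ?thesis
          using word_equiv.relator[of "[]" J "[]" "map (map_prod Inl id) w" R] w Inl_words by auto
      next
        case False
        then have "map (map_prod Inr id) w \<in> R" using that by (auto simp: R_def)
        then have "word_equiv J R (map (map_prod Inr id) w) []"
          using word_equiv.relator[of "[]" J "[]" "map (map_prod Inr id) w" R] w Inl_words by auto
        moreover have "word_equiv J R (map (map_prod Inr id) w) (map (map_prod Inl id) w)"
          using inl[OF Inl_words(2)[OF w]] by (simp add: o_def map_prod_def case_prod_unfold)
        ultimately show ?thesis by (blast intro: word_equiv.intros)
      qed
    qed
    have equiv_val: "word_equiv J R u v" if u: "u \<in> words J" and v: "v \<in> words J" and eq: "val u =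
        val v" for u v
    proof -
      define u' v' where "u' = map (map_prod (case_sum id id) id) u"
        and "v' = map (map_prod (case_sum id id) id) v"
      have uv': "u' \<in> words I" "v' \<in> words I"
        using u v unfolding u'_def v'_def words_def J_def by (auto simp: lists_eq_set)
      have zs: "z = x \<circ> case_sum id id" by (auto simp: z_def fun_eq_iff split: sum.splits)
      have vals: "word_value G z u = word_value G x u'" "word_value G z v = word_value G x v'"
        by (simp_all add: u'_def v'_def word_value_map zs)
      have "word_value G x u' \<in> N #>\<^bsub>G\<^esub> word_value G x v'"
        using eq sN G.word_value_closed[OF x uv'(1)] vals unfolding val_def
        by (metis G.rcos_self)
      then obtain n where n: "n \<in> relators I H y"
        "word_value G x u' = word_value G x n \<otimes>\<^bsub>G\<^esub> word_value G x v'"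
        unfolding N_def r_coset_def by auto
      then have nw: "n \<in> words I" by (auto simp: relators_def)
      \<comment> \<open>Equal cosets give u' = n v' in \<open>G\<close> for a relator n of
        \<open>H\<close>. Hence u' (n v')^-1 is a relator of \<open>G\<close>, and both it and n are
        trivial in the comix.\<close>
      define r where "r = u' @ inverse_word (n @ v')"
      have "r \<in> relators I G x"
        using n nw uv' G.word_value_closed[OF x]
        by (auto simp: r_def relators_def G.word_value_append[OF x] G.word_value_inverse[OF x])
      then have "word_equiv J R (map (map_prod Inl id) r) []" using triv by auto
      then have "word_equiv J R (map (map_prod Inl id) r @ map (map_prod Inl id) (n @ v')) (map
          (map_prod Inl id) (n @ v'))"
        using word_equiv_append_right[of J R _ "[]"] Inl_words nw uv' by auto
      moreover have "word_equiv J R (map (map_prod Inl id) r @ map (map_prod Inl id) (n @ v'))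
          (map (map_prod Inl id) u')"
        using word_equiv_append_left[OF word_equiv_inverse_left[of "map (map_prod Inl id) (n @
            v')" J R],
            of "map (map_prod Inl id) u'"] Inl_words nw uv'
        by (auto simp: r_def inverse_word_map)
      ultimately have "word_equiv J R (map (map_prod Inl id) u') (map (map_prod Inl id) (n @ v'))"
        by (blast intro: word_equiv.intros)
      moreover have "word_equiv J R (map (map_prod Inl id) (n @ v')) (map (map_prod Inl id) v')"
        using word_equiv_append_right[OF triv[of n]] n Inl_words uv' by auto
      moreover have "word_equiv J R u (map (map_prod Inl id) u')"
          "word_equiv J R v (map (map_prod Inl id) v')"
        using inl u v by (simp_all add: u'_def v'_def o_def map_prod_def case_prod_unfold)
      ultimately show ?thesis by (blast intro: word_equiv.intros)
    qed
    let ?E = "{(u, v). word_equiv J R u v}"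
    have cls: "?E `` {u} = {w \<in> words J. val w = val u}" if "u \<in> words J" for u
    proof -
      have "word_equiv J R u w \<longleftrightarrow> w \<in> words J \<and> val w = val u" for w
        using val_eq[of u w] equiv_val[OF that, of w] word_equiv_words[of J R u w] by auto
      then show ?thesis by auto
    qed
    have "order (comix I G x H y) = card (words J // ?E)"
      by (simp add: order_def comix_def presented_group_def J_def R_def)
    \<comment> \<open>The congruence classes are the fibres of \<open>val\<close>, so they are
      counted by its values, the cosets of \<open>N\<close>.\<close>
    also have "words J // ?E = (\<lambda>c. {w \<in> words J. val w = c}) ` (val ` words J)"
    proof -
      have "words J // ?E = (\<lambda>u. ?E `` {u}) ` words J" unfolding quotient_def by blast
      also have "\<dots> = (\<lambda>u. {w \<in> words J. val w = val u}) ` words J"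
        by (rule image_cong[OF HOL.refl cls])
      finally show ?thesis by (simp add: image_image)
    qed
    also have "card \<dots> = card (val ` words J)"
      by (rule card_image) (auto simp: inj_on_def)
    also have "val ` words J = rcosets\<^bsub>G\<^esub> N"
    proof
      show "val ` words J \<subseteq> rcosets\<^bsub>G\<^esub> N"
        using G.word_value_closed[OF z] by (auto simp: RCOSETS_def val_def)
      show "rcosets\<^bsub>G\<^esub> N \<subseteq> val ` words J"
      proof
        fix Z assume "Z \<in> rcosets\<^bsub>G\<^esub> N"
        then obtain w where "w \<in> words I" "Z = N #>\<^bsub>G\<^esub> word_value G x w"
          using sur unfolding RCOSETS_def by blast
        then show "Z \<in> val ` words J"
          by (intro image_eqI[of _ _ "map (map_prod Inl id) w"])
            (auto simp: val_def word_value_map z_def o_def Inl_words)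
      qed
    qed
    finally show ?thesis using G.lagrange[OF sN] by simp
  qed

  have mix: "order (mix_group I G x H y) = card N * order H"
  proof -
    let ?M = "mix_group I G x H y" and ?s = "\<lambda>i. (x i, y i)"
    have s: "?s \<in> I \<rightarrow> carrier (G \<times>\<times> H)" using x y by auto
    then have "carrier (G \<times>\<times> H) \<inter> ?s ` I = ?s ` I" by blast
    then have "carrier ?M = generate (G \<times>\<times> H) (?s ` I)"
      by (simp add: mix_group_def carrier_subgroup_generated)
    also have "\<dots> = word_value (G \<times>\<times> H) ?s ` words I" by (rule GH.generate_eq_word_values[OF s])
    finally have car: "carrier ?M = (\<lambda>w. (word_value G x w, word_value H y w)) ` words I"
      using word_value_DirProd[OF G H x y] by simp
    have "group_hom ?M H snd"
      unfolding group_hom_def group_hom_axioms_def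
    proof (intro conjI)
      show "group ?M" by (simp add: mix_group_def)
      show "snd \<in> hom ?M H"
        by (auto simp: hom_def mix_group_def car[unfolded mix_group_def] intro:
            H.word_value_closed[OF y])
    qed fact
    then interpret M: group_hom ?M H snd .
    \<comment> \<open>A pair of word values has trivial second coordinate exactly when the word is a
      relator of \<open>H\<close>; the first coordinates of such pairs make up
      \<open>N\<close>.\<close>
    have "kernel ?M H snd = N \<times> {\<one>\<^bsub>H\<^esub>}"
      unfolding kernel_def car N_def relators_def by auto
    then have "card (kernel ?M H snd) = card N" by (simp add: card_cartesian_product)
    moreover have "snd ` carrier ?M = carrier H"
      using gen_H H.generate_eq_word_values[OF y] unfolding car by (auto simp: image_image)
    ultimately show ?thesis
      using M.order_eq_card_kernel_mult_card_image by (simp add: order_def)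
  qed
  show ?thesis using comix mix by (metis mult.assoc)
qed


section \<open>Flags and automorphisms of a polytope\<close>

locale polytope =
  fixes P :: "'a based_poset"
  assumes polytope: "abstract_polytope P"
begin

abbreviation le :: "'a \<Rightarrow> 'a \<Rightarrow> bool" where "le x y \<equiv> (x, y) \<in> incidence P"
abbreviation rk :: "'a \<Rightarrow> int" where "rk \<equiv> face_rank P"
abbreviation n :: nat where "n \<equiv> poset_rank P"

section \<open>Flags as chains with one face of each rank\<close>

lemma le_trans: "le x y \<Longrightarrow> le y z \<Longrightarrow> le x z"
  using polytope by (auto simp: abstract_polytope_def partial_order_on_def preorder_on_def dest:
      transD)

lemma le_refl: "x \<in> faces P \<Longrightarrow> le x x"
  using polytope by (auto simp: abstract_polytope_def partial_order_on_def preorder_on_def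
      refl_on_def)

lemma rk_range: "x \<in> faces P \<Longrightarrow> rk x \<in> {-1..int n}"
  using polytope by (auto simp: abstract_polytope_def)

lemma rk_less: "le x y \<Longrightarrow> x \<noteq> y \<Longrightarrow> rk x < rk y"
  using polytope by (auto simp: abstract_polytope_def)

text \<open>The rank is injective on a chain and has n + 2 possible values, so n + 2 faces means a
  face of each rank. Such a chain cannot be extended, since a new face would share its rank with an
  old one.\<close>

lemma flag_iff:
  "C \<in> flags P \<longleftrightarrow> C \<subseteq> faces P \<and> (\<forall>x\<in>C. \<forall>y\<in>C. le x y \<or> le y x) \<and> rk ` C = {-1..int n}"
  (is "_ \<longleftrightarrow> ?R")
proof
  assume C: "C \<in> flags P"
  have sub: "C \<subseteq> faces P" and ch: "\<forall>x\<in>C. \<forall>y\<in>C. le x y \<or> le y x"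
    using C le_refl by (auto simp: flags_def pred_on.maxchain_def pred_on.chain_def)
  have card: "card C = n + 2" using C polytope by (auto simp: abstract_polytope_def)
  \<comment> \<open>\<open>card\<close> of an infinite set is 0, so the value n + 2 forces
    finiteness.\<close>
  then have "finite C" by (metis add_is_0 card.infinite zero_neq_numeral)
  have "inj_on rk C"
    using ch rk_less by (metis inj_onI less_irrefl)
  then have "card (rk ` C) = card {-1..int n}" using card by (simp add: card_image)
  then have "rk ` C = {-1..int n}"
    using sub rk_range by (intro card_subset_eq) auto
  with sub ch show ?R by auto
next
  assume R: ?R
  have "\<not> C \<subset> D" if D: "pred_on.chain (faces P) le D" for D
  proof
    assume "C \<subset> D"
    then obtain d where d: "d \<in> D" "d \<notin> C" by auto
    then have "d \<in> faces P" using D by (auto simp: pred_on.chain_def)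
    then have "rk d \<in> rk ` C" using R rk_range by simp
    then obtain c where c: "c \<in> C" "rk c = rk d" by auto
    then have "le c d \<or> le d c" "c \<noteq> d" using D d \<open>C \<subset> D\<close> by (auto simp: pred_on.chain_def)
    then show False using c rk_less by fastforce
  qed
  moreover have "pred_on.chain (faces P) le C" using R by (auto simp: pred_on.chain_def)
  ultimately show "C \<in> flags P" by (auto simp: flags_def pred_on.maxchain_def)
qed

lemma flag_subset: "C \<in> flags P \<Longrightarrow> C \<subseteq> faces P" by (simp add: flag_iff)

lemma flag_total: "C \<in> flags P \<Longrightarrow> x \<in> C \<Longrightarrow> y \<in> C \<Longrightarrow> le x y \<or> le y x" by (simp add: flag_iff)

lemma chain_inj_rk: "(\<forall>x\<in>C. \<forall>y\<in>C. le x y \<or> le y x) \<Longrightarrow> inj_on rk C"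
  using rk_less by (metis inj_onI less_irrefl)

lemma flag_card: "C \<in> flags P \<Longrightarrow> card C = n + 2"
  using polytope by (auto simp: abstract_polytope_def)

lemma flag_finite: "C \<in> flags P \<Longrightarrow> finite C"
  using flag_card by (metis add_is_0 card.infinite zero_neq_numeral)

lemma flag_cardI:
  assumes "C \<subseteq> faces P" "\<forall>x\<in>C. \<forall>y\<in>C. le x y \<or> le y x" "card C = n + 2"
  shows "C \<in> flags P"
proof -
  have "card (rk ` C) = card {-1..int n}" using assms chain_inj_rk by (simp add: card_image)
  then have "rk ` C = {-1..int n}"
    using assms rk_range by (intro card_subset_eq) auto
  then show ?thesis using assms flag_iff by auto
qed

text \<open>Meaningful only for a flag and a rank from -1 to n. It turns a flag into a function of
  the rank, so that flags can be compared rank by rank.\<close>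

definition face :: "'a set \<Rightarrow> int \<Rightarrow> 'a" where
  "face C k = (THE x. x \<in> C \<and> rk x = k)"

lemma face_eqI: "C \<in> flags P \<Longrightarrow> x \<in> C \<Longrightarrow> rk x = k \<Longrightarrow> face C k = x"
  unfolding face_def using chain_inj_rk[of C] by (auto simp: flag_iff inj_on_def)

lemma face_rk: "C \<in> flags P \<Longrightarrow> x \<in> C \<Longrightarrow> face C (rk x) = x"
  by (simp add: face_eqI)

lemma face_in:
  assumes "C \<in> flags P" "-1 \<le> k" "k \<le> int n"
  shows "face C k \<in> C" "rk (face C k) = k"
proof -
  have "k \<in> rk ` C" using assms flag_iff by auto
  then obtain x where "x \<in> C" "rk x = k" by auto
  then show "face C k \<in> C" "rk (face C k) = k" using face_eqI[OF assms(1)] by auto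
qed

lemma flag_rk: "C \<in> flags P \<Longrightarrow> x \<in> C \<Longrightarrow> -1 \<le> rk x \<and> rk x \<le> int n"
  using rk_range flag_subset by fastforce

lemma flag_eqI:
  assumes "C \<in> flags P" "D \<in> flags P" "\<And>k. -1 \<le> k \<Longrightarrow> k \<le> int n \<Longrightarrow> face C k = face D k"
  shows "C = D"
proof (intro equalityI subsetI)
  fix x assume x: "x \<in> C"
  then have "face C (rk x) = x" "-1 \<le> rk x" "rk x \<le> int n"
    using face_eqI[OF assms(1)] flag_rk[OF assms(1)] by auto
  then show "x \<in> D" using assms(3) face_in(1)[OF assms(2)] by metis
next
  fix x assume x: "x \<in> D"
  then have "face D (rk x) = x" "-1 \<le> rk x" "rk x \<le> int n"
    using face_eqI[OF assms(2)] flag_rk[OF assms(2)] by auto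
  then show "x \<in> C" using assms(3) face_in(1)[OF assms(1)] by metis
qed

lemma flag_le_iff:
  "C \<in> flags P \<Longrightarrow> x \<in> C \<Longrightarrow> y \<in> C \<Longrightarrow> le x y \<longleftrightarrow> rk x \<le> rk y"
  using flag_total[of C x y] rk_less[of x y] rk_less[of y x] le_refl flag_subset by fastforce

lemma face_extreme_eq:
  assumes "C \<in> flags P" "D \<in> flags P"
  shows "face C (-1) = face D (-1)" "face C (int n) = face D (int n)"
proof -
  obtain L where L: "L \<in> faces P" "rk L = -1" "\<forall>F\<in>faces P. le L F"
    using polytope by (auto simp: abstract_polytope_def)
  obtain U where U: "U \<in> faces P" "rk U = int n" "\<forall>F\<in>faces P. le F U"
    using polytope by (auto simp: abstract_polytope_def)
  have "face W (-1) = L" "face W (int n) = U" if "W \<in> flags P" for W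
  proof -
    have "face W (-1) \<in> faces P" "rk (face W (-1)) = -1"
      "face W (int n) \<in> faces P" "rk (face W (int n)) = int n"
      using face_in[OF that] flag_subset[OF that] by auto
    then show "face W (-1) = L" "face W (int n) = U"
      using L U rk_less by (metis less_irrefl)+
  qed
  then show "face C (-1) = face D (-1)" "face C (int n) = face D (int n)" using assms by auto
qed

section \<open>The diamond condition and the exchange of one face\<close>

lemma between_card:
  assumes "C \<in> flags P" "j < n"
  shows "card {H \<in> faces P. rk H = int j \<and> le (face C (int j - 1)) H \<and>
      le H (face C (int j + 1))} = 2"
proof -
  let ?L = "face C (int j - 1)" and ?U = "face C (int j + 1)"
  have "?L \<in> C" "?U \<in> C" "rk ?L = int j - 1" "rk ?U = int j + 1"
    using assms by (simp_all add: face_in)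
  then have "?L \<in> faces P" "?U \<in> faces P" "le ?L ?U" "rk ?U = rk ?L + 2" "rk ?L + 1 = int j"
    using assms flag_subset flag_le_iff by auto
  then show ?thesis using polytope by (auto simp: abstract_polytope_def diamond_condition_def)
qed

lemma face_between:
  assumes "C \<in> flags P" "D \<in> flags P" "j < n"
    "face D (int j - 1) = face C (int j - 1)" "face D (int j + 1) = face C (int j + 1)"
  shows "face D (int j) \<in>
    {H \<in> faces P. rk H = int j \<and> le (face C (int j - 1)) H \<and> le H (face C (int j + 1))}"
proof -
  have r: "-1 \<le> int j - 1" "int j - 1 \<le> int n" "-1 \<le> int j" "int j \<le> int n" "-1 \<le> int j + 1"
      "int j + 1 \<le> int n"
    using assms(3) by auto
  have "le (face D (int j - 1)) (face D (int j))" "le (face D (int j)) (face D (int j + 1))"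
    using r face_in[OF assms(2)] by (auto simp: flag_le_iff[OF assms(2)])
  then show ?thesis
    using r face_in[OF assms(2)] flag_subset[OF assms(2)] assms(4,5) by auto
qed

text \<open>All three faces of rank j lie in the same two-element section, so the two that differ
  from the third coincide.\<close>

lemma face_determined:
  assumes "C \<in> flags P" "D \<in> flags P" "E \<in> flags P" "j < n"
    "face D (int j - 1) = face C (int j - 1)" "face D (int j + 1) = face C (int j + 1)"
    "face E (int j - 1) = face C (int j - 1)" "face E (int j + 1) = face C (int j + 1)"
    "face D (int j) \<noteq> face C (int j)" "face E (int j) \<noteq> face C (int j)"
  shows "face D (int j) = face E (int j)"
proof -
  let ?S = "{H \<in> faces P. rk H = int j \<and> le (face C (int j - 1)) H \<and> le H (face C (int j + 1))}"
  have "\<exists>x y. ?S = {x, y}"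
    using between_card[OF assms(1,4)] unfolding card_2_iff by blast
  then obtain x y where S: "?S = {x, y}" by blast
  have "face C (int j) \<in> {x, y}" "face D (int j) \<in> {x, y}" "face E (int j) \<in> {x, y}"
    using face_between[OF assms(1) assms(1) assms(4) HOL.refl HOL.refl]
      face_between[OF assms(1,2,4,5,6)] face_between[OF assms(1,3,4,7,8)] unfolding S .
  with assms(9,10) show ?thesis by auto
qed

lemma flags_agree_iff:
  assumes "C \<in> flags P" "D \<in> flags P"
  shows "{F \<in> D. rk F \<noteq> int j} = {F \<in> C. rk F \<noteq> int j} \<longleftrightarrow>
    (\<forall>k. -1 \<le> k \<longrightarrow> k \<le> int n \<longrightarrow> k \<noteq> int j \<longrightarrow> face D k = face C k)"
proof (rule iffI)
  assume *: "{F \<in> D. rk F \<noteq> int j} = {F \<in> C. rk F \<noteq> int j}"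
  show "\<forall>k. -1 \<le> k \<longrightarrow> k \<le> int n \<longrightarrow> k \<noteq> int j \<longrightarrow> face D k = face C k"
  proof (intro allI impI)
    fix k :: int assume k: "-1 \<le> k" "k \<le> int n" "k \<noteq> int j"
    then have "face C k \<in> {F \<in> C. rk F \<noteq> int j}" using face_in[OF assms(1) k(1,2)] by simp
    then have "face C k \<in> D" unfolding *[symmetric] by simp
    then show "face D k = face C k" using face_in(2)[OF assms(1) k(1,2)] by (rule face_eqI[OF
        assms(2)])
  qed
next
  assume *: "\<forall>k. -1 \<le> k \<longrightarrow> k \<le> int n \<longrightarrow> k \<noteq> int j \<longrightarrow> face D k = face C k"
  have "x \<in> D" if "x \<in> C" "rk x \<noteq> int j" for x
    using that * flag_rk[OF assms(1) that(1)] face_eqI[OF assms(1) that(1) HOL.refl]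
      face_in(1)[OF assms(2), of "rk x"] by simp
  moreover have "x \<in> C" if "x \<in> D" "rk x \<noteq> int j" for x
    using that * flag_rk[OF assms(2) that(1)] face_eqI[OF assms(2) that(1) HOL.refl]
      face_in(1)[OF assms(1), of "rk x"] by simp
  ultimately show "{F \<in> D. rk F \<noteq> int j} = {F \<in> C. rk F \<noteq> int j}" by auto
qed

lemma ex_adjacent_flag:
  assumes C: "C \<in> flags P" and j: "j < n"
  shows "\<exists>D. D \<in> flags P \<and> D \<noteq> C \<and> {F \<in> D. rk F \<noteq> int j} = {F \<in> C. rk F \<noteq> int j}"
proof -
  let ?S = "{H \<in> faces P. rk H = int j \<and> le (face C (int j - 1)) H \<and> le H (face C (int j + 1))}"
  let ?F = "face C (int j)"
  have F: "?F \<in> C" "rk ?F = int j" using face_in[OF C] j by auto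
  have "\<exists>x y. x \<noteq> y \<and> ?S = {x, y}"
    using between_card[OF C j] unfolding card_2_iff by blast
  then obtain x y where S: "x \<noteq> y" "?S = {x, y}" by blast
  have "\<exists>H\<in>?S. H \<noteq> ?F" unfolding S(2) using S(1) by auto
  then obtain H where H: "H \<in> ?S" "H \<noteq> ?F" by blast
  define D where "D = insert H (C - {?F})"
  have HC: "H \<notin> C"
  proof
    assume "H \<in> C"
    then have "face C (rk H) = H" by (rule face_rk[OF C])
    then show False using H by simp
  qed
  \<comment> \<open>Every other face of \<open>C\<close> lies below its (j-1)-face or above its
    (j+1)-face, and \<open>H\<close> lies between these two.\<close>
  have comp: "le x H \<or> le H x" if x: "x \<in> C" "x \<noteq> ?F" for x
  proof -
    have "rk x \<noteq> int j" using x face_rk[OF C x(1)] by auto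
    then consider "rk x \<le> int j - 1" | "rk x \<ge> int j + 1" by linarith
    then show ?thesis
    proof cases
      case 1
      then have "le x (face C (int j - 1))" using x j face_in[OF C] by (simp add: flag_le_iff[OF C])
      then show ?thesis using H le_trans by blast
    next
      case 2
      then have "le (face C (int j + 1)) x" using x j face_in[OF C] by (simp add: flag_le_iff[OF C])
      then show ?thesis using H le_trans by blast
    qed
  qed
  have "D \<in> flags P"
  proof (rule flag_cardI)
    show "D \<subseteq> faces P" using H flag_subset[OF C] by (auto simp: D_def)
    show "\<forall>x\<in>D. \<forall>y\<in>D. le x y \<or> le y x"
      using comp flag_total[OF C] H le_refl by (auto simp: D_def)
    show "card D = n + 2"
      using flag_card[OF C] flag_finite[OF C] F HC by (simp add: D_def)
  qed
  moreover have "D \<noteq> C" using HC by (auto simp: D_def)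
  moreover have "{F \<in> D. rk F \<noteq> int j} = {F \<in> C. rk F \<noteq> int j}"
    using H F by (auto simp: D_def)
  ultimately show ?thesis by blast
qed

text \<open>The uniqueness behind the definite description in \<open>flag_adj\<close>: only the
  j-face is free, and the diamond leaves one alternative for it. Exchanges are computed below by
  exhibiting the resulting flag.\<close>

lemma flag_adj_eqI:
  assumes C: "C \<in> flags P" and j: "j < n" and D: "D \<in> flags P" "D \<noteq> C"
    and eq: "\<And>k. -1 \<le> k \<Longrightarrow> k \<le> int n \<Longrightarrow> k \<noteq> int j \<Longrightarrow> face D k = face C k"
  shows "flag_adj P j C = D"
proof -
  have neq: "face W (int j) \<noteq> face C (int j)"
    if W: "W \<in> flags P" "W \<noteq> C" "\<And>k. -1 \<le> k \<Longrightarrow> k \<le> int n \<Longrightarrow> k \<noteq> int j \<Longrightarrow> face W k = face C k" for W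
  proof
    assume "face W (int j) = face C (int j)"
    then have "face W k = face C k" if "-1 \<le> k" "k \<le> int n" for k
      using W(3) that by (cases "k = int j") auto
    then show False using flag_eqI[OF W(1) C] W(2) by blast
  qed
  have "E = D" if E: "E \<in> flags P" "E \<noteq> C" and E': "{F \<in> E. rk F \<noteq> int j} = {F \<in> C. rk F \<noteq> int j}"
      for E
  proof (rule flag_eqI[OF E(1) D(1)])
    have eqE: "\<And>k. -1 \<le> k \<Longrightarrow> k \<le> int n \<Longrightarrow> k \<noteq> int j \<Longrightarrow> face E k = face C k"
      using E' flags_agree_iff[OF C E(1)] by blast
    have "face E (int j) = face D (int j)"
      using j by (intro face_determined[OF C E(1) D(1) j]) (auto simp: eq eqE neq E D)
    then show "face E k = face D k" if "-1 \<le> k" "k \<le> int n" for k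
      using that eq eqE by (cases "k = int j") auto
  qed
  moreover have "{F \<in> D. rk F \<noteq> int j} = {F \<in> C. rk F \<noteq> int j}"
    using eq flags_agree_iff[OF C D(1)] by blast
  ultimately show ?thesis
    unfolding flag_adj_def using D by (intro the_equality) blast+
qed

lemma flag_adj:
  assumes C: "C \<in> flags P" and j: "j < n"
  shows flag_adj_flag: "flag_adj P j C \<in> flags P"
    and flag_adj_neq: "flag_adj P j C \<noteq> C"
    and face_flag_adj: "-1 \<le> k \<Longrightarrow> k \<le> int n \<Longrightarrow> k \<noteq> int j \<Longrightarrow> face (flag_adj P j C) k = face C k"
proof -
  obtain D where D: "D \<in> flags P" "D \<noteq> C"
    and "{F \<in> D. rk F \<noteq> int j} = {F \<in> C. rk F \<noteq> int j}"
    using ex_adjacent_flag[OF assms] by blast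
  then have eq: "\<And>k. -1 \<le> k \<Longrightarrow> k \<le> int n \<Longrightarrow> k \<noteq> int j \<Longrightarrow> face D k = face C k"
    using flags_agree_iff[OF C D(1)] by blast
  have "flag_adj P j C = D" by (rule flag_adj_eqI[OF C j D eq])
  then show "flag_adj P j C \<in> flags P" "flag_adj P j C \<noteq> C"
    "-1 \<le> k \<Longrightarrow> k \<le> int n \<Longrightarrow> k \<noteq> int j \<Longrightarrow> face (flag_adj P j C) k = face C k"
    using D eq by auto
qed

lemma face_flag_adj_neq:
  assumes "C \<in> flags P" "j < n"
  shows "face (flag_adj P j C) (int j) \<noteq> face C (int j)"
proof
  assume "face (flag_adj P j C) (int j) = face C (int j)"
  then have "face (flag_adj P j C) k = face C k" if "-1 \<le> k" "k \<le> int n" for k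
    using face_flag_adj[OF assms] that by (cases "k = int j") auto
  then show False using flag_eqI[OF flag_adj_flag[OF assms] assms(1)] flag_adj_neq[OF assms] by
      blast
qed

lemma flag_adj_flag_adj:
  assumes "C \<in> flags P" "j < n"
  shows "flag_adj P j (flag_adj P j C) = C"
  using assms flag_adj[OF assms] by (intro flag_adj_eqI) auto

text \<open>Exchanging the j-face does not touch the faces of ranks i - 1 and i + 1, and vice versa,
  so both orders of exchange select from the same two diamonds.\<close>

lemma flag_adj_commute:
  assumes C: "C \<in> flags P" and ij: "i < n" "j < n" "i + 1 < j \<or> j + 1 < i"
  shows "flag_adj P i (flag_adj P j C) = flag_adj P j (flag_adj P i C)"
proof -
  let ?Ci = "flag_adj P i C" and ?Cj = "flag_adj P j C"
  let ?Cij = "flag_adj P j ?Ci" and ?Cji = "flag_adj P i ?Cj"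
  have f: "?Ci \<in> flags P" "?Cj \<in> flags P" using C ij flag_adj_flag by auto
  have ff: "?Cij \<in> flags P" "?Cji \<in> flags P" using f ij flag_adj_flag by auto
  have i: "face ?Cji (int i) = face ?Cij (int i)"
    using ij f face_flag_adj_neq[OF C, of i] face_flag_adj_neq[OF f(2), of i]
    by (intro face_determined[OF C ff(2,1)]) (auto simp: face_flag_adj C)
  have j: "face ?Cji (int j) = face ?Cij (int j)"
    using ij f face_flag_adj_neq[OF C, of j] face_flag_adj_neq[OF f(1), of j]
    by (intro face_determined[OF C ff(2,1)]) (auto simp: face_flag_adj C)
  show ?thesis
  proof (rule flag_eqI[OF ff(2,1)])
    fix k :: int assume k: "-1 \<le> k" "k \<le> int n"
    show "face ?Cji k = face ?Cij k"
    proof (cases "k = int i \<or> k = int j")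
      case True
      with i j show ?thesis by blast
    next
      case False
      with k show ?thesis
        using face_flag_adj[OF f(1) ij(2)] face_flag_adj[OF f(2) ij(1)]
          face_flag_adj[OF C ij(1)] face_flag_adj[OF C ij(2)] by simp
    qed
  qed
qed

lemma adjacent_flags_iff:
  assumes C: "C \<in> flags P" and D: "D \<in> flags P"
  shows "adjacent_flags C D \<longleftrightarrow> (\<exists>j<n. D = flag_adj P j C)"
proof
  assume "adjacent_flags C D"
  then obtain x where x: "C - D = {x}" by (auto simp: adjacent_flags_def card_1_singleton_iff)
  then have xC: "x \<in> C" "x \<notin> D" by auto
  have eq: "face D k = face C k" if "-1 \<le> k" "k \<le> int n" "k \<noteq> rk x" for k
  proof -
    have "face C k \<in> C" "face C k \<noteq> x" using face_in[OF C that(1,2)] that(3) by auto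
    then have "face C k \<in> D" using x by auto
    then show ?thesis using face_in(2)[OF C that(1,2)] by (rule face_eqI[OF D])
  qed
  \<comment> \<open>The least and the greatest face belong to every flag, so the face that is lost
    has a rank from 0 to n - 1.\<close>
  have "rk x \<noteq> -1" "rk x \<noteq> int n"
    using face_extreme_eq[OF C D] face_in(1)[OF D, of "-1"] face_in(1)[OF D, of "int n"]
      face_rk[OF C xC(1)] xC(2) by auto
  then have r: "0 \<le> rk x" "rk x < int n" using flag_rk[OF C xC(1)] by auto
  then have "flag_adj P (nat (rk x)) C = D"
    using eq xC by (intro flag_adj_eqI[OF C _ D]) auto
  then show "\<exists>j<n. D = flag_adj P j C" using r by (intro exI[of _ "nat (rk x)"]) auto
next
  assume "\<exists>j<n. D = flag_adj P j C"
  then obtain j where j: "j < n" and Dj: "D = flag_adj P j C" by auto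
  have sub: "W - Y \<subseteq> {face W (int j)}"
    if "W \<in> flags P" "Y \<in> flags P" "\<And>k. -1 \<le> k \<Longrightarrow> k \<le> int n \<Longrightarrow> k \<noteq> int j \<Longrightarrow> face Y k = face W k"
        for W Y
  proof
    fix z assume z: "z \<in> W - Y"
    then have "face W (rk z) = z" "-1 \<le> rk z" "rk z \<le> int n" using that face_rk[of W z] flag_rk[of
        W z] by auto
    moreover have "rk z = int j" using that(3)[of "rk z"] z face_in(1)[OF that(2)] calculation by
        force
    ultimately show "z \<in> {face W (int j)}" by auto
  qed
  have "C - D \<subseteq> {face C (int j)}" "D - C \<subseteq> {face D (int j)}"
    using sub[OF C D] sub[OF D C] face_flag_adj[OF C j] Dj by auto
  moreover have "face C (int j) \<notin> D" "face D (int j) \<notin> C" "face C (int j) \<in> C" "face D (int j) \<in> D"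
    using face_flag_adj_neq[OF C j] Dj face_rk[OF C, of "face D (int j)"]
      face_rk[OF D, of "face C (int j)"] face_in[OF C, of "int j"] face_in[OF D, of "int j"] j
    by auto
  ultimately have "C - D = {face C (int j)}" "D - C = {face D (int j)}" by auto
  then show "adjacent_flags C D" by (simp add: adjacent_flags_def)
qed

text \<open>Obtained by following the connecting sequence of strong flag-connectedness, each
  adjacency being read as an exchange.\<close>

lemma flag_induct [consumes 2, case_names base adj]:
  assumes C: "C \<in> flags P" and D: "D \<in> flags P" and base: "Q C"
    and step: "\<And>E j. E \<in> flags P \<Longrightarrow> j < n \<Longrightarrow> Q E \<Longrightarrow> Q (flag_adj P j E)"
  shows "Q D"
proof -
  have "(\<lambda>W Y. W \<in> flags P \<and> Y \<in> flags P \<and> C \<inter> D \<subseteq> W \<and> C \<inter> D \<subseteq> Y \<and> adjacent_flags W Y)\<^sup>*\<^sup>* C D"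
    using polytope C D by (auto simp: abstract_polytope_def strongly_flag_connected_def)
  then show ?thesis
  proof induction
    case (step W Y)
    then show ?case using adjacent_flags_iff assms(4) by metis
  qed (rule base)
qed

lemma base_flag: "base_flag P \<in> flags P"
  using polytope by (simp add: abstract_polytope_def)

section \<open>Automorphisms and their action on flags\<close>

lemma aut_iff: "f \<in> carrier (aut_group P) \<longleftrightarrow> f \<in> extensional (faces P) \<and>
    bij_betw f (faces P) (faces P) \<and> (\<forall>x\<in>faces P. \<forall>y\<in>faces P. le (f x) (f y) \<longleftrightarrow> le x y)"
  by (auto simp: aut_group_def Bij_def)

lemma group_aut_group: "group (aut_group P)"
proof (rule groupI)
  show "\<one>\<^bsub>aut_group P\<^esub> \<in> carrier (aut_group P)"
    by (simp add: aut_group_def id_Bij)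
  fix f g h
  assume f: "f \<in> carrier (aut_group P)" and g: "g \<in> carrier (aut_group P)"
    and h: "h \<in> carrier (aut_group P)"
  have mem: "f x \<in> faces P" "g x \<in> faces P" if "x \<in> faces P" for x
    using f g that unfolding aut_iff by (auto dest: bij_betwE)
  show "f \<otimes>\<^bsub>aut_group P\<^esub> g \<in> carrier (aut_group P)"
    using f g mem by (auto simp: aut_group_def compose_Bij compose_eq)
  show "f \<otimes>\<^bsub>aut_group P\<^esub> g \<otimes>\<^bsub>aut_group P\<^esub> h = f \<otimes>\<^bsub>aut_group P\<^esub> (g \<otimes>\<^bsub>aut_group P\<^esub> h)"
    using mem by (auto simp: aut_group_def compose_def fun_eq_iff)
next
  fix f assume f: "f \<in> carrier (aut_group P)"
  show "\<one>\<^bsub>aut_group P\<^esub> \<otimes>\<^bsub>aut_group P\<^esub> f = f"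
    using f by (auto simp: aut_group_def Bij_def compose_def extensional_def fun_eq_iff)
  let ?g = "restrict (inv_into (faces P) f) (faces P)"
  have fb: "f \<in> Bij (faces P)" using f by (simp add: aut_group_def)
  have inv: "?g x \<in> faces P" "f (?g x) = x" if "x \<in> faces P" for x
    using that f unfolding aut_iff
    by (auto simp: bij_betw_def f_inv_into_f inv_into_into)
  have "?g \<in> carrier (aut_group P)"
    using f inv restrict_inv_into_Bij[OF fb] unfolding aut_group_def by simp metis
  moreover have "?g \<otimes>\<^bsub>aut_group P\<^esub> f = \<one>\<^bsub>aut_group P\<^esub>"
    using inv by (auto simp: aut_group_def compose_def fun_eq_iff)
  ultimately show "\<exists>g\<in>carrier (aut_group P). g \<otimes>\<^bsub>aut_group P\<^esub> f = \<one>\<^bsub>aut_group P\<^esub>" by blast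
qed

lemma aut_mult_image:
  "C \<subseteq> faces P \<Longrightarrow> (f \<otimes>\<^bsub>aut_group P\<^esub> g) ` C = g ` f ` C"
  by (force simp: aut_group_def compose_eq image_iff)

lemma aut_one_image: "C \<subseteq> faces P \<Longrightarrow> \<one>\<^bsub>aut_group P\<^esub> ` C = C"
  by (force simp: aut_group_def image_iff)

lemma aut_image_flag:
  assumes f: "f \<in> carrier (aut_group P)" and C: "C \<in> flags P"
  shows "f ` C \<in> flags P"
proof (rule flag_cardI)
  have b: "bij_betw f (faces P) (faces P)" using f aut_iff by auto
  show "f ` C \<subseteq> faces P" using b flag_subset[OF C] by (auto simp: bij_betw_def)
  show "\<forall>x\<in>f ` C. \<forall>y\<in>f ` C. le x y \<or> le y x"
    using f flag_total[OF C] flag_subset[OF C] unfolding aut_iff by blast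
  have "inj_on f C" using b flag_subset[OF C] by (meson bij_betw_def inj_on_subset)
  then show "card (f ` C) = n + 2" using flag_card[OF C] by (simp add: card_image)
qed

text \<open>Expresses the rank through incidence alone, the offset 2 coming from the least rank -1
  and from \<open>x\<close> itself. The elements of \<open>aut_group\<close> are defined by
  incidence; this is why they also preserve ranks on flags.\<close>

lemma rk_eq_card_below:
  assumes C: "C \<in> flags P" and x: "x \<in> C"
  shows "int (card {y \<in> C. le y x}) = rk x + 2"
proof -
  have "rk ` {y \<in> C. le y x} = {-1..rk x}"
  proof -
    have "k \<in> rk ` {y \<in> C. le y x}" if "-1 \<le> k" "k \<le> rk x" for k
      using that face_in[OF C, of k] flag_rk[OF C x] x
      by (intro image_eqI[of _ _ "face C k"]) (auto simp: flag_le_iff[OF C])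
    then show ?thesis using flag_rk[OF C] x by (auto simp: flag_le_iff[OF C])
  qed
  moreover have "inj_on rk {y \<in> C. le y x}"
    using chain_inj_rk flag_total[OF C] by (intro chain_inj_rk) auto
  ultimately have "card {y \<in> C. le y x} = card {-1..rk x}" by (metis card_image)
  then show ?thesis using flag_rk[OF C x] by simp
qed

lemma aut_rk:
  assumes f: "f \<in> carrier (aut_group P)" and C: "C \<in> flags P" and x: "x \<in> C"
  shows "rk (f x) = rk x"
proof -
  have inj: "inj_on f C" using f flag_subset[OF C] unfolding aut_iff by (meson bij_betw_def
      inj_on_subset)
  have "{y \<in> f ` C. le y (f x)} = f ` {y \<in> C. le y x}"
    using f flag_subset[OF C] x unfolding aut_iff by blast
  then have "card {y \<in> f ` C. le y (f x)} = card {y \<in> C. le y x}"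
    using card_image inj by (metis (mono_tags, lifting) inj_on_subset mem_Collect_eq subsetI)
  then show ?thesis
    using rk_eq_card_below[OF C x] rk_eq_card_below[OF aut_image_flag[OF f C], of "f x"] x by simp
qed

lemma face_aut_image:
  assumes f: "f \<in> carrier (aut_group P)" and C: "C \<in> flags P" and k: "-1 \<le> k" "k \<le> int n"
  shows "face (f ` C) k = f (face C k)"
  using face_in[OF C k] aut_rk[OF f C] by (intro face_eqI[OF aut_image_flag[OF f C]]) auto

lemma aut_flag_adj:
  assumes f: "f \<in> carrier (aut_group P)" and C: "C \<in> flags P" and j: "j < n"
  shows "flag_adj P j (f ` C) = f ` flag_adj P j C"
proof (rule flag_adj_eqI[OF aut_image_flag[OF f C] j aut_image_flag[OF f flag_adj_flag[OF C j]]])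
  have "inj_on f (faces P)" using f unfolding aut_iff by (simp add: bij_betw_def)
  then show "f ` flag_adj P j C \<noteq> f ` C"
    using flag_adj_neq[OF C j] flag_subset[OF C] flag_subset[OF flag_adj_flag[OF C j]]
    by (metis inj_on_image_eq_iff)
qed (use f C j in \<open>simp add: face_aut_image face_flag_adj flag_adj_flag\<close>)

text \<open>A chain that is maximal among the chains through \<open>x\<close> is maximal outright,
  and finiteness provides one.\<close>

lemma ex_flag_containing:
  assumes fin: "finite (faces P)" and x: "x \<in> faces P"
  shows "\<exists>C\<in>flags P. x \<in> C"
proof -
  let ?W = "{C. pred_on.chain (faces P) le C \<and> x \<in> C}"
  have "?W \<subseteq> Pow (faces P)" by (auto simp: pred_on.chain_def)
  then have "finite ?W" using fin by (meson finite_Pow_iff finite_subset)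
  moreover have "{x} \<in> ?W" using x by (auto simp: pred_on.chain_def)
  ultimately obtain C where C: "C \<in> ?W" "\<forall>D\<in>?W. C \<subseteq> D \<longrightarrow> C = D"
    using finite_has_maximal[of ?W] by blast
  then have "C \<in> flags P" by (auto simp: flags_def pred_on.maxchain_def)
  then show ?thesis using C by auto
qed

text \<open>Automorphisms commute with exchanges, so agreement on one flag spreads to all flags by
  connectedness; every face lies on some flag and is recovered there from its rank.\<close>

lemma aut_eqI:
  assumes fin: "finite (faces P)"
    and f: "f \<in> carrier (aut_group P)" and g: "g \<in> carrier (aut_group P)"
    and C: "C \<in> flags P" and eq: "f ` C = g ` C"
  shows "f = g"
proof (rule extensionalityI)
  show "f \<in> extensional (faces P)" "g \<in> extensional (faces P)" using f g aut_iff by auto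
  fix x assume "x \<in> faces P"
  then obtain D where D: "D \<in> flags P" "x \<in> D" using ex_flag_containing[OF fin] by blast
  have "f ` D = g ` D"
    using C D(1)
  proof (induction rule: flag_induct)
    case (adj E j)
    then show ?case using aut_flag_adj f g by metis
  qed (rule eq)
  moreover have "face (f ` D) (rk x) = f x" "face (g ` D) (rk x) = g x"
    using face_rk[OF aut_image_flag[OF _ D(1)], of _ "_ x"] D f g aut_rk[OF _ D] by fastforce+
  ultimately show "f x = g x" by simp
qed

lemma finite_aut_group: "finite (faces P) \<Longrightarrow> finite (carrier (aut_group P))"
  by (rule finite_subset[of _ "faces P \<rightarrow>\<^sub>E faces P"])
    (auto simp: aut_iff extensional_def intro: bij_betw_apply intro!: finite_PiE)

lemma rot_eqI:
  assumes fin: "finite (faces P)" and f: "f \<in> carrier (aut_group P)"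
    and eq: "f ` base_flag P = flag_adj P (i - 1) (flag_adj P i (base_flag P))"
  shows "rot P i = f"
  unfolding rot_def
proof (rule the_equality)
  fix g assume "g \<in> carrier (aut_group P) \<and>
    g ` base_flag P = flag_adj P (i - 1) (flag_adj P i (base_flag P))"
  then show "g = f" using aut_eqI[OF fin _ f base_flag] eq by simp
qed (use f eq in simp)

lemma flag_orbit_eq: "flag_orbit P C = (\<lambda>f. f ` C) ` carrier (aut_group P)"
  by (auto simp: flag_orbit_def orbit_def)

lemma flag_orbit_eq_iff:
  assumes C: "C \<in> flags P" and D: "D \<in> flags P"
  shows "flag_orbit P C = flag_orbit P D \<longleftrightarrow> (\<exists>f\<in>carrier (aut_group P). f ` C = D)"
proof
  interpret G: group "aut_group P" by (rule group_aut_group)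
  assume "flag_orbit P C = flag_orbit P D"
  moreover have "D \<in> flag_orbit P D"
    unfolding flag_orbit_eq using aut_one_image[OF flag_subset[OF D]] G.one_closed by force
  ultimately have "D \<in> flag_orbit P C" by simp
  then show "\<exists>f\<in>carrier (aut_group P). f ` C = D" unfolding flag_orbit_eq by blast
next
  interpret G: group "aut_group P" by (rule group_aut_group)
  assume "\<exists>f\<in>carrier (aut_group P). f ` C = D"
  then obtain f where f: "f \<in> carrier (aut_group P)" and fC: "f ` C = D" by auto
  have 1: "g ` D = (f \<otimes>\<^bsub>aut_group P\<^esub> g) ` C" for g
    using aut_mult_image[OF flag_subset[OF C]] fC by simp
  have 2: "g ` C = (inv\<^bsub>aut_group P\<^esub> f \<otimes>\<^bsub>aut_group P\<^esub> g) ` D" if "g \<in> carrier (aut_group P)" for g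
  proof -
    have "(inv\<^bsub>aut_group P\<^esub> f) ` D = C"
      using fC aut_mult_image[OF flag_subset[OF C], of f "inv\<^bsub>aut_group P\<^esub> f"] f
        aut_one_image[OF flag_subset[OF C]] by simp
    then show ?thesis using aut_mult_image[OF flag_subset[OF D]] by simp
  qed
  show "flag_orbit P C = flag_orbit P D"
  proof (intro equalityI subsetI)
    fix E assume "E \<in> flag_orbit P C"
    then obtain g where "g \<in> carrier (aut_group P)" "E = g ` C" by (auto simp: flag_orbit_eq)
    then show "E \<in> flag_orbit P D" unfolding flag_orbit_eq using f 2 by blast
  next
    fix E assume "E \<in> flag_orbit P D"
    then obtain g where "g \<in> carrier (aut_group P)" "E = g ` D" by (auto simp: flag_orbit_eq)
    then show "E \<in> flag_orbit P C" unfolding flag_orbit_eq using f 1 by blast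
  qed
qed

end


section \<open>Finite chiral polyhedra\<close>

declare One_nat_def [simp del] One_nat_def [symmetric, simp]

locale finite_chiral_polyhedron = polytope P for P :: "'a based_poset" +
  assumes chiral: "chiral P" and rank_3: "poset_rank P = 3" and finite_faces: "finite (faces P)"
begin

sublocale G: group "aut_group P" by (rule group_aut_group)

abbreviation \<Phi> :: "'a set" where "\<Phi> \<equiv> base_flag P"
abbreviation adj :: "nat \<Rightarrow> 'a set \<Rightarrow> 'a set" where "adj \<equiv> flag_adj P"
abbreviation a :: "'a \<Rightarrow> 'a" where "a \<equiv> rot P 1"
abbreviation b :: "'a \<Rightarrow> 'a" where "b \<equiv> rot P 2"

section \<open>Rotations and the flags that they reach\<close>

lemma adj_flag [simp]: "C \<in> flags P \<Longrightarrow> j < 3 \<Longrightarrow> adj j C \<in> flags P"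
  by (simp add: flag_adj_flag rank_3)

lemma adj_adj [simp]: "C \<in> flags P \<Longrightarrow> j < 3 \<Longrightarrow> adj j (adj j C) = C"
  by (simp add: flag_adj_flag_adj rank_3)

lemma adj_2_0: "C \<in> flags P \<Longrightarrow> adj 2 (adj 0 C) = adj 0 (adj 2 C)"
  by (rule flag_adj_commute) (simp_all add: rank_3)

lemma base_flag' [simp]: "\<Phi> \<in> flags P" by (rule base_flag)

lemma aut_adj: "f \<in> carrier (aut_group P) \<Longrightarrow> C \<in> flags P \<Longrightarrow> j < 3 \<Longrightarrow> f ` adj j C = adj j (f ` C)"
  by (simp add: aut_flag_adj rank_3)

lemma aut_image_neq_adj:
  assumes "f \<in> carrier (aut_group P)" "C \<in> flags P" "j < 3"
  shows "f ` C \<noteq> adj j C"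
proof
  assume "f ` C = adj j C"
  then have "flag_orbit P C = flag_orbit P (adj j C)"
    using flag_orbit_eq_iff[of C "adj j C"] assms by auto
  moreover have "adjacent_flags C (adj j C)"
    using adjacent_flags_iff[of C "adj j C"] assms rank_3 by auto
  ultimately show False using chiral assms by (auto simp: chiral_def)
qed

text \<open>Each exchange changes the orbit and there are only two orbits, so two exchanges lead
  back to the orbit of \<open>C\<close>.\<close>

lemma ex_aut_adj_adj:
  assumes "C \<in> flags P" "i < 3" "j < 3"
  shows "\<exists>f\<in>carrier (aut_group P). f ` C = adj i (adj j C)"
proof -
  let ?D = "adj j C" and ?E = "adj i (adj j C)"
  have fl: "?D \<in> flags P" "?E \<in> flags P" using assms by simp_all
  have "adjacent_flags C ?D" "adjacent_flags ?D ?E"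
    using adjacent_flags_iff[of C ?D] adjacent_flags_iff[of ?D ?E] assms fl rank_3 by auto
  then have neq: "flag_orbit P C \<noteq> flag_orbit P ?D" "flag_orbit P ?D \<noteq> flag_orbit P ?E"
    using chiral assms fl by (auto simp: chiral_def)
  have "card (flag_orbit P ` flags P) = 2" using chiral by (simp add: chiral_def)
  then have "\<exists>x y. flag_orbit P ` flags P = {x, y}" unfolding card_2_iff by blast
  then obtain x y where xy: "flag_orbit P ` flags P = {x, y}" by (elim exE)
  have "flag_orbit P B \<in> {x, y}" if "B \<in> flags P" for B
    using imageI[OF that, of "flag_orbit P"] unfolding xy .
  from this[OF assms(1)] this[OF fl(1)] this[OF fl(2)]
  have "flag_orbit P C \<in> {x, y}" "flag_orbit P ?D \<in> {x, y}" "flag_orbit P ?E \<in> {x, y}" .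
  with neq have "flag_orbit P C = flag_orbit P ?E" by auto
  then show ?thesis using flag_orbit_eq_iff[OF assms(1) fl(2)] by simp
qed

lemma rot:
  assumes "i \<in> {1, 2}"
  shows rot_closed: "rot P i \<in> carrier (aut_group P)"
    and rot_image: "rot P i ` \<Phi> = adj (i - 1) (adj i \<Phi>)"
proof -
  obtain f where f: "f \<in> carrier (aut_group P)" "f ` \<Phi> = adj (i - 1) (adj i \<Phi>)"
    using ex_aut_adj_adj[of \<Phi> "i - 1" i] assms by auto
  then have "rot P i = f" using rot_eqI[OF finite_faces] by simp
  then show "rot P i \<in> carrier (aut_group P)" "rot P i ` \<Phi> = adj (i - 1) (adj i \<Phi>)"
    using f by simp_all
qed

lemma a_closed [simp]: "a \<in> carrier (aut_group P)"
  and b_closed [simp]: "b \<in> carrier (aut_group P)"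
  using rot_closed by simp_all

lemma a_image: "a ` \<Phi> = adj 0 (adj 1 \<Phi>)"
  and b_image: "b ` \<Phi> = adj 1 (adj 2 \<Phi>)"
  using rot_image[of 1] rot_image[of 2] by simp_all

lemma mult_image: "C \<in> flags P \<Longrightarrow> (f \<otimes>\<^bsub>aut_group P\<^esub> g) ` C = g ` f ` C"
  by (rule aut_mult_image[OF flag_subset])

lemma aut_inv_image:
  assumes "f \<in> carrier (aut_group P)" "D \<in> flags P" "f ` D = C"
  shows "(inv\<^bsub>aut_group P\<^esub> f) ` C = D"
  using mult_image[OF assms(2), of f "inv\<^bsub>aut_group P\<^esub> f"] assms aut_one_image[OF flag_subset]
  by simp

lemma inv_a_image: "(inv\<^bsub>aut_group P\<^esub> a) ` \<Phi> = adj 1 (adj 0 \<Phi>)"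
  by (rule aut_inv_image) (simp_all add: aut_adj a_image)

lemma inv_b_image: "(inv\<^bsub>aut_group P\<^esub> b) ` \<Phi> = adj 2 (adj 1 \<Phi>)"
  by (rule aut_inv_image) (simp_all add: aut_adj b_image)

text \<open>\<open>b\<close> is applied last but commutes with exchanges, so its own exchanges end
  up innermost and the two neighbouring exchanges of rank 1 cancel.\<close>

lemma ab_image: "(a \<otimes>\<^bsub>aut_group P\<^esub> b) ` \<Phi> = adj 0 (adj 2 \<Phi>)"
  by (simp add: mult_image aut_adj a_image b_image)

lemma base_aut_eqI:
  assumes "f \<in> carrier (aut_group P)" "g \<in> carrier (aut_group P)" "f ` \<Phi> = g ` \<Phi>"
  shows "f = g"
  by (rule aut_eqI[OF finite_faces assms(1,2) base_flag' assms(3)])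

text \<open>The product exchanges the vertex and the 2-face of the base flag. These exchanges
  commute, so a second application restores the flag, which determines the automorphism.\<close>

lemma ab_squared: "a \<otimes>\<^bsub>aut_group P\<^esub> b \<otimes>\<^bsub>aut_group P\<^esub> (a \<otimes>\<^bsub>aut_group P\<^esub> b) = \<one>\<^bsub>aut_group P\<^esub>"
proof (rule base_aut_eqI)
  show "(a \<otimes>\<^bsub>aut_group P\<^esub> b \<otimes>\<^bsub>aut_group P\<^esub> (a \<otimes>\<^bsub>aut_group P\<^esub> b)) ` \<Phi> = \<one>\<^bsub>aut_group P\<^esub> ` \<Phi>"
    using adj_2_0[of \<Phi>]
    by (simp add: mult_image[of _ "a \<otimes>\<^bsub>aut_group P\<^esub> b"] ab_image aut_adj aut_one_image[OF
        flag_subset]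
        adj_2_0[symmetric])
qed simp_all

lemma rot_neq_one: "a \<noteq> \<one>\<^bsub>aut_group P\<^esub>" "b \<noteq> \<one>\<^bsub>aut_group P\<^esub>"
proof -
  have "adj i (adj j \<Phi>) \<noteq> \<Phi>" if "i < 3" "j < 3" "i \<noteq> j" for i j
  proof
    assume "adj i (adj j \<Phi>) = \<Phi>"
    then have "adj j \<Phi> = adj i \<Phi>" using adj_adj[of "adj j \<Phi>" i] that by simp
    moreover have "face (adj i \<Phi>) (int j) = face \<Phi> (int j)"
      using that by (intro face_flag_adj) (simp_all add: rank_3)
    moreover have "face (adj j \<Phi>) (int j) \<noteq> face \<Phi> (int j)"
      using that by (intro face_flag_adj_neq) (simp_all add: rank_3)
    ultimately show False by simp
  qed
  from this[of 0 1] this[of 1 2] show "a \<noteq> \<one>\<^bsub>aut_group P\<^esub>" "b \<noteq> \<one>\<^bsub>aut_group P\<^esub>"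
    using a_image b_image aut_one_image[OF flag_subset[OF base_flag']] by auto
qed

text \<open>By connectedness, the translates of \<Phi> and of \<open>adj 0 \<Phi>\<close> under the
  generated subgroup already exhaust the flags. Chirality keeps an image of \<Phi> from being a
  translate of \<open>adj 0 \<Phi>\<close>.\<close>

lemma generate_rot: "generate (aut_group P) {a, b} = carrier (aut_group P)"
proof
  show "generate (aut_group P) {a, b} \<subseteq> carrier (aut_group P)"
    by (rule G.generate_incl) auto
  let ?N = "generate (aut_group P) {a, b}"
  have N: "g \<in> carrier (aut_group P)" if "g \<in> ?N" for g
    using that \<open>?N \<subseteq> carrier (aut_group P)\<close> by blast
  have mem: "a \<in> ?N" "b \<in> ?N" "inv\<^bsub>aut_group P\<^esub> a \<in> ?N"
    by (auto intro: generate.incl generate.inv)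
  have mult: "f \<in> ?N \<Longrightarrow> g \<in> ?N \<Longrightarrow> f \<otimes>\<^bsub>aut_group P\<^esub> g \<in> ?N" for f g by (rule generate.eng)
  show "carrier (aut_group P) \<subseteq> ?N"
  proof
    fix f assume f: "f \<in> carrier (aut_group P)"
    have "\<exists>g\<in>?N. f ` \<Phi> = g ` \<Phi> \<or> f ` \<Phi> = g ` adj 0 \<Phi>"
      using base_flag' aut_image_flag[OF f base_flag']
    proof (induction rule: flag_induct)
      case base
      have "\<one>\<^bsub>aut_group P\<^esub> \<in> ?N" by (rule generate.one)
      then show ?case using aut_one_image[OF flag_subset[OF base_flag']] by metis
    next
      case (adj E j)
      then obtain g where g: "g \<in> ?N" "E = g ` \<Phi> \<or> E = g ` adj 0 \<Phi>" by blast
      have j: "j = 0 \<or> j = 1 \<or> j = 2" using adj rank_3 by auto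
      let ?ab = "a \<otimes>\<^bsub>aut_group P\<^esub> b"
      have ab0: "?ab ` adj 0 \<Phi> = adj 2 \<Phi>" "?ab ` \<Phi> = adj 2 (adj 0 \<Phi>)"
        using adj_2_0[of \<Phi>] by (simp_all add: aut_adj ab_image)
      have a0: "a ` adj 0 \<Phi> = adj 1 \<Phi>" "(inv\<^bsub>aut_group P\<^esub> a) ` \<Phi> = adj 1 (adj 0 \<Phi>)"
        by (simp_all add: aut_adj a_image inv_a_image)
      have 1: "flag_adj P j (g ` \<Phi>) = g ` adj j \<Phi>" "flag_adj P j (g ` adj 0 \<Phi>) =
          g ` adj j (adj 0 \<Phi>)"
      proof -
        have "j < 3" using j by auto
        then show "flag_adj P j (g ` \<Phi>) = g ` adj j \<Phi>" "flag_adj P j (g ` adj 0 \<Phi>) =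
            g ` adj j (adj 0 \<Phi>)"
          using aut_adj[OF N[OF g(1)] base_flag', of j] aut_adj[OF N[OF g(1)] adj_flag[OF
              base_flag'], of 0 j]
          by (simp_all only: zero_less_numeral)
      qed
      \<comment> \<open>Exchanges of rank 1 and 2 on the two reference flags are realised by
        \<open>a\<close>, its inverse and the product \<open>ab\<close>, applied before g; hence the
        new factor stands on the left. An exchange of rank 0 just interchanges the reference
        flags.\<close>
      have 2: "g ` adj 1 \<Phi> = (a \<otimes>\<^bsub>aut_group P\<^esub> g) ` adj 0 \<Phi>"
        "g ` adj 1 (adj 0 \<Phi>) = (inv\<^bsub>aut_group P\<^esub> a \<otimes>\<^bsub>aut_group P\<^esub> g) ` \<Phi>"
        "g ` adj 2 \<Phi> = (?ab \<otimes>\<^bsub>aut_group P\<^esub> g) ` adj 0 \<Phi>"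
        "g ` adj 2 (adj 0 \<Phi>) = (?ab \<otimes>\<^bsub>aut_group P\<^esub> g) ` \<Phi>"
        by (simp_all add: mult_image[of _ a] mult_image[of _ ?ab] mult_image[of _ "inv\<^bsub>aut_group
            P\<^esub> a"] ab0 a0)
      have 3: "a \<otimes>\<^bsub>aut_group P\<^esub> g \<in> ?N" "inv\<^bsub>aut_group P\<^esub> a \<otimes>\<^bsub>aut_group P\<^esub> g \<in> ?N"
          "?ab \<otimes>\<^bsub>aut_group P\<^esub> g \<in> ?N"
        using mem g mult by blast+
      from j show ?case
      proof (elim disjE)
        assume "j = 0"
        then have "flag_adj P j E = g ` adj 0 \<Phi> \<or> flag_adj P j E = g ` \<Phi>"
          using g(2) 1 adj_adj[OF base_flag', of 0] by (metis zero_less_numeral)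
        then show ?thesis using g(1) by blast
      next
        assume "j = 1"
        then have "flag_adj P j E = (a \<otimes>\<^bsub>aut_group P\<^esub> g) ` adj 0 \<Phi> \<or>
            flag_adj P j E = (inv\<^bsub>aut_group P\<^esub> a \<otimes>\<^bsub>aut_group P\<^esub> g) ` \<Phi>"
          using g(2) 1 2(1,2) by metis
        then show ?thesis using 3 by blast
      next
        assume "j = 2"
        then have "flag_adj P j E = (?ab \<otimes>\<^bsub>aut_group P\<^esub> g) ` adj 0 \<Phi> \<or>
            flag_adj P j E = (?ab \<otimes>\<^bsub>aut_group P\<^esub> g) ` \<Phi>"
          using g(2) 1 2(3,4) by metis
        then show ?thesis using 3 by blast
      qed
    qed
    then obtain g where g: "g \<in> ?N" "f ` \<Phi> = g ` \<Phi> \<or> f ` \<Phi> = g ` adj 0 \<Phi>" by blast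
    have "f ` \<Phi> \<noteq> g ` adj 0 \<Phi>"
    proof
      assume "f ` \<Phi> = g ` adj 0 \<Phi>"
      then have "f ` \<Phi> = adj 0 (g ` \<Phi>)" using g N by (simp add: aut_adj)
      moreover have "(inv\<^bsub>aut_group P\<^esub> g \<otimes>\<^bsub>aut_group P\<^esub> f) ` (g ` \<Phi>) = f ` \<Phi>"
        using aut_inv_image[OF N[OF g(1)] base_flag' HOL.refl]
        by (simp add: mult_image aut_image_flag[OF N[OF g(1)]])
      ultimately show False
        using aut_image_neq_adj[of "inv\<^bsub>aut_group P\<^esub> g \<otimes>\<^bsub>aut_group P\<^esub> f" "g ` \<Phi>" 0]
          aut_image_flag[OF N[OF g(1)] base_flag'] N[OF g(1)] f by simp
    qed
    then have "f = g" using base_aut_eqI[OF f N[OF g(1)]] g by simp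
    then show "f \<in> ?N" using g by simp
  qed
qed

section \<open>The intersection property of the rotation group\<close>

lemma stabilizer_subgroup:
  assumes "x \<in> faces P"
  shows "subgroup {f \<in> carrier (aut_group P). f x = x} (aut_group P)"
proof
  have mult: "(f \<otimes>\<^bsub>aut_group P\<^esub> g) x = g (f x)" for f g
    using assms by (simp add: aut_group_def compose_eq)
  show "\<one>\<^bsub>aut_group P\<^esub> \<in> {f \<in> carrier (aut_group P). f x = x}"
    using assms by (auto simp: aut_group_def id_Bij)
  show "f \<otimes>\<^bsub>aut_group P\<^esub> g \<in> {f \<in> carrier (aut_group P). f x = x}"
    if "f \<in> {f \<in> carrier (aut_group P). f x = x}" "g \<in> {f \<in> carrier (aut_group P). f x = x}" for f g
    using that mult by simp
  show "inv\<^bsub>aut_group P\<^esub> f \<in> {f \<in> carrier (aut_group P). f x = x}"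
    if "f \<in> {f \<in> carrier (aut_group P). f x = x}" for f
  proof -
    have "(f \<otimes>\<^bsub>aut_group P\<^esub> inv\<^bsub>aut_group P\<^esub> f) x = x"
    proof -
      have "f \<otimes>\<^bsub>aut_group P\<^esub> inv\<^bsub>aut_group P\<^esub> f = \<one>\<^bsub>aut_group P\<^esub>" using that by simp
      then show ?thesis using assms by (simp add: aut_group_def)
    qed
    then show ?thesis using that mult by simp
  qed
qed auto

text \<open>\<open>a\<close> fixes the base 2-face and \<open>b\<close> the base vertex, so a common
  element of the two subgroups fixes both. The base flag is then either fixed or has its edge
  exchanged, and chirality rules out the latter.\<close>

lemma generate_rot_Int: "generate (aut_group P) {a} \<inter> generate (aut_group P) {b} = {\<one>\<^bsub>aut_group P\<^esub>}"
proof -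
  have fix_face: "f (face \<Phi> k) = face \<Phi> k"
    if g: "g \<in> carrier (aut_group P)" and k: "-1 \<le> k" "k \<le> 3" and eq: "face (g ` \<Phi>) k = face \<Phi> k"
      and f: "f \<in> generate (aut_group P) {g}" for f g k
  proof -
    have "face \<Phi> k \<in> faces P" using face_in(1)[of \<Phi> k] k rank_3 flag_subset[of \<Phi>] by auto
    from stabilizer_subgroup[OF this] have "generate (aut_group P) {g} \<subseteq> {f \<in> carrier (aut_group
        P). f (face \<Phi> k) = face \<Phi> k}"
      using g eq face_aut_image[OF g base_flag', of k] k rank_3 by (intro
          G.generate_subgroup_incl) auto
    then show ?thesis using f by blast
  qed
  have "f = \<one>\<^bsub>aut_group P\<^esub>" if f: "f \<in> generate (aut_group P) {a}"
      "f \<in> generate (aut_group P) {b}" for f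
  proof -
    have fc: "f \<in> carrier (aut_group P)" using f G.generate_in_carrier[of "{a}"] by simp
    have a2: "face (a ` \<Phi>) 2 = face \<Phi> 2"
      using face_flag_adj[of "adj 1 \<Phi>" 0 2] face_flag_adj[of \<Phi> 1 2] rank_3 by (simp add: a_image)
    have b0: "face (b ` \<Phi>) 0 = face \<Phi> 0"
      using face_flag_adj[of "adj 2 \<Phi>" 1 0] face_flag_adj[of \<Phi> 2 0] rank_3 by (simp add: b_image)
    have "f (face \<Phi> 2) = face \<Phi> 2" "f (face \<Phi> 0) = face \<Phi> 0"
      using fix_face[OF a_closed _ _ a2 f(1)] fix_face[OF b_closed _ _ b0 f(2)] by simp_all
    then have f02: "face (f ` \<Phi>) 2 = face \<Phi> 2" "face (f ` \<Phi>) 0 = face \<Phi> 0"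
      using face_aut_image[OF fc base_flag'] rank_3 by simp_all
    have fm: "f ` \<Phi> \<in> flags P" by (rule aut_image_flag[OF fc base_flag'])
    have eq: "face (f ` \<Phi>) k = face \<Phi> k" if "-1 \<le> k" "k \<le> 3" "k \<noteq> 1" for k
    proof -
      have "k = -1 \<or> k = 0 \<or> k = 2 \<or> k = 3" using that by linarith
      then show ?thesis using f02 face_extreme_eq[OF fm base_flag'] rank_3 by auto
    qed
    have "f ` \<Phi> = \<Phi>"
    proof (rule ccontr)
      assume "f ` \<Phi> \<noteq> \<Phi>"
      then have "adj 1 \<Phi> = f ` \<Phi>"
        using eq rank_3 by (intro flag_adj_eqI[OF base_flag' _ fm]) auto
      then show False using aut_image_neq_adj[OF fc base_flag', of 1] by simp
    qed
    then show ?thesis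
      using base_aut_eqI[OF fc G.one_closed] aut_one_image[OF flag_subset[OF base_flag']] by simp
  qed
  then show ?thesis by (auto intro: generate.one)
qed

lemma rotation_group_eq: "rotation_group P = aut_group P"
  by (simp add: rotation_group_def chiral)

end

subsection \<open>Mirror image and dual\<close>

lemma mirror_simps [simp]:
  "faces (mirror P) = faces P" "incidence (mirror P) = incidence P"
  "face_rank (mirror P) = face_rank P" "poset_rank (mirror P) = poset_rank P"
  "base_flag (mirror P) = flag_adj P 0 (base_flag P)"
  by (simp_all add: mirror_def)

lemma mirror_derived [simp]:
  "flags (mirror P) = flags P" "flag_adj (mirror P) = flag_adj P" "aut_group (mirror P) =
      aut_group P"
  "flag_orbit (mirror P) = flag_orbit P"
  by (simp_all add: flags_def flag_adj_def aut_group_def flag_orbit_def fun_eq_iff)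

lemma dual_simps [simp]:
  "faces (dual P) = faces P" "incidence (dual P) = (incidence P)\<inverse>"
  "face_rank (dual P) = (\<lambda>F. int (poset_rank P) - 1 - face_rank P F)"
  "poset_rank (dual P) = poset_rank P" "base_flag (dual P) = base_flag P"
  by (simp_all add: dual_def)

lemma flags_dual [simp]: "flags (dual P) = flags P"
proof -
  have "pred_on.chain A (\<lambda>x y. (y, x) \<in> r) = pred_on.chain A (\<lambda>x y. (x, y) \<in> r)"
      for A and r :: "'a rel"
    unfolding pred_on.chain_def by (intro ext) blast
  then show ?thesis by (simp add: flags_def pred_on.maxchain_def)
qed

lemma aut_group_dual [simp]: "aut_group (dual P) = aut_group P"
  by (auto simp: aut_group_def)

lemma flag_orbit_dual [simp]: "flag_orbit (dual P) = flag_orbit P"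
  by (simp add: flag_orbit_def fun_eq_iff)

lemma flag_adj_dual:
  assumes "j < poset_rank P"
  shows "flag_adj (dual P) j C = flag_adj P (poset_rank P - 1 - j) C"
proof -
  have "int (poset_rank P) - 1 - r \<noteq> int j \<longleftrightarrow> r \<noteq> int (poset_rank P - 1 - j)" for r
    using assms by auto
  then show ?thesis by (simp add: flag_adj_def)
qed

context polytope
begin

lemma abstract_polytope_mirror: "0 < n \<Longrightarrow> abstract_polytope (mirror P)"
  using polytope flag_adj_flag[OF base_flag, of 0]
  by (simp add: abstract_polytope_def diamond_condition_def strongly_flag_connected_def)

lemma abstract_polytope_dual: "abstract_polytope (dual P)"
proof -
  have "diamond_condition (dual P)"
    unfolding diamond_condition_def
  proof (intro ballI impI)
    fix F H assume F: "F \<in> faces (dual P)" and H: "H \<in> faces (dual P)"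
      and FH: "(F, H) \<in> incidence (dual P) \<and> face_rank (dual P) H = face_rank (dual P) F + 2"
    have "card {K \<in> faces P. rk K = rk H + 1 \<and> le H K \<and> le K F} = 2"
      using polytope F H FH by (auto simp: abstract_polytope_def diamond_condition_def)
    moreover have "{K \<in> faces P. rk K = rk H + 1 \<and> le H K \<and> le K F} =
      {K \<in> faces (dual P). face_rank (dual P) K = face_rank (dual P) F + 1 \<and>
         (F, K) \<in> incidence (dual P) \<and> (K, H) \<in> incidence (dual P)}"
      using FH by auto
    ultimately show "card {K \<in> faces (dual P). face_rank (dual P) K = face_rank (dual P) F + 1 \<and>
         (F, K) \<in> incidence (dual P) \<and> (K, H) \<in> incidence (dual P)} = 2" by simp
  qed
  moreover have "strongly_flag_connected (dual P)"
    using polytope by (simp add: abstract_polytope_def strongly_flag_connected_def)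
  moreover have "partial_order_on (faces P) ((incidence P)\<inverse>)"
    using polytope by (simp add: abstract_polytope_def)
  moreover have "\<exists>L\<in>faces P. int n - 1 - rk L = -1 \<and> (\<forall>F\<in>faces P. (L, F) \<in> (incidence P)\<inverse>)"
    "\<exists>L\<in>faces P. int n - 1 - rk L = int n \<and> (\<forall>F\<in>faces P. (F, L) \<in> (incidence P)\<inverse>)"
  proof -
    obtain L U where "L \<in> faces P" "rk L = -1" "\<forall>F\<in>faces P. le L F"
      "U \<in> faces P" "rk U = int n" "\<forall>F\<in>faces P. le F U"
      using polytope by (auto simp: abstract_polytope_def)
    then show "\<exists>L\<in>faces P. int n - 1 - rk L = -1 \<and> (\<forall>F\<in>faces P. (L, F) \<in> (incidence P)\<inverse>)"
      "\<exists>L\<in>faces P. int n - 1 - rk L = int n \<and> (\<forall>F\<in>faces P. (F, L) \<in> (incidence P)\<inverse>)"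
      by (auto intro: bexI[of _ U] bexI[of _ L])
  qed
  moreover have "(\<lambda>F. int n - 1 - rk F) ` faces P \<subseteq> {-1..int n}"
    using rk_range by fastforce
  ultimately show ?thesis
    using polytope unfolding abstract_polytope_def
    by (simp only: dual_simps flags_dual simp_thms) (auto simp: rk_less)
qed

end

context finite_chiral_polyhedron
begin

lemma chiral_mirror: "chiral (mirror P)"
  using chiral abstract_polytope_mirror rank_3 by (simp add: chiral_def)

lemma chiral_dual: "chiral (dual P)"
  using chiral abstract_polytope_dual by (simp add: chiral_def)

lemma rotation_group_mirror: "rotation_group (mirror P) = aut_group P"
  and rotation_group_dual: "rotation_group (dual P) = aut_group P"
  by (simp_all add: rotation_group_def chiral_mirror chiral_dual)

text \<open>These are the values of the two generators under the bar automorphism. They are verified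
  on the base flag \<open>adj 0 \<Phi>\<close> of the mirror image, since automorphisms commute with
  the exchange of the vertex.\<close>

lemma rot_mirror:
  shows "rot (mirror P) 1 = inv\<^bsub>aut_group P\<^esub> a"
    and "rot (mirror P) 2 = a \<otimes>\<^bsub>aut_group P\<^esub> (a \<otimes>\<^bsub>aut_group P\<^esub> b)"
proof -
  interpret M: polytope "mirror P"
    by standard (rule abstract_polytope_mirror, simp add: rank_3)
  have "(inv\<^bsub>aut_group P\<^esub> a) ` adj 0 \<Phi> = adj 0 (adj 1 (adj 0 \<Phi>))"
    by (simp add: aut_adj inv_a_image)
  then show "rot (mirror P) 1 = inv\<^bsub>aut_group P\<^esub> a"
    by (intro M.rot_eqI) (simp_all add: finite_faces)
  have "(a \<otimes>\<^bsub>aut_group P\<^esub> (a \<otimes>\<^bsub>aut_group P\<^esub> b)) ` adj 0 \<Phi> = adj 1 (adj 2 (adj 0 \<Phi>))"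
    using adj_2_0[of \<Phi>] by (simp add: mult_image[of _ a] aut_adj a_image ab_image)
  then show "rot (mirror P) 2 = a \<otimes>\<^bsub>aut_group P\<^esub> (a \<otimes>\<^bsub>aut_group P\<^esub> b)"
    by (intro M.rot_eqI) (simp_all add: finite_faces)
qed

text \<open>Duality turns an exchange of rank j into one of rank 2 - j, so the first generator must
  send \<Phi> to \<open>adj 2 (adj 1 \<Phi>)\<close>, as the inverse of \<open>b\<close>
  does.\<close>

lemma rot_dual:
  shows "rot (dual P) 1 = inv\<^bsub>aut_group P\<^esub> b"
    and "rot (dual P) 2 = inv\<^bsub>aut_group P\<^esub> a"
proof -
  interpret D: polytope "dual P"
    by standard (rule abstract_polytope_dual)
  show "rot (dual P) 1 = inv\<^bsub>aut_group P\<^esub> b"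
    by (intro D.rot_eqI) (simp_all add: finite_faces flag_adj_dual rank_3 inv_b_image)
  show "rot (dual P) 2 = inv\<^bsub>aut_group P\<^esub> a"
    by (intro D.rot_eqI) (simp_all add: finite_faces flag_adj_dual rank_3 inv_a_image)
qed

end


section \<open>The coset poset of a rotation group of rank 3\<close>

text \<open>Collects the properties from which the rank 3 coset construction is shown to give a
  polytope. Nontriviality of the generators keeps the two faces in each diamond apart.\<close>

locale rotation_group_3 = group K for K (structure) +
  fixes s :: "nat \<Rightarrow> 'a"
  assumes s_closed [simp]: "s 1 \<in> carrier K" "s 2 \<in> carrier K"
    and finite_carrier: "finite (carrier K)"
    and e_squared: "s 1 \<otimes> s 2 \<otimes> (s 1 \<otimes> s 2) = \<one>"
    and generate_s: "generate K {s 1, s 2} = carrier K"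
    and generate_Int: "generate K {s 1} \<inter> generate K {s 2} = {\<one>}"
    and s_neq_one: "s 1 \<noteq> \<one>" "s 2 \<noteq> \<one>"
begin

abbreviation e :: 'a where "e \<equiv> s 1 \<otimes> s 2"
abbreviation st :: "int \<Rightarrow> 'a set" where "st \<equiv> face_stabilizer 3 K s"

section \<open>Identities for the generators, and the stabilizers of the base faces\<close>

lemma cancel_left [simp]:
  assumes "x \<in> carrier K" "y \<in> carrier K"
  shows "inv x \<otimes> (x \<otimes> y) = y" "x \<otimes> (inv x \<otimes> y) = y"
  using assms by (simp_all add: m_assoc[symmetric])

lemma e_e: "x \<in> carrier K \<Longrightarrow> e \<otimes> (e \<otimes> x) = x"
  using e_squared by (simp add: m_assoc[symmetric] del: m_assoc)

lemma e_s1: "e \<otimes> s 1 = inv (s 2)"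
proof -
  have "e \<otimes> s 1 \<otimes> s 2 = \<one>" using e_squared by (simp add: m_assoc)
  then show ?thesis by (metis inv_equality m_closed s_closed)
qed

lemma s1_inv_e: "inv (s 1) \<otimes> e = s 2" by simp

lemma e_inv_s2: "e \<otimes> inv (s 2) = s 1" by (simp add: m_assoc)

lemma s2_e: "s 2 \<otimes> e = inv (s 1)"
proof -
  have "s 1 \<otimes> (s 2 \<otimes> e) = \<one>" using e_squared by (simp add: m_assoc)
  then show ?thesis by (metis inv_equality inv_inv m_closed s_closed inv_closed inv_unique' r_inv)
qed

lemma tau_s: "tau K s 1 1 = s 1" "tau K s 1 2 = e" "tau K s 2 2 = s 2"
proof -
  have "[1..<Suc 1] = [1]" "[1..<Suc 2] = [1, 2]" "[2..<Suc 2] = [2]"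
    by (simp_all add: upt_rec)
  then show "tau K s 1 1 = s 1" "tau K s 1 2 = e" "tau K s 2 2 = s 2"
    by (simp_all add: tau_def)
qed

text \<open>In rank 3 the elements \<open>tau K s i k\<close> have the index pairs (i - 1, k) = (0,
  1), (0, 2), (1, 2), belonging to s_1, e and s_2; those whose pair avoids j remain.\<close>

lemma stabilizer_eq_generate:
  "st j = generate K ((if 0 \<noteq> j \<and> 1 \<noteq> j then {s 1} else {}) \<union> (if 0 \<noteq> j \<and> 2 \<noteq> j then {e} else {}) \<union>
     (if 1 \<noteq> j \<and> 2 \<noteq> j then {s 2} else {}))"
proof -
  have ij: "1 \<le> i \<and> i \<le> k \<and> k < (3 :: nat) \<longleftrightarrow> i = 1 \<and> k = 1 \<or> i = 1 \<and> k = 2 \<or> i = 2 \<and> k = 2" for i k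
    by auto
  have "{tau K s i k | i k. 1 \<le> i \<and> i \<le> k \<and> k < 3 \<and> i - 1 \<in> {k. k < 3 \<and> int k \<noteq> j} \<and>
      k \<in> {k. k < 3 \<and> int k \<noteq> j}}
    = {t. \<exists>i k. (1 \<le> i \<and> i \<le> k \<and> k < 3) \<and> t = tau K s i k \<and> int (i - 1) \<noteq> j \<and> int k \<noteq> j}"
  proof (intro Collect_cong iff_exI)
    fix t i k
    show "(t = tau K s i k \<and> 1 \<le> i \<and> i \<le> k \<and> k < 3 \<and> i - 1 \<in> {k. k < 3 \<and> int k \<noteq> j} \<and>
        k \<in> {k. k < 3 \<and> int k \<noteq> j}) =
      ((1 \<le> i \<and> i \<le> k \<and> k < 3) \<and> t = tau K s i k \<and> int (i - 1) \<noteq> j \<and> int k \<noteq> j)"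
      using diff_le_self[of i 1] by (auto simp del: of_nat_diff)
  qed
  also have "\<dots> = (if 0 \<noteq> j \<and> 1 \<noteq> j then {s 1} else {}) \<union> (if 0 \<noteq> j \<and> 2 \<noteq> j then {e} else {}) \<union>
     (if 1 \<noteq> j \<and> 2 \<noteq> j then {s 2} else {})"
    unfolding ij by (auto simp: conj_disj_distribR ex_disj_distrib tau_s)
  finally show ?thesis unfolding face_stabilizer_def tau_subgroup_def by simp
qed

lemma stabilizer:
  shows stabilizer_0: "st 0 = generate K {s 2}"
    and stabilizer_1: "st 1 = {\<one>, e}"
    and stabilizer_2: "st 2 = generate K {s 1}"
    and stabilizer_extreme: "j \<notin> {0, 1, 2} \<Longrightarrow> st j = carrier K"
proof -
  show "st 0 = generate K {s 2}" "st 2 = generate K {s 1}"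
    by (simp_all add: stabilizer_eq_generate)
  have "subgroup {\<one>, e} K"
  proof
    show "inv x \<in> {\<one>, e}" if "x \<in> {\<one>, e}" for x
      using that e_squared by (auto intro: inv_equality)
  qed (use e_squared in auto)
  then have "generate K {e} = {\<one>, e}"
    by (intro equalityI generate_subgroup_incl) (auto intro: generate.one generate.incl)
  then show "st 1 = {\<one>, e}" by (simp add: stabilizer_eq_generate)
  show "st j = carrier K" if "j \<notin> {0, 1, 2}"
  proof -
    have "generate K {s 1, s 2} \<subseteq> generate K {s 1, e, s 2}" by (rule mono_generate) auto
    moreover have "generate K {s 1, e, s 2} \<subseteq> carrier K" by (rule generate_incl) auto
    ultimately show ?thesis using that generate_s by (simp add: stabilizer_eq_generate
        insert_commute)
  qed
qed

lemma subgroup_st: "subgroup (st j) K"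
  unfolding stabilizer_eq_generate by (rule generate_is_subgroup) auto

lemma st_closed: "x \<in> st j \<Longrightarrow> x \<in> carrier K"
  using subgroup.mem_carrier[OF subgroup_st] .

lemma s2_in_st: "s 2 \<in> st 0" and s1_in_st: "s 1 \<in> st 2" and e_in_st: "e \<in> st 1"
  by (auto simp: stabilizer intro: generate.incl)

lemma st_0_2: "x \<in> st 0 \<Longrightarrow> x \<in> st 2 \<Longrightarrow> x = \<one>"
  using generate_Int by (auto simp: stabilizer)

text \<open>If e were in the subgroup of s_2, so would be s_1 = e s_2^-1, against the intersection
  property; with s_2 = s_1^-1 e the other case is the same.\<close>

lemma e_notin_st: "e \<notin> st 0" "e \<notin> st 2"
proof -
  show "e \<notin> st 0"
  proof
    assume "e \<in> st 0"
    then have "e \<otimes> inv (s 2) \<in> st 0"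
      using subgroup_st[of 0] s2_in_st by (simp add: subgroup.m_closed subgroup.m_inv_closed)
    then show False using st_0_2 s1_in_st s_neq_one e_inv_s2 by simp
  qed
  show "e \<notin> st 2"
  proof
    assume "e \<in> st 2"
    then have "inv (s 1) \<otimes> e \<in> st 2"
      using subgroup.m_closed[OF subgroup_st subgroup.m_inv_closed[OF subgroup_st s1_in_st]] by
          blast
    then show False using st_0_2 s2_in_st s_neq_one s1_inv_e by simp
  qed
qed

lemma s1_notin_st: "s 1 \<notin> st 1"
  using s_neq_one by (auto simp: stabilizer_1)

section \<open>Faces as right cosets, incidence as a common representative\<close>

definition fc :: "int \<Rightarrow> 'a \<Rightarrow> int \<times> 'a set" where
  "fc j g = (j, st j #> g)"

lemma fst_fc [simp]: "fst (fc j g) = j" by (simp add: fc_def)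

lemma mem_coset_iff: "g \<in> carrier K \<Longrightarrow> h \<in> carrier K \<Longrightarrow> g \<in> st j #> h \<longleftrightarrow> g \<otimes> inv h \<in> st j"
  using subgroup.rcos_module[OF subgroup_st is_group] by blast

lemma fc_eq_iff:
  assumes "g \<in> carrier K" "h \<in> carrier K"
  shows "fc j g = fc k h \<longleftrightarrow> j = k \<and> g \<otimes> inv h \<in> st j"
proof -
  have "st j #> g = st j #> h \<longleftrightarrow> g \<in> st j #> h"
    using rcos_self[OF assms(1) subgroup_st] repr_independence[OF _ assms(2) subgroup_st,
        of g] by metis
  then show ?thesis using mem_coset_iff[OF assms] by (auto simp: fc_def)
qed

lemma fc_mult: "x \<in> st j \<Longrightarrow> g \<in> carrier K \<Longrightarrow> fc j (x \<otimes> g) = fc j g"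
  using st_closed[of x j] by (subst fc_eq_iff) (auto simp: m_assoc)

lemma fc_eqE:
  assumes "fc j g = fc k h" "g \<in> carrier K" "h \<in> carrier K"
  obtains x where "j = k" "x \<in> st j" "g = x \<otimes> h"
  using assms fc_eq_iff[OF assms(2,3)] by (auto simp: m_assoc intro: that[of "g \<otimes> inv h"])

lemma fc_mult_eqD:
  assumes "fc j (x \<otimes> g) = fc j g" "x \<in> carrier K" "g \<in> carrier K"
  shows "x \<in> st j"
  using assms fc_eq_iff[of "x \<otimes> g" g j j] by (simp add: m_assoc)

lemma fc_s2 [simp]: "g \<in> carrier K \<Longrightarrow> fc 0 (s 2 \<otimes> g) = fc 0 g"
  and fc_s1 [simp]: "g \<in> carrier K \<Longrightarrow> fc 2 (s 1 \<otimes> g) = fc 2 g"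
  and fc_e [simp]: "g \<in> carrier K \<Longrightarrow> fc 1 (e \<otimes> g) = fc 1 g"
  by (simp_all add: fc_mult s1_in_st s2_in_st e_in_st)

lemma fc_extreme: "j \<notin> {0, 1, 2} \<Longrightarrow> g \<in> carrier K \<Longrightarrow> h \<in> carrier K \<Longrightarrow> fc j g = fc j h"
  by (simp add: fc_eq_iff stabilizer_extreme)

lemma fc_0_e_s1: "g \<in> carrier K \<Longrightarrow> fc 0 (e \<otimes> (s 1 \<otimes> g)) = fc 0 g"
proof -
  assume g: "g \<in> carrier K"
  have "inv (s 2) \<in> st 0" using subgroup_st[of 0] s2_in_st by (simp add: subgroup.m_inv_closed)
  moreover have "e \<otimes> (s 1 \<otimes> g) = inv (s 2) \<otimes> g"
    using g e_s1 by (metis m_assoc m_closed s_closed)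
  ultimately show ?thesis using g by (simp add: fc_mult)
qed

lemma fc_neq:
  assumes "g \<in> carrier K"
  shows "fc 0 (e \<otimes> g) \<noteq> fc 0 g" "fc 2 (e \<otimes> g) \<noteq> fc 2 g" "fc 1 (s 1 \<otimes> g) \<noteq> fc 1 g"
  using assms e_notin_st s1_notin_st fc_mult_eqD[OF _ _ assms] by auto

lemma fc_1_eqD:
  assumes "fc 1 g = fc 1 h" "g \<in> carrier K" "h \<in> carrier K"
  shows "g = h \<or> g = e \<otimes> h"
  using assms by (auto elim!: fc_eqE simp: stabilizer_1)

abbreviation Q :: "(int \<times> 'a set) based_poset" where "Q \<equiv> coset_poset 3 K s"

lemma rank_Q [simp]: "poset_rank Q = 3" "face_rank Q = fst"
  by (simp_all add: coset_poset_def)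

lemma faces_Q: "faces Q = (\<Union>j\<in>{-1..3}. fc j ` carrier K)"
  by (auto simp: coset_poset_def coset_faces_def RCOSETS_def fc_def)

lemma fc_in_faces: "j \<in> {-1..3} \<Longrightarrow> g \<in> carrier K \<Longrightarrow> fc j g \<in> faces Q"
  by (auto simp: faces_Q)

text \<open>An element common to two cosets represents both of them, so incident faces can be
  written with one representative.\<close>

lemma incidence_iff:
  "(p, q) \<in> incidence Q \<longleftrightarrow>
    (\<exists>i\<in>{-1..3}. \<exists>j\<in>{-1..3}. \<exists>x\<in>carrier K. i \<le> j \<and> p = fc i x \<and> q = fc j x)"
proof
  assume pq: "(p, q) \<in> incidence Q"
  obtain i Y j Z where p: "p = (i, Y)" and q: "q = (j, Z)" by (metis surj_pair)
  with pq have "(i, Y) \<in> faces Q" "(j, Z) \<in> faces Q" "i \<le> j" "Y \<inter> Z \<noteq> {}"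
    by (auto simp: coset_poset_def)
  then obtain g h x where g: "g \<in> carrier K" "Y = st i #> g" and h: "h \<in> carrier K" "Z = st j #> h"
    and x: "x \<in> Y" "x \<in> Z" and ij: "i \<in> {-1..3}" "j \<in> {-1..3}" "i \<le> j"
    unfolding faces_Q fc_def by blast
  have xc: "x \<in> carrier K" using x g r_coset_subset_G[OF subgroup.subset[OF subgroup_st]] by blast
  have "Y = st i #> x" "Z = st j #> x"
    using repr_independence[OF _ g(1) subgroup_st, of x i] repr_independence[OF _ h(1)
        subgroup_st, of x j] g h x
    by auto
  then show "\<exists>i\<in>{-1..3}. \<exists>j\<in>{-1..3}. \<exists>x\<in>carrier K. i \<le> j \<and> p = fc i x \<and> q = fc j x"
    using ij xc p q unfolding fc_def by blast
next
  assume "\<exists>i\<in>{-1..3}. \<exists>j\<in>{-1..3}. \<exists>x\<in>carrier K. i \<le> j \<and> p = fc i x \<and> q = fc j x"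
  then obtain i j x where ij: "i \<in> {-1..3}" "j \<in> {-1..3}" "i \<le> j" and x: "x \<in> carrier K"
    and pq: "p = fc i x" "q = fc j x" by blast
  have "x \<in> st i #> x" "x \<in> st j #> x" using rcos_self[OF x subgroup_st] by auto
  moreover have "(i, st i #> x) \<in> coset_faces 3 K s" "(j, st j #> x) \<in> coset_faces 3 K s"
    using fc_in_faces[OF ij(1) x] fc_in_faces[OF ij(2) x] by (simp_all add: coset_poset_def fc_def)
  ultimately show "(p, q) \<in> incidence Q"
    using ij unfolding pq fc_def coset_poset_def by auto
qed

lemma incidenceI: "i \<in> {-1..3} \<Longrightarrow> j \<in> {-1..3} \<Longrightarrow> i \<le> j \<Longrightarrow> x \<in> carrier K \<Longrightarrow> (fc i x,
    fc j x) \<in> incidence Q"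
  unfolding incidence_iff by blast

lemma incidence_trans:
  assumes "(p, q) \<in> incidence Q" "(q, r) \<in> incidence Q"
  shows "(p, r) \<in> incidence Q"
proof -
  obtain i j x where ij: "i \<in> {-1..3}" "j \<in> {-1..3}" "i \<le> j" and x: "x \<in> carrier K"
    and p: "p = fc i x" "q = fc j x" using assms(1) unfolding incidence_iff by blast
  obtain j' k y where jk: "j' \<in> {-1..3}" "k \<in> {-1..3}" "j' \<le> k" and y: "y \<in> carrier K"
    and q: "q = fc j' y" "r = fc k y" using assms(2) unfolding incidence_iff by blast
  have jj: "j' = j" using p q by (metis fst_fc)
  have eq: "fc j x = fc j y" using p q jj by simp
  have "\<exists>z\<in>carrier K. fc i z = fc i x \<and> fc k z = fc k y"
  proof -
    \<comment> \<open>Equal ranks and improper faces are harmless; the one real case is a vertex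
      below an edge below a 2-face.\<close>
    consider "i = j" | "j = k" | "i = -1" | "k = 3" | "i = 0" "j = 1" "k = 2"
      using ij jk jj by force
    then show ?thesis
    proof cases
      case 1
      then show ?thesis using eq y by auto
    next
      case 2
      then show ?thesis using eq x by auto
    next
      case 3
      then show ?thesis using fc_extreme[of i x y] x y by auto
    next
      case 4
      then show ?thesis using fc_extreme[of k x y] x y by auto
    next
      case 5
      then consider "y = x" | "y = e \<otimes> x" using fc_1_eqD[of y x] eq x y by auto
      then show ?thesis
      proof cases
        case 1
        then show ?thesis using x by auto
      next
        case 2
        \<comment> \<open>Here y = s_1 (s_2 x), so s_2 x represents the 2-face of y, while it still
          represents the vertex of x.\<close>
        then have "fc 2 y = fc 2 (s 2 \<otimes> x)" using x by (simp add: m_assoc)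
        then show ?thesis using x 5 by (intro bexI[of _ "s 2 \<otimes> x"]) simp_all
      qed
    qed
  qed
  then show ?thesis
    unfolding incidence_iff p(1) q(2) using ij jk jj by (metis order_trans)
qed

lemma incidence_rank: "(p, q) \<in> incidence Q \<Longrightarrow> fst p \<le> fst q"
  unfolding incidence_iff by auto

lemma incidence_eq:
  assumes "(p, q) \<in> incidence Q" "fst p = fst q"
  shows "p = q"
  using assms unfolding incidence_iff by auto

lemma partial_order_Q: "partial_order_on (faces Q) (incidence Q)"
  unfolding partial_order_on_def preorder_on_def
proof (intro conjI)
  show "refl_on (faces Q) (incidence Q)"
    unfolding refl_on_def by (auto simp: faces_Q intro: incidenceI)
  show "trans (incidence Q)" using incidence_trans by (auto intro: transI)
  show "antisym (incidence Q)"
    by (rule antisymI) (metis incidence_eq incidence_rank order_antisym)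
qed (auto simp: incidence_iff fc_in_faces)

text \<open>
  The two orbits of flags under right multiplication, distinguished by the Boolean: the flags
  \<open>(S\<^sub>0 g, S\<^sub>1 g, S\<^sub>2 g)\<close> and their images under the exchange of the vertex.
\<close>

definition fl :: "bool \<Rightarrow> 'a \<Rightarrow> int \<Rightarrow> int \<times> 'a set" where
  "fl b g k = fc k (if b \<and> k = 0 then e \<otimes> g else g)"

definition flag :: "bool \<Rightarrow> 'a \<Rightarrow> (int \<times> 'a set) set" where
  "flag b g = fl b g ` {-1..3}"

lemma fst_fl [simp]: "fst (fl b g k) = k" by (simp add: fl_def)

lemma fl_simps: "fl False g k = fc k g" "fl b g 1 = fc 1 g" "fl b g 2 = fc 2 g" "fl True g 0 =
    fc 0 (e \<otimes> g)"
  "k \<noteq> 0 \<Longrightarrow> fl b g k = fc k g"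
  by (simp_all add: fl_def)

lemma fl_in_faces: "g \<in> carrier K \<Longrightarrow> k \<in> {-1..3} \<Longrightarrow> fl b g k \<in> faces Q"
  by (simp add: fl_def fc_in_faces)

lemma base_flag_Q: "base_flag Q = flag False \<one>"
proof -
  have "st j #> \<one> = st j" for j using coset_mult_one[OF subgroup.subset[OF subgroup_st]] .
  then show ?thesis by (simp add: coset_poset_def flag_def fl_simps fc_def)
qed

lemma fl_incidence:
  assumes g: "g \<in> carrier K" and ij: "i \<in> {-1..3}" "j \<in> {-1..3}" "i \<le> j"
  shows "(fl b g i, fl b g j) \<in> incidence Q"
proof (cases "b \<and> i = 0 \<and> j \<noteq> 0")
  case False
  consider "\<not> (b \<and> i = 0)" "\<not> (b \<and> j = 0)" | "b" "i = 0" "j = 0" | "b" "i = -1" "j = 0"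
    using False ij by force
  then show ?thesis
  proof cases
    case 1
    then show ?thesis using incidenceI[OF ij g] by (auto simp: fl_def)
  next
    case 2
    then show ?thesis using incidenceI[OF ij, of "e \<otimes> g"] g by (auto simp: fl_def)
  next
    case 3
    then show ?thesis
      using incidenceI[OF ij, of "e \<otimes> g"] fc_extreme[of i g "e \<otimes> g"] g by (auto simp: fl_def)
  qed
next
  case True
  consider "j = 1" | "j = 2" | "j = 3" using True ij by force
  then show ?thesis
  proof cases
    case 1
    then show ?thesis using incidenceI[of 0 1 "e \<otimes> g"] g True by (simp add: fl_def)
  next
    case 2
    \<comment> \<open>In the second class the vertex is represented by e g and the 2-face by g;
      since s_2 e = s_1^-1, the element s_2 e g represents both.\<close>
    let ?z = "s 2 \<otimes> (e \<otimes> g)"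
    have "?z = inv (s 1) \<otimes> g" using g s2_e by (metis m_assoc m_closed s_closed)
    then have "fc 2 ?z = fc 2 g"
      using g fc_mult[of "inv (s 1)" 2 g] subgroup.m_inv_closed[OF subgroup_st s1_in_st] by simp
    then show ?thesis using incidenceI[of 0 2 ?z] g True 2 by (simp add: fl_def)
  next
    case 3
    then show ?thesis
      using incidenceI[of 0 3 "e \<otimes> g"] fc_extreme[of 3 g "e \<otimes> g"] g True by (simp add: fl_def)
  qed
qed

abbreviation chain :: "(int \<times> 'a set) set \<Rightarrow> bool" where
  "chain \<equiv> pred_on.chain (faces Q) (\<lambda>x y. (x, y) \<in> incidence Q)"

lemma chain_rank_inj:
  assumes "chain C" "p \<in> C" "q \<in> C" "fst p = fst q"
  shows "p = q"
proof -
  have "(p, q) \<in> incidence Q \<or> p = q \<or> (q, p) \<in> incidence Q"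
    using assms(1-3) unfolding pred_on.chain_def by blast
  then show ?thesis using incidence_eq[of p q] incidence_eq[of q p] assms(4) by auto
qed

lemma chain_flag: "g \<in> carrier K \<Longrightarrow> chain (flag b g)"
  unfolding pred_on.chain_def flag_def
proof (intro conjI ballI)
  assume g: "g \<in> carrier K"
  show "fl b g ` {-1..3} \<subseteq> faces Q" using g fl_in_faces by auto
  fix p q assume "p \<in> fl b g ` {-1..3}" "q \<in> fl b g ` {-1..3}"
  then obtain i j where "i \<in> {-1..3}" "j \<in> {-1..3}" "p = fl b g i" "q = fl b g j" by auto
  then show "(\<lambda>x y. (x, y) \<in> incidence Q)\<^sup>=\<^sup>= p q \<or> (\<lambda>x y. (x, y) \<in> incidence Q)\<^sup>=\<^sup>= q p"
    using fl_incidence[OF g, of i j b] fl_incidence[OF g, of j i b] by (cases "i \<le> j") auto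
qed

lemma flag_in_flags:
  assumes g: "g \<in> carrier K"
  shows "flag b g \<in> flags Q"
proof -
  have "\<not> flag b g \<subset> D" if D: "chain D" for D
  proof
    assume sub: "flag b g \<subset> D"
    then obtain p where p: "p \<in> D" "p \<notin> flag b g" by auto
    then have "p \<in> faces Q" using D by (auto simp: pred_on.chain_def)
    then have "fst p \<in> {-1..3}" by (auto simp: faces_Q)
    then have "fl b g (fst p) \<in> flag b g" by (auto simp: flag_def)
    then show False using chain_rank_inj[OF D p(1), of "fl b g (fst p)"] sub p by auto
  qed
  then show ?thesis
    using chain_flag[OF g] by (auto simp: flags_def pred_on.maxchain_def)
qed

text \<open>If there is an edge, a representative g common to it and the 2-face is chosen; the edge
  then leaves g or e g for the vertex, which is what the Boolean records. Without an edge, the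
  vertex and the 2-face share a representative.\<close>

lemma chain_subset_flag:
  assumes C: "chain C"
  shows "\<exists>b. \<exists>g\<in>carrier K. C \<subseteq> flag b g"
proof -
  have face: "\<exists>x\<in>carrier K. p = fc (fst p) x \<and> fst p \<in> {-1..3}" if "p \<in> C" for p
  proof -
    have "p \<in> faces Q" using that C by (auto simp: pred_on.chain_def)
    then obtain j x where "j \<in> {-1..3}" "x \<in> carrier K" "p = fc j x" unfolding faces_Q by blast
    then show ?thesis by auto
  qed
  have inc: "(p, q) \<in> incidence Q" if "p \<in> C" "q \<in> C" "fst p < fst q" for p q
    using that C incidence_rank[of q p] by (auto simp: pred_on.chain_def)
  have common: "\<exists>z\<in>carrier K. p = fc (fst p) z \<and> q = fc (fst q) z" if "p \<in> C" "q \<in> C"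
      "fst p < fst q" for p q
    using inc[OF that] unfolding incidence_iff by auto
  have sub: "C \<subseteq> flag b g" if g: "g \<in> carrier K" and "\<And>p. p \<in> C \<Longrightarrow> fst p \<in> {0, 1, 2} \<Longrightarrow> p =
      fl b g (fst p)" for b g
  proof
    fix p assume p: "p \<in> C"
    obtain x where x: "x \<in> carrier K" "p = fc (fst p) x" "fst p \<in> {-1..3}" using face[OF p] by blast
    have "p = fl b g (fst p)"
    proof (cases "fst p \<in> {0, 1, 2}")
      case False
      then have "fc (fst p) x = fc (fst p) g" using x g fc_extreme by blast
      then show ?thesis using False x by (simp add: fl_def)
    qed (rule that(2)[OF p])
    then show "p \<in> flag b g" unfolding flag_def using x(3) by blast
  qed
  have uniq: "p = q" if "p \<in> C" "q \<in> C" "fst p = fst q" for p q by (rule chain_rank_inj[OF C that])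
  show ?thesis
  proof (cases "\<exists>p\<in>C. fst p = 1")
    case True
    then obtain p1 where p1: "p1 \<in> C" "fst p1 = 1" by auto
    have "\<exists>g\<in>carrier K. p1 = fc 1 g \<and> (\<forall>p\<in>C. fst p = 2 \<longrightarrow> p = fc 2 g)"
    proof (cases "\<exists>p\<in>C. fst p = 2")
      case True
      then obtain p2 where p2: "p2 \<in> C" "fst p2 = 2" by auto
      then obtain z where "z \<in> carrier K" "p1 = fc 1 z" "p2 = fc 2 z"
        using common[of p1 p2] p1 by auto
      then show ?thesis using uniq p2 by metis
    next
      case False
      then show ?thesis using face[OF p1(1)] p1 by auto
    qed
    then obtain g where g: "g \<in> carrier K" "p1 = fc 1 g" "\<forall>p\<in>C. fst p = 2 \<longrightarrow> p = fc 2 g" by blast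
    have "\<exists>b. \<forall>p\<in>C. fst p = 0 \<longrightarrow> p = fl b g 0"
    proof (cases "\<exists>p\<in>C. fst p = 0")
      case True
      then obtain p0 where p0: "p0 \<in> C" "fst p0 = 0" by auto
      then obtain z where z: "z \<in> carrier K" "p0 = fc 0 z" "p1 = fc 1 z"
        using common[of p0 p1] p1 by auto
      then have "z = g \<or> z = e \<otimes> g" using fc_1_eqD g by metis
      then have "p0 = fl False g 0 \<or> p0 = fl True g 0" using z by (auto simp: fl_simps)
      then show ?thesis using uniq p0 by metis
    qed auto
    then obtain b where b: "\<forall>p\<in>C. fst p = 0 \<longrightarrow> p = fl b g 0" by blast
    have "p = fl b g (fst p)" if "p \<in> C" "fst p \<in> {0, 1, 2}" for p
    proof -
      have "p = fc 1 g" if "fst p = 1" using uniq[OF \<open>p \<in> C\<close> p1(1)] p1(2) g(2) that by simp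
      then show ?thesis using that b g(3) by (auto simp: fl_simps)
    qed
    then show ?thesis using sub g by blast
  next
    case no1: False
    have "\<exists>g\<in>carrier K. \<forall>p\<in>C. fst p \<in> {0, 2} \<longrightarrow> p = fc (fst p) g"
    proof (cases "\<exists>p\<in>C. fst p = 0")
      case True
      then obtain p0 where p0: "p0 \<in> C" "fst p0 = 0" by auto
      show ?thesis
      proof (cases "\<exists>p\<in>C. fst p = 2")
        case True
        then obtain p2 where p2: "p2 \<in> C" "fst p2 = 2" by auto
        then obtain z where z: "z \<in> carrier K" "p0 = fc 0 z" "p2 = fc 2 z"
          using common[of p0 p2] p0 by auto
        have "p = fc (fst p) z" if "p \<in> C" "fst p \<in> {0, 2}" for p
          using uniq[OF that(1) p0(1)] uniq[OF that(1) p2(1)] that(2) p0(2) p2(2) z by auto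
        then show ?thesis using z by blast
      next
        case False
        obtain x where x: "x \<in> carrier K" "p0 = fc 0 x" using face[OF p0(1)] p0 by auto
        have "p = fc (fst p) x" if "p \<in> C" "fst p \<in> {0, 2}" for p
          using uniq[OF that(1) p0(1)] that p0(2) False x by auto
        then show ?thesis using x by blast
      qed
    next
      case no0: False
      show ?thesis
      proof (cases "\<exists>p\<in>C. fst p = 2")
        case True
        then obtain p2 where p2: "p2 \<in> C" "fst p2 = 2" by auto
        obtain x where x: "x \<in> carrier K" "p2 = fc 2 x" using face[OF p2(1)] p2 by auto
        have "p = fc (fst p) x" if "p \<in> C" "fst p \<in> {0, 2}" for p
          using uniq[OF that(1) p2(1)] that p2(2) no0 x by auto
        then show ?thesis using x by blast
      next
        case False
        then show ?thesis using no0 by (intro bexI[of _ \<one>]) auto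
      qed
    qed
    then obtain g where g: "g \<in> carrier K" "\<forall>p\<in>C. fst p \<in> {0, 2} \<longrightarrow> p = fc (fst p) g" by blast
    have "p = fl False g (fst p)" if "p \<in> C" "fst p \<in> {0, 1, 2}" for p
      using that g no1 by (auto simp: fl_simps)
    then show ?thesis using sub g by blast
  qed
qed

lemma flags_Q: "flags Q = {flag b g | b g. g \<in> carrier K}"
proof (intro equalityI subsetI)
  fix C assume C: "C \<in> flags Q"
  then have "chain C" by (auto simp: flags_def pred_on.maxchain_def)
  then obtain b g where bg: "g \<in> carrier K" "C \<subseteq> flag b g" using chain_subset_flag by blast
  moreover have "\<not> C \<subset> flag b g"
    using C chain_flag[OF bg(1)] unfolding flags_def pred_on.maxchain_def by blast
  ultimately show "C \<in> {flag b g | b g. g \<in> carrier K}" by blast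
next
  fix C assume "C \<in> {flag b g | b g. g \<in> carrier K}"
  then show "C \<in> flags Q" using flag_in_flags by blast
qed

lemma card_flag: "card (flag b g) = 5"
proof -
  have "inj_on (fl b g) {-1..3}" by (rule inj_onI) (metis fst_fl)
  then show ?thesis unfolding flag_def by (simp add: card_image)
qed

end


lemma (in group_hom) ord_inj_hom:
  assumes "inj_on h (carrier G)" "x \<in> carrier G"
  shows "group.ord H (h x) = group.ord G x"
proof (rule H.ord_unique[THEN iffD2, rule_format])
  show "h x \<in> carrier H" using assms(2) by (rule hom_closed)
  fix k :: nat
  have "h x [^]\<^bsub>H\<^esub> k = h (x [^] k)" using assms(2) by (simp add: hom_nat_pow)
  also have "\<dots> = \<one>\<^bsub>H\<^esub> \<longleftrightarrow> x [^] k = \<one>"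
    using assms inj_onD[OF assms(1), of "x [^] k" \<one>] by auto
  finally show "h x [^]\<^bsub>H\<^esub> k = \<one>\<^bsub>H\<^esub> \<longleftrightarrow> G.ord x dvd k"
    using G.pow_eq_id[OF assms(2)] by simp
qed

text \<open>\<open>r\<close> recovers the index, as the rank does for a face of a flag, so members
  with different indices never coincide and the images differ exactly at j.\<close>

lemma adjacent_flags_imageI:
  assumes "j \<in> I" "f j \<noteq> h j" "\<And>k. k \<in> I \<Longrightarrow> k \<noteq> j \<Longrightarrow> f k = h k"
    "\<And>k. r (f k) = k" "\<And>k. r (h k) = k"
  shows "adjacent_flags (f ` I) (h ` I)"
proof -
  have iff: "f k \<in> h ` I \<longleftrightarrow> k \<noteq> j" "h k \<in> f ` I \<longleftrightarrow> k \<noteq> j" if "k \<in> I" for k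
  proof -
    have "f k \<in> h ` I \<longleftrightarrow> f k = h k" "h k \<in> f ` I \<longleftrightarrow> h k = f k"
      using that assms(4)[of k] assms(5)[of k] by (auto simp: image_iff) (metis assms(4,5))+
    then show "f k \<in> h ` I \<longleftrightarrow> k \<noteq> j" "h k \<in> f ` I \<longleftrightarrow> k \<noteq> j"
      using assms(2) assms(3)[OF that] by auto
  qed
  have "f ` I - h ` I = {f j}" "h ` I - f ` I = {h j}"
    using assms(1) iff by auto
  then show ?thesis by (simp add: adjacent_flags_def)
qed

context rotation_group_3
begin

text \<open>An edge has the two representatives x and e x, which give its two vertices and its two
  2-faces. The edges between a vertex and a 2-face are counted with the help of the intersection
  property.\<close>

lemma diamond_Q: "diamond_condition Q"
  unfolding diamond_condition_def
proof (intro ballI impI)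
  fix p q assume "p \<in> faces Q" "q \<in> faces Q"
  assume pq: "(p, q) \<in> incidence Q \<and> face_rank Q q = face_rank Q p + 2"
  then obtain i x where i: "i \<in> {-1, 0, 1}" and x: "x \<in> carrier K" and p: "p = fc i x" and q: "q =
      fc (i + 2) x"
  proof -
    obtain i j x where *: "i \<in> {-1..3}" "j \<in> {-1..3}" "x \<in> carrier K" "p = fc i x" "q = fc j x"
      using pq unfolding incidence_iff by blast
    moreover have j: "j = i + 2" using pq * by simp
    moreover have "i = -1 \<or> i = 0 \<or> i = 1" using *(1,2) j by (simp, linarith)
    ultimately show ?thesis using that[of i x] by auto
  qed
  let ?S = "{r \<in> faces Q. face_rank Q r = face_rank Q p + 1 \<and> (p, r) \<in> incidence Q \<and> (r,
      q) \<in> incidence Q}"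
  have inc: "(fc i' y, fc j' z) \<in> incidence Q \<longleftrightarrow> i' \<in> {-1..3} \<and> j' \<in> {-1..3} \<and> i' \<le> j' \<and>
      (\<exists>w\<in>carrier K. fc i' w = fc i' y \<and> fc j' w = fc j' z)" for i' j' y z
  proof
    assume "(fc i' y, fc j' z) \<in> incidence Q"
    then obtain k l w where w: "k \<in> {-1..3}" "l \<in> {-1..3}" "w \<in> carrier K" "k \<le> l" "fc i' y =
        fc k w" "fc j' z = fc l w"
      unfolding incidence_iff by blast
    then have "k = i'" "l = j'" by (simp_all add: fc_def)
    then show "i' \<in> {-1..3} \<and> j' \<in> {-1..3} \<and> i' \<le> j' \<and> (\<exists>w\<in>carrier K. fc i' w = fc i' y \<and>
        fc j' w = fc j' z)"
      using w by auto
  next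
    assume "i' \<in> {-1..3} \<and> j' \<in> {-1..3} \<and> i' \<le> j' \<and> (\<exists>w\<in>carrier K. fc i' w = fc i' y \<and> fc j' w =
        fc j' z)"
    then obtain w where "i' \<in> {-1..3}" "j' \<in> {-1..3}" "i' \<le> j'" "w \<in> carrier K" "fc i' w =
        fc i' y" "fc j' w = fc j' z"
      by blast
    then show "(fc i' y, fc j' z) \<in> incidence Q" using incidenceI[of i' j' w] by simp
  qed
  have S: "?S = {fc (i + 1) y | y. y \<in> carrier K \<and> (\<exists>w\<in>carrier K. fc i w = fc i x \<and> fc (i + 1) w =
      fc (i + 1) y) \<and>
     (\<exists>w\<in>carrier K. fc (i + 1) w = fc (i + 1) y \<and> fc (i + 2) w = fc (i + 2) x)}" (is "_ = ?T")
  proof (intro equalityI subsetI)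
    fix r assume r: "r \<in> ?S"
    then have "r \<in> faces Q" "fst r = i + 1" by (simp_all add: p)
    then obtain y where y: "y \<in> carrier K" "r = fc (i + 1) y" unfolding faces_Q by auto
    then show "r \<in> ?T" using r unfolding p q by (auto simp: inc)
  next
    fix r assume "r \<in> ?T"
    then obtain y where "y \<in> carrier K" "r = fc (i + 1) y" 
      "\<exists>w\<in>carrier K. fc i w = fc i x \<and> fc (i + 1) w = fc (i + 1) y"
      "\<exists>w\<in>carrier K. fc (i + 1) w = fc (i + 1) y \<and> fc (i + 2) w = fc (i + 2) x" by blast
    then show "r \<in> ?S" using i unfolding p q by (auto simp: inc fc_in_faces)
  qed
  have ex: "e \<otimes> x \<in> carrier K" "s 1 \<otimes> x \<in> carrier K" using x by simp_all
  consider "i = -1" | "i = 0" | "i = 1" using i by auto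
  then show "card ?S = 2"
  proof cases
    case 1
    have "?S = {fc 0 x, fc 0 (e \<otimes> x)}"
    proof (intro equalityI subsetI)
      fix r assume "r \<in> ?S"
      then obtain y w where "r = fc 0 y" "w \<in> carrier K" "fc 0 w = fc 0 y" "fc 1 w = fc 1 x"
        unfolding S 1 by auto
      then show "r \<in> {fc 0 x, fc 0 (e \<otimes> x)}" using fc_1_eqD[of w x] x by auto
    next
      fix r assume "r \<in> {fc 0 x, fc 0 (e \<otimes> x)}"
      then obtain y where y: "y \<in> {x, e \<otimes> x}" "r = fc 0 y" by auto
      then have "y \<in> carrier K" "fc (-1) y = fc (-1) x" "fc 1 y = fc 1 x"
        using x ex fc_extreme[of "-1" y x] by auto
      then show "r \<in> ?S" unfolding S 1 y by auto
    qed
    then show ?thesis using fc_neq(1)[OF x] by simp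
  next
    case 3
    have "?S = {fc 2 x, fc 2 (e \<otimes> x)}"
    proof (intro equalityI subsetI)
      fix r assume "r \<in> ?S"
      then obtain y w where "r = fc 2 y" "w \<in> carrier K" "fc 2 w = fc 2 y" "fc 1 w = fc 1 x"
        unfolding S 3 by auto
      then show "r \<in> {fc 2 x, fc 2 (e \<otimes> x)}" using fc_1_eqD[of w x] x by auto
    next
      fix r assume "r \<in> {fc 2 x, fc 2 (e \<otimes> x)}"
      then obtain y where y: "y \<in> {x, e \<otimes> x}" "r = fc 2 y" by auto
      then have "y \<in> carrier K" "fc 3 y = fc 3 x" "fc 1 y = fc 1 x"
        using x ex fc_extreme[of 3 y x] by auto
      then show "r \<in> ?S" unfolding S 3 y by auto
    qed
    then show ?thesis using fc_neq(2)[OF x] by simp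
  next
    case 2
    have "?S = {fc 1 x, fc 1 (s 1 \<otimes> x)}"
    proof (intro equalityI subsetI)
      fix r assume "r \<in> ?S"
      then obtain y w z where r: "r = fc 1 y" and w: "w \<in> carrier K" "fc 0 w = fc 0 x" "fc 1 w =
          fc 1 y"
        and z: "z \<in> carrier K" "fc 1 z = fc 1 y" "fc 2 z = fc 2 x"
        unfolding S 2 by auto
      obtain v where v: "v \<in> st 0" "w = v \<otimes> x" using w x by (auto elim: fc_eqE)
      obtain f where f: "f \<in> st 2" "z = f \<otimes> x" using z x by (auto elim: fc_eqE)
      have vf: "v \<in> carrier K" "f \<in> carrier K" using v f st_closed by auto
      \<comment> \<open>Both w = v x and z = f x represent the edge r, so f is v or e v. In the
        first case f = v lies in both stabilizers, in the second s_1^-1 f = s_2 v does; hence f is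
        the identity or s_1.\<close>
      have "z = w \<or> z = e \<otimes> w" using fc_1_eqD[of z w] w z by simp
      then show "r \<in> {fc 1 x, fc 1 (s 1 \<otimes> x)}"
      proof
        assume "z = w"
        then have "f = v" using v f vf x by simp
        then have "v = \<one>" using st_0_2 v f by simp
        then show ?thesis using r w v x by simp
      next
        assume "z = e \<otimes> w"
        then have "f \<otimes> x = (e \<otimes> v) \<otimes> x" using v f vf x by (simp add: m_assoc)
        then have "f = e \<otimes> v" using vf x by simp
        then have "f = s 1 \<otimes> (s 2 \<otimes> v)" using vf by (simp add: m_assoc)
        then have "inv (s 1) \<otimes> f = s 2 \<otimes> v" using vf by simp
        moreover have "inv (s 1) \<otimes> f \<in> st 2" "s 2 \<otimes> v \<in> st 0"
          using subgroup.m_closed[OF subgroup_st subgroup.m_inv_closed[OF subgroup_st s1_in_st]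
              f(1)]
            subgroup.m_closed[OF subgroup_st s2_in_st v(1)] by auto
        ultimately have "inv (s 1) \<otimes> f = \<one>" using st_0_2 by simp
        then have "f = s 1" using vf by (metis cancel_left(2) r_one s_closed(1))
        then show ?thesis using r z f by simp
      qed
    next
      \<comment> \<open>The witness s_2^-1 x has the vertex of x, and e s_2^-1 = s_1 shows that it
        has the edge of s_1 x.\<close>
      have "fc 1 (inv (s 2) \<otimes> x) = fc 1 (s 1 \<otimes> x)"
      proof -
        have "e \<otimes> (inv (s 2) \<otimes> x) = s 1 \<otimes> x" using x by (simp add: m_assoc)
        then show ?thesis using fc_e[of "inv (s 2) \<otimes> x"] x by simp
      qed
      moreover have "fc 0 (inv (s 2) \<otimes> x) = fc 0 x"
        using x by (intro fc_mult subgroup.m_inv_closed[OF subgroup_st s2_in_st])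
      ultimately have 1: "\<exists>w\<in>carrier K. fc 0 w = fc 0 x \<and> fc 1 w = fc 1 (s 1 \<otimes> x)"
        using x by (intro bexI[of _ "inv (s 2) \<otimes> x"]) simp_all
      have 3: "\<exists>w\<in>carrier K. fc 1 w = fc 1 (s 1 \<otimes> x) \<and> fc 2 w = fc 2 x"
        using x by (intro bexI[of _ "s 1 \<otimes> x"]) simp_all
      fix r assume "r \<in> {fc 1 x, fc 1 (s 1 \<otimes> x)}"
      then show "r \<in> ?S" using 1 3 ex x unfolding S 2 by auto
    qed
    then show ?thesis using fc_neq(3)[OF x] by simp
  qed
qed

section \<open>Exchanges and adjacency in the coset poset\<close>

lemma fl_exchange_0: "k \<noteq> 0 \<Longrightarrow> fl (\<not> b) g k = fl b g k"
  by (simp add: fl_def)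

text \<open>Passing from g to e g keeps the edge but changes both the vertex and the 2-face;
  flipping the Boolean restores the vertex, because e is an involution.\<close>

lemma fl_exchange_2:
  assumes g: "g \<in> carrier K" and k: "k \<noteq> 2"
  shows "fl (\<not> b) (e \<otimes> g) k = fl b g k"
proof -
  consider "k = 0" | "k = 1" | "k \<notin> {0, 1, 2}" using k by auto
  then show ?thesis
    using g e_e[OF g] fc_extreme[of k "e \<otimes> g" g] by cases (auto simp: fl_def)
qed

text \<open>Passing to s_1 g keeps the 2-face; with the Boolean set, the vertex is that of e s_1 g =
  s_2^-1 g, hence that of g.\<close>

lemma fl_exchange_1:
  assumes g: "g \<in> carrier K" and k: "k \<noteq> 1"
  shows "fl True (s 1 \<otimes> g) k = fl False g k"
proof -
  consider "k = 0" | "k = 2" | "k \<notin> {0, 1, 2}" using k by auto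
  then show ?thesis
    using g fc_0_e_s1[OF g] fc_extreme[of k "s 1 \<otimes> g" g] by cases (auto simp: fl_def)
qed

lemma fl_exchange_neq:
  assumes g: "g \<in> carrier K"
  shows "fl (\<not> b) g 0 \<noteq> fl b g 0" "fl (\<not> b) (e \<otimes> g) 2 \<noteq> fl b g 2"
    "fl True (s 1 \<otimes> g) 1 \<noteq> fl False g 1"
  using fc_neq[OF g] by (auto simp: fl_def)

lemma adjacent_flag:
  assumes g: "g \<in> carrier K"
  shows adjacent_flag_0: "adjacent_flags (flag b g) (flag (\<not> b) g)"
    and adjacent_flag_2: "adjacent_flags (flag b g) (flag (\<not> b) (e \<otimes> g))"
    and adjacent_flag_1: "adjacent_flags (flag False g) (flag True (s 1 \<otimes> g))"
proof -
  show "adjacent_flags (flag b g) (flag (\<not> b) g)"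
    unfolding flag_def
    by (rule adjacent_flags_imageI[where j = 0 and r = fst])
      (simp_all add: fl_exchange_0 fl_exchange_neq(1)[OF g, symmetric])
  show "adjacent_flags (flag b g) (flag (\<not> b) (e \<otimes> g))"
    unfolding flag_def
    by (rule adjacent_flags_imageI[where j = 2 and r = fst])
      (simp_all add: fl_exchange_2[OF g] fl_exchange_neq(2)[OF g, symmetric])
  show "adjacent_flags (flag False g) (flag True (s 1 \<otimes> g))"
    unfolding flag_def
    by (rule adjacent_flags_imageI[where j = 1 and r = fst])
      (simp_all add: fl_exchange_1[OF g] fl_exchange_neq(3)[OF g, symmetric])
qed

section \<open>Strong flag-connectedness of the coset poset\<close>

definition conn :: "(int \<times> 'a set) set \<Rightarrow> (int \<times> 'a set) set \<Rightarrow> (int \<times> 'a set) set \<Rightarrow> bool" where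
  "conn T = (\<lambda>C D. C \<in> flags Q \<and> D \<in> flags Q \<and> T \<subseteq> C \<and> T \<subseteq> D \<and> adjacent_flags C D)\<^sup>*\<^sup>*"

lemma conn_refl: "conn T C C" by (simp add: conn_def)

lemma conn_trans: "conn T C D \<Longrightarrow> conn T D E \<Longrightarrow> conn T C E"
  unfolding conn_def by (rule rtranclp_trans)

lemma conn_sym: "conn T C D \<Longrightarrow> conn T D C"
  unfolding conn_def
  by (rule sympD[OF symp_rtranclp]) (auto simp: symp_def adjacent_flags_def)

lemma conn_adj:
  assumes "g \<in> carrier K" "h \<in> carrier K" "T \<subseteq> flag b g" "T \<subseteq> flag c h"
      "adjacent_flags (flag b g) (flag c h)"
  shows "conn T (flag b g) (flag c h)"
  unfolding conn_def using assms flag_in_flags by (intro r_into_rtranclp) blast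

lemma fl_in_flag: "k \<in> {-1..3} \<Longrightarrow> fl b g k \<in> flag b g"
  by (simp add: flag_def)

text \<open>The two improper faces. They lie in every flag, hence in every set of common faces of
  two flags.\<close>

definition ext :: "(int \<times> 'a set) set" where "ext = {fc (-1) \<one>, fc 3 \<one>}"

lemma ext_subset: "g \<in> carrier K \<Longrightarrow> ext \<subseteq> flag b g"
  using fl_in_flag[of "-1" b g] fl_in_flag[of 3 b g] fc_extreme[of "-1" g \<one>] fc_extreme[of 3 g \<one>]
  by (simp add: ext_def fl_def)

lemma flag_contains:
  assumes "g \<in> carrier K" "k \<in> {-1..3}" "fl b g k = p"
  shows "insert p ext \<subseteq> flag b g"
  using ext_subset[OF assms(1)] fl_in_flag[OF assms(2)] assms(3) by auto

lemma flag_contains':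
  assumes "g \<in> carrier K" "k \<in> {-1..3}" "fl b g k = p" "T \<subseteq> insert p ext"
  shows "T \<subseteq> flag b g"
  using flag_contains[OF assms(1,2,3)] assms(4) by blast

lemma conn_s1:
  assumes g: "g \<in> carrier K" and T: "T \<subseteq> insert (fc 2 g) ext"
  shows "conn T (flag False g) (flag False (s 1 \<otimes> g))"
proof -
  have g': "s 1 \<otimes> g \<in> carrier K" using g by simp
  have "T \<subseteq> flag False g" "T \<subseteq> flag b (s 1 \<otimes> g)" for b
    by (rule flag_contains'[OF _ _ _ T, of _ 2]; use g in \<open>simp add: fl_simps\<close>)+
  then have "conn T (flag False g) (flag True (s 1 \<otimes> g))" "conn T (flag True (s 1 \<otimes> g)) (flag
      False (s 1 \<otimes> g))"
    using conn_adj[OF g g' _ _ adjacent_flag_1[OF g]] conn_adj[OF g' g' _ _ adjacent_flag_0[OF g',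
        of True]] by auto
  then show ?thesis by (rule conn_trans)
qed

text \<open>\<open>flag True (e \<otimes> g)\<close> is a common neighbour: it arises from g by
  exchanging the 2-face and from s_2 g by exchanging the edge, since s_1 s_2 g = e g. The vertex of
  g is kept throughout.\<close>

lemma conn_s2:
  assumes g: "g \<in> carrier K" and T: "T \<subseteq> insert (fc 0 g) ext"
  shows "conn T (flag False g) (flag False (s 2 \<otimes> g))"
proof -
  have g': "s 2 \<otimes> g \<in> carrier K" "e \<otimes> g \<in> carrier K" using g by simp_all
  have sub: "T \<subseteq> flag False g" "T \<subseteq> flag False (s 2 \<otimes> g)" "T \<subseteq> flag True (e \<otimes> g)"
    by (rule flag_contains'[OF _ _ _ T, of _ 0]; use g e_e[OF g] in \<open>simp add: fl_simps\<close>)+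
  have eq: "s 1 \<otimes> (s 2 \<otimes> g) = e \<otimes> g" using g by (simp add: m_assoc)
  have "conn T (flag False g) (flag True (e \<otimes> g))"
    using conn_adj[OF g g'(2) _ _ ] adjacent_flag_2[OF g, of False] sub by auto
  moreover have "conn T (flag False (s 2 \<otimes> g)) (flag True (e \<otimes> g))"
    using conn_adj[OF g'(1) g'(2)] adjacent_flag_1[OF g'(1)] sub eq by simp
  ultimately show ?thesis using conn_trans conn_sym by blast
qed

text \<open>\<open>B h\<close> bounds the faces \<open>T\<close> that a path has to keep. As the
  generators do not change it, paths for single generators can be concatenated to paths for all of
  the generated subgroup.\<close>

lemma conn_generate:
  assumes S: "S \<subseteq> carrier K"
    and step: "\<And>x h. x \<in> S \<Longrightarrow> h \<in> carrier K \<Longrightarrow> T \<subseteq> B h \<Longrightarrow> conn T (flag False h) (flag False (x \<otimes> h))"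
    and inv: "\<And>x h. x \<in> S \<Longrightarrow> h \<in> carrier K \<Longrightarrow> B (x \<otimes> h) = B h"
    and u: "u \<in> generate K S"
  shows "h \<in> carrier K \<Longrightarrow> T \<subseteq> B h \<Longrightarrow> conn T (flag False h) (flag False (u \<otimes> h)) \<and> B (u \<otimes> h) = B h"
  using u
proof (induction arbitrary: h)
  case one
  then show ?case by (simp add: conn_refl)
next
  case (incl x)
  then show ?case using step inv by blast
next
  case (inv x)
  then have x: "x \<in> carrier K" "inv x \<otimes> h \<in> carrier K" using S by auto
  then have eq: "x \<otimes> (inv x \<otimes> h) = h" using inv by simp
  then have "B (inv x \<otimes> h) = B h" using assms(3)[OF inv(1) x(2)] by simp
  then show ?case using step[OF inv(1) x(2)] inv eq conn_sym by simp
next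
  case (eng x y)
  have xy: "x \<in> carrier K" "y \<in> carrier K" using eng S generate_in_carrier by blast+
  have y: "conn T (flag False h) (flag False (y \<otimes> h))" "B (y \<otimes> h) = B h" using eng by blast+
  have "conn T (flag False (y \<otimes> h)) (flag False (x \<otimes> (y \<otimes> h)))" "B (x \<otimes> (y \<otimes> h)) = B (y \<otimes> h)"
    using eng.IH(1)[of "y \<otimes> h"] eng.prems y xy by auto
  then show ?case using y xy eng.prems conn_trans by (auto simp: m_assoc)
qed

lemma flag_Int_subset:
  "flag b g \<inter> flag c h \<subseteq> {fl b g k | k. k \<in> {-1..3} \<and> fl b g k = fl c h k}"
proof
  fix p assume "p \<in> flag b g \<inter> flag c h"
  then obtain k l where "k \<in> {-1..3}" "p = fl b g k" "p = fl c h l" by (auto simp: flag_def)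
  moreover have "k = l" using calculation by (metis fst_fl)
  ultimately show "p \<in> {fl b g k | k. k \<in> {-1..3} \<and> fl b g k = fl c h k}" by blast
qed

text \<open>The cases are the sets of proper ranks at which two flags agree. Agreement at all of
  them is equality, at two of them adjacency. With one common proper face, the flags are joined
  through the stabilizer of that face; with none, through the whole group.\<close>

lemma strongly_flag_connected_Q: "strongly_flag_connected Q"
proof -
  have "conn (flag b g \<inter> flag c h) (flag b g) (flag c h)"
    if g: "g \<in> carrier K" and h: "h \<in> carrier K" for b g c h
  proof -
    let ?T = "flag b g \<inter> flag c h"
    define E where "E k \<longleftrightarrow> fl b g k = fl c h k" for k
    have eE: "E k" if "k \<in> {-1..3}" "k \<notin> {0, 1, 2}" for k
      using that fc_extreme[of k g h] g h by (auto simp: E_def fl_def)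
    have T: "?T \<subseteq> insert (fl b g j) ext" if "\<And>k. k \<in> {0, 1, 2} \<Longrightarrow> k \<noteq> j \<Longrightarrow> \<not> E k" for j
    proof
      fix p assume "p \<in> ?T"
      then obtain k where k: "k \<in> {-1..3}" "E k" "p = fl b g k"
          using flag_Int_subset unfolding E_def by blast
      then have "k = j \<or> k = -1 \<or> k = 3" using that[of k] by force
      then show "p \<in> insert (fl b g j) ext"
        using k fc_extreme[of k g \<one>] g by (auto simp: ext_def fl_def)
    qed
    have g': "e \<otimes> g \<in> carrier K" and h': "e \<otimes> h \<in> carrier K" using g h by simp_all
    have to_False: "conn ?T (flag d x) (flag False x)" if "x \<in> carrier K" "\<And>b'. ?T \<subseteq> flag b' x"
        for d x
      using conn_adj[OF that(1,1) that(2) that(2)] adjacent_flag_0[OF that(1),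
          of d] conn_refl by (cases d) auto
    consider "E 0" "E 1" "E 2" | j where "j \<in> {0, 1, 2}" "\<not> E j" "\<And>k. k \<in> {0, 1, 2} \<Longrightarrow> k \<noteq> j \<Longrightarrow> E k"
      | "E 0" "\<not> E 1" "\<not> E 2" | "\<not> E 0" "E 1" "\<not> E 2" | "\<not> E 0" "\<not> E 1" "E 2" | "\<not> E 0" "\<not> E 1"
          "\<not> E 2"
      by auto
    then show ?thesis
    proof cases
      case 1
      have "E k" if "k \<in> {-1..3}" for k using eE[OF that] 1 by auto
      then have "flag b g = flag c h" unfolding flag_def E_def by (rule image_cong[OF HOL.refl])
      then show ?thesis by (simp add: conn_refl)
    next
      case 2
      have "adjacent_flags (flag b g) (flag c h)"
        unfolding flag_def
        by (rule adjacent_flags_imageI[where j = j and r = fst])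
          (use 2 eE in \<open>auto simp: E_def\<close>)
      then show ?thesis by (intro conn_adj[OF g h]) auto
    next
      case 3
      \<comment> \<open>A flag of the second class has the vertex of e x, so exchanging its 2-face
        leads to \<open>flag False (e \<otimes> x)\<close> with the same vertex. Afterwards both
        flags are in the first class.\<close>
      have red: "\<exists>y\<in>carrier K. fc 0 y = fl d x 0 \<and> conn ?T (flag d x) (flag False y)"
        if x: "x \<in> carrier K" and T': "?T \<subseteq> insert (fl d x 0) ext" for d x
      proof (cases d)
        case True
        have ex: "e \<otimes> x \<in> carrier K" using x by simp
        have "?T \<subseteq> flag d x" by (rule flag_contains'[OF x _ HOL.refl T']) simp
        moreover have "?T \<subseteq> flag False (e \<otimes> x)"
          by (rule flag_contains'[OF ex _ _ T', of 0]) (simp_all add: fl_def True)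
        ultimately have "conn ?T (flag d x) (flag False (e \<otimes> x))"
          using conn_adj[OF x ex] adjacent_flag_2[OF x, of True] True by simp
        then show ?thesis using ex True by (auto simp: fl_def)
      next
        case False
        then show ?thesis using x conn_refl by (auto simp: fl_def)
      qed
      have T0: "?T \<subseteq> insert (fl b g 0) ext" using 3 by (intro T) auto
      then have T0': "?T \<subseteq> insert (fl c h 0) ext" using 3 by (simp add: E_def)
      obtain y where y: "y \<in> carrier K" "fc 0 y = fl b g 0" "conn ?T (flag b g) (flag False y)"
        using red[OF g T0] by blast
      obtain z where z: "z \<in> carrier K" "fc 0 z = fl c h 0" "conn ?T (flag c h) (flag False z)"
        using red[OF h T0'] by blast
      have "fc 0 z = fc 0 y" using y z 3 by (simp add: E_def)
      then obtain u where "u \<in> st 0" "z = u \<otimes> y" using z(1) y(1) by (rule fc_eqE)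
      then have u: "u \<in> generate K {s 2}" "z = u \<otimes> y" by (simp_all add: stabilizer)
      have "conn ?T (flag False y) (flag False z)"
        using conn_generate[of "{s 2}" ?T "\<lambda>x. insert (fc 0 x) ext" u y] conn_s2 u y T0 by auto
      then show ?thesis using y z conn_trans conn_sym by blast
    next
      case 4
      have T1: "?T \<subseteq> insert (fc 1 g) ext" using 4 T[of 1] by (auto simp: fl_simps)
      have sub: "?T \<subseteq> flag d x" if "x \<in> carrier K" "fc 1 x = fc 1 g" for d x
        by (rule flag_contains'[OF that(1) _ _ T1, of 1]) (use that in \<open>simp_all add: fl_simps\<close>)
      have hg: "fc 1 h = fc 1 g" using 4 by (simp add: E_def fl_simps)
      have 1: "conn ?T (flag b g) (flag False g)" using to_False[OF g sub[OF g]] by simp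
      have 2: "conn ?T (flag c h) (flag False h)" using to_False[OF h sub[OF h hg]] by simp
      have "conn ?T (flag False g) (flag True g)"
        using conn_adj[OF g g sub sub] adjacent_flag_0[OF g, of False] g by simp
      moreover have "conn ?T (flag True g) (flag False (e \<otimes> g))"
        using conn_adj[OF g g' sub sub] adjacent_flag_2[OF g, of True] g g' by simp
      ultimately have "conn ?T (flag False g) (flag False (e \<otimes> g))" by (rule conn_trans)
      moreover have "h = g \<or> h = e \<otimes> g" using fc_1_eqD[OF hg h g] .
      ultimately have "conn ?T (flag False g) (flag False h)" using conn_refl by auto
      then show ?thesis using 1 2 conn_trans conn_sym by blast
    next
      case 5
      have T2: "?T \<subseteq> insert (fc 2 g) ext" using 5 T[of 2] by (auto simp: fl_simps)
      have sub: "?T \<subseteq> flag d x" if "x \<in> carrier K" "fc 2 x = fc 2 g" for d x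
        by (rule flag_contains'[OF that(1) _ _ T2, of 2]) (use that in \<open>simp_all add: fl_simps\<close>)
      have hg: "fc 2 h = fc 2 g" using 5 by (simp add: E_def fl_simps)
      have 1: "conn ?T (flag b g) (flag False g)" using to_False[OF g sub[OF g]] by simp
      have 2: "conn ?T (flag c h) (flag False h)" using to_False[OF h sub[OF h hg]] by simp
      obtain u where "u \<in> st 2" "h = u \<otimes> g" using hg h g by (rule fc_eqE)
      then have u: "u \<in> generate K {s 1}" "h = u \<otimes> g" by (simp_all add: stabilizer)
      have "conn ?T (flag False g) (flag False h)"
        using conn_generate[of "{s 1}" ?T "\<lambda>x. insert (fc 2 x) ext" u g] conn_s1 u g T2 by auto
      then show ?thesis using 1 2 conn_trans conn_sym by blast
    next
      case 6
      have T3: "?T \<subseteq> ext"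
      proof -
        have "?T \<subseteq> insert (fl b g (-1)) ext" using 6 by (intro T) auto
        moreover have "fl b g (-1) = fc (-1) \<one>" using fc_extreme[of "-1"
            g \<one>] g by (simp add: fl_def)
        ultimately show ?thesis by (auto simp: ext_def)
      qed
      have sub: "?T \<subseteq> flag d x" if "x \<in> carrier K" for d x
        using T3 ext_subset[OF that] by blast
      have 1: "conn ?T (flag b g) (flag False g)" using to_False[OF g sub[OF g]] .
      have 2: "conn ?T (flag c h) (flag False h)" using to_False[OF h sub[OF h]] .
      have u: "h \<otimes> inv g \<in> generate K {s 1, s 2}" using g h generate_s by simp
      have "conn ?T (flag False x) (flag False (w \<otimes> x))" if "w \<in> {s 1, s 2}" "x \<in> carrier K" for w x
        using that T3 conn_s1[of x ?T] conn_s2[of x ?T] by auto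
      then have "conn ?T (flag False g) (flag False (h \<otimes> inv g \<otimes> g))"
        using conn_generate[of "{s 1, s 2}" ?T "\<lambda>x. ext" "h \<otimes> inv g" g] u g T3 by auto
      then have "conn ?T (flag False g) (flag False h)" using g h by (simp add: m_assoc)
      then show ?thesis using 1 2 conn_trans conn_sym by blast
    qed
  qed
  note conn_flags = this
  have "conn (C \<inter> D) C D" if C: "C \<in> flags Q" and D: "D \<in> flags Q" for C D
  proof -
    obtain b g where "C = flag b g" "g \<in> carrier K" using C unfolding flags_Q by blast
    moreover obtain c h where "D = flag c h" "h \<in> carrier K" using D unfolding flags_Q by blast
    ultimately show ?thesis using conn_flags by simp
  qed
  then show ?thesis
    unfolding strongly_flag_connected_def conn_def[symmetric] by blast
qed

lemma abstract_polytope_Q: "abstract_polytope Q"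
proof -
  have "\<exists>L\<in>faces Q. fst L = -1 \<and> (\<forall>F\<in>faces Q. (L, F) \<in> incidence Q)"
  proof (intro bexI conjI ballI)
    fix F assume "F \<in> faces Q"
    then obtain j x where jx: "j \<in> {-1..3}" "x \<in> carrier K" "F = fc j x" unfolding faces_Q by blast
    then have "(fc (-1) x, fc j x) \<in> incidence Q" by (intro incidenceI) auto
    then show "(fc (-1) \<one>, F) \<in> incidence Q" using jx fc_extreme[of "-1" x \<one>] by simp
  qed (auto intro: fc_in_faces)
  moreover have "\<exists>U\<in>faces Q. fst U = 3 \<and> (\<forall>F\<in>faces Q. (F, U) \<in> incidence Q)"
  proof (intro bexI conjI ballI)
    fix F assume "F \<in> faces Q"
    then obtain j x where jx: "j \<in> {-1..3}" "x \<in> carrier K" "F = fc j x" unfolding faces_Q by blast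
    then have "(fc j x, fc 3 x) \<in> incidence Q" by (intro incidenceI) auto
    then show "(F, fc 3 \<one>) \<in> incidence Q" using jx fc_extreme[of 3 x \<one>] by simp
  qed (auto intro: fc_in_faces)
  moreover have "\<forall>C\<in>flags Q. card C = 5" using card_flag flags_Q by auto
  moreover have "\<forall>(F, H)\<in>incidence Q. F \<noteq> H \<longrightarrow> fst F < fst H"
    using incidence_rank incidence_eq order_le_less by blast
  moreover have "fst ` faces Q \<subseteq> {-1..3}" by (auto simp: faces_Q)
  ultimately show ?thesis
    unfolding abstract_polytope_def
    using partial_order_Q diamond_Q strongly_flag_connected_Q base_flag_Q flag_in_flags[OF
        one_closed]
    by (simp only: rank_Q) simp
qed

end


lemma (in group) generate_inv_singleton:
  assumes "x \<in> carrier G"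
  shows "generate G {inv x} = generate G {x}"
proof (intro equalityI generate_subgroup_incl)
  show "subgroup (generate G {x}) G" "subgroup (generate G {inv x}) G"
    using assms by (simp_all add: generate_is_subgroup)
  show "{inv x} \<subseteq> generate G {x}" by (auto intro: generate.inv)
  have "inv (inv x) \<in> generate G {inv x}" by (rule generate.inv) simp
  then show "{x} \<subseteq> generate G {inv x}" using assms by simp
qed

context rotation_group_3
begin

sublocale Q: polytope Q by standard (rule abstract_polytope_Q)

text \<open>The edge leaves h and e h for g, the 2-face excludes e h, and the vertex then determines
  the Boolean. Thus the flags are two disjoint copies of the group.\<close>

lemma flag_eq_iff:
  assumes g: "g \<in> carrier K" and h: "h \<in> carrier K"
  shows "flag b g = flag c h \<longleftrightarrow> b = c \<and> g = h"
proof
  assume eq: "flag b g = flag c h"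
  have fl: "fl b g k = fl c h k" if "k \<in> {-1..3}" for k
  proof -
    have "fl b g k \<in> flag c h" using fl_in_flag[OF that] eq by blast
    then obtain l where l: "fl b g k = fl c h l" unfolding flag_def by blast
    moreover have "k = l" using arg_cong[OF l, of fst] by simp
    ultimately show ?thesis by simp
  qed
  have "fc 1 g = fc 1 h" "fc 2 g = fc 2 h" using fl[of 1] fl[of 2] by (simp_all add: fl_simps)
  then have gh: "g = h" using fc_1_eqD[OF _ g h] fc_neq(2)[OF h] by auto
  moreover have "b = c" using fl[of 0] fc_neq(1)[OF h] gh by (cases b; cases c) (auto simp:
      fl_simps)
  ultimately show "b = c \<and> g = h" by simp
qed simp

lemma face_flag: "g \<in> carrier K \<Longrightarrow> k \<in> {-1..3} \<Longrightarrow> Q.face (flag b g) k = fl b g k"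
  by (rule Q.face_eqI) (simp_all add: flag_in_flags fl_in_flag)

lemma flag_adj_Q:
  assumes g: "g \<in> carrier K"
  shows flag_adj_0: "flag_adj Q 0 (flag b g) = flag (\<not> b) g"
    and flag_adj_2: "flag_adj Q 2 (flag b g) = flag (\<not> b) (e \<otimes> g)"
    and flag_adj_1_False: "flag_adj Q 1 (flag False g) = flag True (s 1 \<otimes> g)"
    and flag_adj_1_True: "flag_adj Q 1 (flag True g) = flag False (inv (s 1) \<otimes> g)"
proof -
  have 1: "flag_adj Q 1 (flag False g) = flag True (s 1 \<otimes> g)" if g: "g \<in> carrier K" for g
    using g by (intro Q.flag_adj_eqI flag_in_flags)
      (simp_all add: flag_eq_iff face_flag fl_exchange_1)
  show "flag_adj Q 0 (flag b g) = flag (\<not> b) g"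
    using g by (intro Q.flag_adj_eqI flag_in_flags)
      (simp_all add: flag_eq_iff face_flag fl_exchange_0)
  show "flag_adj Q 2 (flag b g) = flag (\<not> b) (e \<otimes> g)"
    using g by (intro Q.flag_adj_eqI flag_in_flags)
      (simp_all add: flag_eq_iff face_flag fl_exchange_2)
  show "flag_adj Q 1 (flag False g) = flag True (s 1 \<otimes> g)" by (rule 1[OF g])
  have "flag_adj Q 1 (flag False (inv (s 1) \<otimes> g)) = flag True g"
      using 1[of "inv (s 1) \<otimes> g"] g by simp
  then show "flag_adj Q 1 (flag True g) = flag False (inv (s 1) \<otimes> g)"
    using Q.flag_adj_flag_adj[OF flag_in_flags, of "inv (s 1) \<otimes> g" 1 False] g by simp
qed

section \<open>The group acting on its coset poset by right multiplication\<close>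

lemma finite_faces_Q: "finite (faces Q)"
  using finite_carrier by (simp add: faces_Q)

text \<open>Restricted to the faces because the elements of \<open>aut_group\<close> are extensional
  functions.\<close>

definition rmult :: "'a \<Rightarrow> int \<times> 'a set \<Rightarrow> int \<times> 'a set" where
  "rmult k = (\<lambda>p\<in>faces Q. (fst p, snd p #> k))"

lemma rmult_fc:
  assumes "g \<in> carrier K" "k \<in> carrier K" "j \<in> {-1..3}"
  shows "rmult k (fc j g) = fc j (g \<otimes> k)"
  using assms fc_in_faces[OF assms(3,1)] coset_mult_assoc[OF subgroup.subset[OF subgroup_st]
      assms(1,2)]
  by (simp add: rmult_def fc_def)

lemma faces_QE:
  assumes "p \<in> faces Q"
  obtains j g where "j \<in> {-1..3}" "g \<in> carrier K" "p = fc j g"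
  using assms unfolding faces_Q by blast

lemma rmult_rmult_inv:
  assumes "k \<in> carrier K" "p \<in> faces Q"
  shows "rmult k (rmult (inv k) p) = p" "rmult (inv k) (rmult k p) = p" "rmult k p \<in> faces Q"
  using assms by (auto elim!: faces_QE simp: rmult_fc m_assoc fc_in_faces)

lemma rmult_incidence:
  assumes k: "k \<in> carrier K" and pq: "(p, q) \<in> incidence Q"
  shows "(rmult k p, rmult k q) \<in> incidence Q"
proof -
  obtain i j x where "i \<in> {-1..3}" "j \<in> {-1..3}" "x \<in> carrier K" "i \<le> j" "p = fc i x" "q = fc j x"
    using pq unfolding incidence_iff by blast
  then show ?thesis using k by (simp add: rmult_fc incidenceI)
qed

lemma rmult_aut:
  assumes k: "k \<in> carrier K"
  shows "rmult k \<in> carrier (aut_group Q)"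
  unfolding Q.aut_iff
proof (intro conjI ballI)
  show "rmult k \<in> extensional (faces Q)" by (simp add: rmult_def)
  show "bij_betw (rmult k) (faces Q) (faces Q)"
    using k rmult_rmult_inv[OF k] rmult_rmult_inv(3)[of "inv k"]
    by (intro bij_betw_byWitness[where f' = "rmult (inv k)"]) auto
  fix p q assume "p \<in> faces Q" "q \<in> faces Q"
  then show "((rmult k p, rmult k q) \<in> incidence Q) = ((p, q) \<in> incidence Q)"
    using rmult_incidence[OF k, of p q] rmult_incidence[of "inv k" "rmult k p" "rmult k q"] k
      rmult_rmult_inv(2)[OF k] by auto
qed

lemma rmult_flag:
  assumes "k \<in> carrier K" "g \<in> carrier K"
  shows "rmult k ` flag b g = flag b (g \<otimes> k)"
  using assms unfolding flag_def image_image
  by (intro image_cong HOL.refl) (simp add: fl_def rmult_fc m_assoc)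

text \<open>Products in \<open>aut_group\<close> apply the left factor first, in accordance with
  right multiplication; it suffices to compare both sides on one flag.\<close>

lemma rmult_hom: "rmult \<in> hom K (aut_group Q)"
proof (rule homI)
  fix g h assume gh: "g \<in> carrier K" "h \<in> carrier K"
  interpret A: group "aut_group Q" by (rule Q.group_aut_group)
  show "rmult (g \<otimes> h) = rmult g \<otimes>\<^bsub>aut_group Q\<^esub> rmult h"
  proof (rule Q.aut_eqI[OF finite_faces_Q _ _ flag_in_flags[OF one_closed, of False]])
    show "rmult (g \<otimes> h) ` flag False \<one> = (rmult g \<otimes>\<^bsub>aut_group Q\<^esub> rmult h) ` flag False \<one>"
      using gh Q.aut_mult_image[OF Q.flag_subset[OF flag_in_flags[OF one_closed]]]
      by (simp add: rmult_flag)
  qed (use gh in \<open>simp_all add: rmult_aut\<close>)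
qed (rule rmult_aut)

lemma inj_rmult: "inj_on rmult (carrier K)"
proof (rule inj_onI)
  fix g h assume gh: "g \<in> carrier K" "h \<in> carrier K" and "rmult g = rmult h"
  then have "rmult g ` flag False \<one> = rmult h ` flag False \<one>" by simp
  then show "g = h" using gh by (simp add: rmult_flag flag_eq_iff)
qed

lemma rot_Q: "rot Q 1 = rmult (s 1)" "rot Q 2 = rmult (s 2)"
proof -
  show "rot Q 1 = rmult (s 1)"
    by (rule Q.rot_eqI[OF finite_faces_Q])
      (simp_all add: rmult_aut base_flag_Q rmult_flag flag_adj_1_False flag_adj_0)
  have "flag_adj Q 1 (flag_adj Q 2 (flag False \<one>)) = flag False (s 2)"
    using flag_adj_2[of \<one> False] flag_adj_1_True[of e] by simp
  then show "rot Q 2 = rmult (s 2)"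
    by (intro Q.rot_eqI[OF finite_faces_Q])
      (simp_all add: rmult_aut base_flag_Q rmult_flag)
qed

lemma schlafli_type_Q:
  assumes "chiral Q"
  shows "schlafli_type Q = [ord (s 1), ord (s 2)]"
proof -
  interpret R: group_hom K "aut_group Q" rmult
    using rmult_hom Q.group_aut_group by (simp add: group_hom_def group_hom_axioms_def)
  have "[1..<3] = [1, 2 :: nat]" by (simp add: upt_rec)
  then show ?thesis
    using assms R.ord_inj_hom[OF inj_rmult]
    by (simp add: schlafli_type_def rotation_group_def rot_Q)
qed

text \<open>
  An automorphism exchanging the two classes of flags maps \<open>flag False u\<close> to \<open>flag True (\<theta> u)\<close> for
  an endomorphism \<open>\<theta>\<close> of the group.
\<close>

lemma reflection_endomorphism:
  assumes f: "f \<in> carrier (aut_group Q)" and f1: "f ` flag False \<one> = flag True \<one>"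
  shows "\<exists>\<theta>\<in>hom K K. \<theta> (s 1) = inv (s 1) \<and> \<theta> (s 2) = s 1 \<otimes> e"
proof -
  \<comment> \<open>\<open>step u v\<close> says that f turns left multiplication by u in the first
    class into left multiplication by v in the second. Quantifying over all g and t makes this
    relation multiplicative.\<close>
  define step where "step u v \<longleftrightarrow> v \<in> carrier K \<and> (\<forall>g\<in>carrier K. \<forall>t\<in>carrier K.
    f ` flag False g = flag True t \<longrightarrow> f ` flag False (u \<otimes> g) = flag True (v \<otimes> t))" for u v
  have adj: "f ` flag_adj Q j (flag b g) = flag_adj Q j (f ` flag b g)" if "j < 3" "g \<in> carrier K"
      for j b g
    using Q.aut_flag_adj[OF f flag_in_flags[OF that(2)]] that(1) by simp
  have step1: "step (s 1) (inv (s 1))"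
    unfolding step_def
  proof (intro conjI ballI impI)
    fix g t assume g: "g \<in> carrier K" and t: "t \<in> carrier K" and gt: "f ` flag False g =
        flag True t"
    have "flag False (s 1 \<otimes> g) = flag_adj Q 0 (flag_adj Q 1 (flag False g))"
      using g by (simp add: flag_adj_0 flag_adj_1_False)
    also have "f ` \<dots> = flag_adj Q 0 (flag_adj Q 1 (flag True t))"
      using adj[of 1 g False] adj[of 0 "s 1 \<otimes> g" True] g gt by (simp add: flag_adj_1_False)
    also have "\<dots> = flag True (inv (s 1) \<otimes> t)" using t by (simp add: flag_adj_0 flag_adj_1_True)
    finally show "f ` flag False (s 1 \<otimes> g) = flag True (inv (s 1) \<otimes> t)" .
  qed simp
  have step1': "step (inv (s 1)) (s 1)"
    unfolding step_def
  proof (intro conjI ballI impI)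
    fix g t assume g: "g \<in> carrier K" and t: "t \<in> carrier K" and gt: "f ` flag False g =
        flag True t"
    have "flag False (inv (s 1) \<otimes> g) = flag_adj Q 1 (flag_adj Q 0 (flag False g))"
      using g by (simp add: flag_adj_0 flag_adj_1_True)
    also have "f ` \<dots> = flag_adj Q 1 (flag_adj Q 0 (flag True t))"
      using adj[of 0 g False] adj[of 1 g True] g gt by (simp add: flag_adj_0)
    also have "\<dots> = flag True (s 1 \<otimes> t)" using t by (simp add: flag_adj_0 flag_adj_1_False)
    finally show "f ` flag False (inv (s 1) \<otimes> g) = flag True (s 1 \<otimes> t)" .
  qed simp
  \<comment> \<open>In the first class s_2 is the exchange of the 2-face followed by that of the
    edge. In the second class these exchanges multiply by e and then by s_1, whence the value s_1
    e.\<close>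
  have step2: "step (s 2) (s 1 \<otimes> e)"
    unfolding step_def
  proof (intro conjI ballI impI)
    fix g t assume g: "g \<in> carrier K" and t: "t \<in> carrier K" and gt: "f ` flag False g =
        flag True t"
    have "flag False (s 2 \<otimes> g) = flag_adj Q 1 (flag_adj Q 2 (flag False g))"
      using g flag_adj_2[OF g, of False] flag_adj_1_True[of "e \<otimes> g"] by (simp add: m_assoc)
    also have "f ` \<dots> = flag_adj Q 1 (flag_adj Q 2 (flag True t))"
      using adj[of 2 g False] adj[of 1 "e \<otimes> g" True] g gt flag_adj_2[OF g, of False] by simp
    also have "\<dots> = flag True (s 1 \<otimes> e \<otimes> t)"
      using t flag_adj_2[OF t, of True] flag_adj_1_False[of "e \<otimes> t"] by (simp add: m_assoc)
    finally show "f ` flag False (s 2 \<otimes> g) = flag True (s 1 \<otimes> e \<otimes> t)" .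
  qed simp
  have step2': "step (inv (s 2)) (e \<otimes> inv (s 1))"
    unfolding step_def
  proof (intro conjI ballI impI)
    fix g t assume g: "g \<in> carrier K" and t: "t \<in> carrier K" and gt: "f ` flag False g =
        flag True t"
    have "inv (s 2) \<otimes> g = e \<otimes> (s 1 \<otimes> g)" using g e_s1 by (metis m_assoc m_closed s_closed)
    then have "flag False (inv (s 2) \<otimes> g) = flag_adj Q 2 (flag_adj Q 1 (flag False g))"
      using g flag_adj_2[of "s 1 \<otimes> g" True] by (simp add: flag_adj_1_False)
    also have "f ` \<dots> = flag_adj Q 2 (flag_adj Q 1 (flag True t))"
      using adj[of 1 g False] adj[of 2 "s 1 \<otimes> g" True] g gt by (simp add: flag_adj_1_False)
    also have "\<dots> = flag True (e \<otimes> inv (s 1) \<otimes> t)"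
      using t flag_adj_2[of "inv (s 1) \<otimes> t" False] by (simp add: flag_adj_1_True m_assoc)
    finally show "f ` flag False (inv (s 2) \<otimes> g) = flag True (e \<otimes> inv (s 1) \<otimes> t)" .
  qed simp
  \<comment> \<open>\<open>generate\<close> also admits inverses of generators, which is why their
    effect was determined separately.\<close>
  have ex: "\<exists>v. step u v" if "u \<in> carrier K" for u
  proof -
    have "u \<in> generate K {s 1, s 2}" using that generate_s by simp
    then show ?thesis
    proof induction
      case one
      have "step \<one> \<one>" by (simp add: step_def)
      then show ?case by blast
    next
      case (incl h)
      then show ?case using step1 step2 by blast
    next
      case (inv h)
      then show ?case using step1' step2' by blast
    next
      case (eng x y)
      have xy: "x \<in> carrier K" "y \<in> carrier K" using eng generate_s by auto
      obtain v w where "step x v" "step y w" using eng by blast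
      then have "step (x \<otimes> y) (v \<otimes> w)"
        unfolding step_def using xy by (simp add: m_assoc)
      then show ?case by blast
    qed
  qed
  have stepD: "f ` flag False u = flag True v" if "step u v" "u \<in> carrier K" for u v
  proof -
    have "f ` flag False (u \<otimes> \<one>) = flag True (v \<otimes> \<one>)"
      using that(1) f1 one_closed unfolding step_def by blast
    then show ?thesis using that unfolding step_def by simp
  qed
  have uniq: "v = w" if "step u v" "step u w" "u \<in> carrier K" for u v w
    using stepD[OF that(1,3)] stepD[OF that(2,3)] that flag_eq_iff[of v w True True]
    unfolding step_def by simp
  \<comment> \<open>The value is chosen pointwise; its uniqueness is what makes
    \<open>\<theta>\<close> a homomorphism with the prescribed values.\<close>
  define \<theta> where "\<theta> u = (SOME v. step u v)" for u
  have \<theta>: "step u (\<theta> u)" if "u \<in> carrier K" for u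
    unfolding \<theta>_def using ex[OF that] by (rule someI_ex)
  have "\<theta> \<in> hom K K"
  proof (rule homI)
    show "\<theta> u \<in> carrier K" if "u \<in> carrier K" for u using \<theta>[OF that] by (simp add: step_def)
    fix u v assume uv: "u \<in> carrier K" "v \<in> carrier K"
    have "step (u \<otimes> v) (\<theta> u \<otimes> \<theta> v)"
      using \<theta>[OF uv(1)] \<theta>[OF uv(2)] uv unfolding step_def by (simp add: m_assoc)
    then show "\<theta> (u \<otimes> v) = \<theta> u \<otimes> \<theta> v" using uniq[OF \<theta>] uv by simp
  qed
  moreover have "\<theta> (s 1) = inv (s 1)" "\<theta> (s 2) = s 1 \<otimes> e"
    using uniq[OF \<theta> step1] uniq[OF \<theta> step2] by simp_all
  ultimately show ?thesis by blast
qed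

text \<open>Right multiplication is transitive on each class of flags, and every exchange passes to
  the other class. So chirality could fail only through an automorphism joining the classes, which
  would produce the excluded endomorphism.\<close>

lemma chiral_Q:
  assumes no: "\<not> (\<exists>\<theta>\<in>hom K K. \<theta> (s 1) = inv (s 1) \<and> \<theta> (s 2) = s 1 \<otimes> e)"
  shows "chiral Q"
proof -
  have orb: "flag_orbit Q (flag b g) = flag_orbit Q (flag b \<one>)" if g: "g \<in> carrier K" for b g
  proof -
    have "rmult g ` flag b \<one> = flag b g" using g by (simp add: rmult_flag)
    then show ?thesis
      using Q.flag_orbit_eq_iff[OF flag_in_flags[OF one_closed, of b] flag_in_flags[OF g,
          of b]] rmult_aut[OF g]
      by auto
  qed
  have neq: "flag_orbit Q (flag False \<one>) \<noteq> flag_orbit Q (flag True \<one>)"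
    using Q.flag_orbit_eq_iff[OF flag_in_flags[OF one_closed,
        of False] flag_in_flags[OF one_closed, of True]]
      reflection_endomorphism no by blast
  have "flag_orbit Q ` flags Q = {flag_orbit Q (flag False \<one>), flag_orbit Q (flag True \<one>)}"
  proof (intro equalityI subsetI)
    fix O' assume "O' \<in> flag_orbit Q ` flags Q"
    then obtain b g where "g \<in> carrier K" "O' = flag_orbit Q (flag b g)" unfolding flags_Q by blast
    then show "O' \<in> {flag_orbit Q (flag False \<one>), flag_orbit Q (flag True \<one>)}"
      using orb[of g b] by (cases b) auto
  next
    fix O' assume "O' \<in> {flag_orbit Q (flag False \<one>), flag_orbit Q (flag True \<one>)}"
    then show "O' \<in> flag_orbit Q ` flags Q" using flag_in_flags[OF one_closed] by blast
  qed
  then have "card (flag_orbit Q ` flags Q) = 2" using neq by simp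
  moreover have "flag_orbit Q C \<noteq> flag_orbit Q D"
    if C: "C \<in> flags Q" and D: "D \<in> flags Q" and CD: "adjacent_flags C D" for C D
  proof -
    obtain b g where bg: "g \<in> carrier K" "C = flag b g" using C unfolding flags_Q by blast
    obtain j where j: "j < 3" "D = flag_adj Q j C" using Q.adjacent_flags_iff[OF C D] CD by auto
    have "\<exists>h\<in>carrier K. D = flag (\<not> b) h"
    proof -
      consider "j = 0" | "j = 1" | "j = 2" using j by linarith
      then show ?thesis
        using j bg flag_adj_0[OF bg(1)] flag_adj_1_False[OF bg(1)] flag_adj_1_True[OF bg(1)]
            flag_adj_2[OF bg(1)]
        by cases (cases b; force)+
    qed
    then obtain h where "h \<in> carrier K" "D = flag (\<not> b) h" by blast
    then show ?thesis using orb[of g b] orb[of h "\<not> b"] bg neq by (cases b) auto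
  qed
  ultimately show ?thesis unfolding chiral_def using abstract_polytope_Q by blast
qed

text \<open>Since \<delta> fixes e and interchanges the subgroups of s_1 and s_2, it maps the
  stabilizer of rank j onto that of rank 2 - j, and taking images of cosets is a duality. The map j
  -> 2 - j also swaps the improper ranks -1 and 3.\<close>

lemma properly_self_dual_Q:
  assumes hom: "\<delta> \<in> hom K K" and invol: "\<And>x. x \<in> carrier K \<Longrightarrow> \<delta> (\<delta> x) = x"
    and \<delta>_s: "\<delta> (s 1) = inv (s 2)" "\<delta> (s 2) = inv (s 1)"
  shows "properly_self_dual Q"
proof -
  interpret D: group_hom K K \<delta>
    using hom by (simp add: group_hom_def group_hom_axioms_def is_group)
  have \<delta>_e: "\<delta> e = e"
  proof -
    have "\<delta> e = inv (s 2) \<otimes> inv (s 1)" by (simp add: \<delta>_s)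
    also have "\<dots> = inv e" by (simp add: inv_mult_group)
    also have "\<dots> = e" using e_squared by (intro inv_equality) simp_all
    finally show ?thesis .
  qed
  have \<delta>_gen: "\<delta> ` generate K {x} = generate K {\<delta> x}" if "x \<in> carrier K" for x
    using D.generate_img[of "{x}"] that by simp
  have \<delta>_carrier: "\<delta> ` carrier K = carrier K"
  proof (intro equalityI subsetI)
    fix x assume "x \<in> carrier K"
    then show "x \<in> \<delta> ` carrier K" by (intro image_eqI[of _ _ "\<delta> x"]) (simp_all add: invol)
  qed auto
  have \<delta>_st: "\<delta> ` st j = st (2 - j)" for j
  proof -
    consider "j = 0" | "j = 1" | "j = 2" | "j \<notin> {0, 1, 2}" by auto
    then show ?thesis
    proof cases
      case 4
      then have "2 - j \<notin> {0, 1, 2}" by auto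
      then show ?thesis using 4 stabilizer_extreme \<delta>_carrier by simp
    qed (simp_all add: stabilizer \<delta>_gen \<delta>_s generate_inv_singleton \<delta>_e)
  qed
  define d where "d p = (2 - fst p, \<delta> ` snd p)" for p :: "int \<times> 'a set"
  have d_fc: "d (fc j g) = fc (2 - j) (\<delta> g)" if g: "g \<in> carrier K" for j g
  proof -
    have "\<delta> ` (st j #> g) = \<delta> ` st j #> \<delta> g"
      using g st_closed by (force simp: r_coset_def)
    then show ?thesis by (simp add: d_def fc_def \<delta>_st)
  qed
  have d_face: "d p \<in> faces Q" "d (d p) = p" if p: "p \<in> faces Q" for p
    using p by (auto elim!: faces_QE simp: d_fc invol intro!: fc_in_faces)
  have d_inc: "(d q, d p) \<in> incidence Q" if pq: "(p, q) \<in> incidence Q" for p q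
  proof -
    obtain i j x where "i \<in> {-1..3}" "j \<in> {-1..3}" "x \<in> carrier K" "i \<le> j" "p = fc i x" "q = fc j x"
      using pq unfolding incidence_iff by blast
    then show ?thesis by (simp add: d_fc incidenceI)
  qed
  show ?thesis
    unfolding properly_self_dual_def
  proof (intro exI conjI ballI)
    show "bij_betw d (faces Q) (faces Q)"
      using d_face by (intro bij_betw_byWitness[where f' = d]) auto
    fix x y assume "x \<in> faces Q" "y \<in> faces Q"
    then show "((d x, d y) \<in> incidence Q) = ((y, x) \<in> incidence Q)"
      using d_inc[of y x] d_inc[of "d x" "d y"] d_face(2) by auto
  next
    have "d ` flag False \<one> = (\<lambda>k. fc (2 - k) \<one>) ` {-1..3}"
      unfolding flag_def image_image by (intro image_cong HOL.refl) (simp add: fl_simps d_fc)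
    also have "\<dots> = (\<lambda>k. fc k \<one>) ` ((\<lambda>k. 2 - k) ` {-1..3})" by (simp only: image_image)
    also have "(\<lambda>k :: int. 2 - k) ` {-1..3} = {-1..3}" by (simp add: image_diff_atLeastAtMost)
    finally show "d ` base_flag Q = base_flag Q"
      by (simp add: base_flag_Q flag_def fl_simps)
  qed
qed

end


section \<open>The mix of a chiral polyhedron with its dual\<close>

text \<open>Trivial intersection makes (x, y) -> x y injective; the products are counted as a subset
  of \<open>N\<close> and need not form a subgroup.\<close>

lemma (in group) card_mult_le_of_trivial_Int:
  assumes fin: "finite N" and N: "subgroup N G" and H: "subgroup H G" "H \<subseteq> N"
      and J: "subgroup J G" "J \<subseteq> N"
    and triv: "H \<inter> J = {\<one>}"
  shows "card H * card J \<le> card N"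
proof -
  have "inj_on (\<lambda>(x, y). x \<otimes> y) (H \<times> J)"
  proof (rule inj_onI, clarify)
    fix x y x' y' assume x: "x \<in> H" "x' \<in> H" and y: "y \<in> J" "y' \<in> J" and eq: "x \<otimes> y = x' \<otimes> y'"
    have c: "x \<in> carrier G" "x' \<in> carrier G" "y \<in> carrier G" "y' \<in> carrier G"
      using x y subgroup.mem_carrier[OF H(1)] subgroup.mem_carrier[OF J(1)] by auto
    have "inv x' \<otimes> x = inv x' \<otimes> (x \<otimes> y) \<otimes> inv y" using c by (simp add: m_assoc)
    also have "\<dots> = y' \<otimes> inv y" unfolding eq using c by (simp add: m_assoc[symmetric])
    finally have z: "inv x' \<otimes> x = y' \<otimes> inv y" .
    have "inv x' \<otimes> x \<in> H" "y' \<otimes> inv y \<in> J"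
      using x y H J by (simp_all add: subgroup.m_closed subgroup.m_inv_closed)
    then have "inv x' \<otimes> x = \<one>" "y' \<otimes> inv y = \<one>" using z triv by auto
    then show "x = x' \<and> y = y'" using c by (metis inv_equality inv_inv inv_closed l_inv)
  qed
  then have "card (H \<times> J) = card ((\<lambda>(x, y). x \<otimes> y) ` (H \<times> J))" by (simp add: card_image)
  also have "\<dots> \<le> card N"
    using fin H(2) J(2) subgroup.m_closed[OF N] by (intro card_mono) auto
  finally show ?thesis by (simp add: card_cartesian_product)
qed

lemma (in group) conj_nat_pow:
  assumes "x \<in> carrier G" "y \<in> carrier G"
  shows "(x \<otimes> y \<otimes> inv x) [^] (k :: nat) = x \<otimes> y [^] k \<otimes> inv x"
proof (induction k)
  case (Suc k)
  have "x \<otimes> y [^] k \<otimes> inv x \<otimes> (x \<otimes> y \<otimes> inv x) = x \<otimes> y [^] k \<otimes> (inv x \<otimes> x) \<otimes> y \<otimes> inv x"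
    using assms by (simp only: m_assoc m_closed inv_closed nat_pow_closed)
  then show ?case using Suc assms by (simp add: m_assoc)
qed (use assms in simp)

context finite_chiral_polyhedron
begin

section \<open>The mix with the dual as a rotation group of rank 3\<close>

abbreviation G :: "('a \<Rightarrow> 'a) monoid" where "G \<equiv> aut_group P"
abbreviation K :: "(('a \<Rightarrow> 'a) \<times> ('a \<Rightarrow> 'a)) monoid" where
  "K \<equiv> mix_group {1..<3} G (rot P) G (rot (dual P))"
abbreviation s :: "nat \<Rightarrow> ('a \<Rightarrow> 'a) \<times> ('a \<Rightarrow> 'a)" where
  "s i \<equiv> (rot P i, rot (dual P) i)"

sublocale GG: group "G \<times>\<times> G" by (rule DirProd_group) (rule G.is_group)+

lemma interval_1_3: "{1..<3} = {1, 2 :: nat}" by auto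

lemma ab_inverse: "inv\<^bsub>G\<^esub> (a \<otimes>\<^bsub>G\<^esub> b) = a \<otimes>\<^bsub>G\<^esub> b"
  using ab_squared by (intro G.inv_equality) simp_all

lemma finite_G: "finite (carrier G)" by (rule finite_aut_group[OF finite_faces])

lemma ord_pos: "x \<in> carrier G \<Longrightarrow> 0 < G.ord x"
  using G.ord_ge_1[OF finite_G, of x] by linarith

lemma K_def: "K = subgroup_generated (G \<times>\<times> G) {s 1, s 2}"
  by (simp add: mix_group_def interval_1_3)

lemma s_in_GG: "{s 1, s 2} \<subseteq> carrier (G \<times>\<times> G)"
  by (simp add: rot_dual)

lemma carrier_K: "carrier K = generate (G \<times>\<times> G) {s 1, s 2}"
  unfolding K_def carrier_subgroup_generated using s_in_GG by (simp add: Int_absorb1)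

lemma carrier_K_subset: "carrier K \<subseteq> carrier G \<times> carrier G"
  using GG.carrier_subgroup_generated_subset unfolding K_def by auto

lemma group_K: "group K" unfolding K_def by simp

lemma fst_hom_K: "group_hom K G fst" and snd_hom_K: "group_hom K G snd"
  unfolding group_hom_def group_hom_axioms_def
  using carrier_K_subset group_K G.is_group by (auto simp: hom_def K_def)

lemma s_in_K: "s 1 \<in> carrier K" "s 2 \<in> carrier K"
  unfolding carrier_K by (auto intro: generate.incl)

lemma inv_K: "x \<in> carrier K \<Longrightarrow> inv\<^bsub>K\<^esub> x = (inv\<^bsub>G\<^esub> (fst x), inv\<^bsub>G\<^esub> (snd x))"
proof -
  assume x: "x \<in> carrier K"
  then have "inv\<^bsub>K\<^esub> x = inv\<^bsub>G \<times>\<times> G\<^esub> x" unfolding K_def by simp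
  also have "\<dots> = (inv\<^bsub>G\<^esub> (fst x), inv\<^bsub>G\<^esub> (snd x))"
    using x carrier_K_subset inv_DirProd[OF G.is_group G.is_group, of "fst x" "snd x"] by auto
  finally show ?thesis .
qed

lemma rotation_group_3_K: "rotation_group_3 K s"
proof -
  interpret K: group K by (rule group_K)
  interpret F: group_hom K G fst by (rule fst_hom_K)
  interpret S: group_hom K G snd by (rule snd_hom_K)
  show ?thesis
  proof
    show "s 1 \<in> carrier K" "s 2 \<in> carrier K" by (rule s_in_K)+
    show "finite (carrier K)"
      by (rule finite_subset[OF carrier_K_subset finite_cartesian_product[OF finite_G finite_G]])
    have "inv\<^bsub>G\<^esub> b \<otimes>\<^bsub>G\<^esub> inv\<^bsub>G\<^esub> a = a \<otimes>\<^bsub>G\<^esub> b"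
      using ab_inverse by (simp add: G.inv_mult_group)
    then show "s 1 \<otimes>\<^bsub>K\<^esub> s 2 \<otimes>\<^bsub>K\<^esub> (s 1 \<otimes>\<^bsub>K\<^esub> s 2) = \<one>\<^bsub>K\<^esub>"
      using ab_squared by (simp add: K_def rot_dual)
    have "carrier K = carrier (subgroup_generated K {s 1, s 2})" unfolding K_def by simp
    also have "\<dots> = generate K {s 1, s 2}"
      using s_in_K by (simp add: carrier_subgroup_generated Int_absorb1)
    finally show "generate K {s 1, s 2} = carrier K" by simp
    have "x = \<one>\<^bsub>K\<^esub>" if x: "x \<in> generate K {s 1}" "x \<in> generate K {s 2}" for x
    proof -
      have "fst x \<in> generate G {a}" "fst x \<in> generate G {b}"
        using x F.generate_img[of "{s 1}"] F.generate_img[of "{s 2}"] s_in_K by auto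
      moreover have "snd x \<in> generate G {inv\<^bsub>G\<^esub> b}" "snd x \<in> generate G {inv\<^bsub>G\<^esub> a}"
        using x S.generate_img[of "{s 1}"] S.generate_img[of "{s 2}"] s_in_K rot_dual by auto
      ultimately have "fst x = \<one>\<^bsub>G\<^esub>" "snd x = \<one>\<^bsub>G\<^esub>"
        using generate_rot_Int by (auto simp: G.generate_inv_singleton)
      then show ?thesis by (simp add: K_def prod_eq_iff)
    qed
    then show "generate K {s 1} \<inter> generate K {s 2} = {\<one>\<^bsub>K\<^esub>}" by (auto intro: generate.one)
    show "s 1 \<noteq> \<one>\<^bsub>K\<^esub>" "s 2 \<noteq> \<one>\<^bsub>K\<^esub>" using rot_neq_one by (simp_all add: K_def)
  qed
qed

sublocale K: rotation_group_3 K s by (rule rotation_group_3_K)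

text \<open>The order of a pair is the least common multiple of the orders of its coordinates, here
  those of \<open>a\<close> and \<open>b\<close> in one order or the other, up to inversion.\<close>

lemma ord_s: "K.ord (s 1) = lcm (G.ord a) (G.ord b)" "K.ord (s 2) = lcm (G.ord a) (G.ord b)"
proof -
  interpret F: group_hom K G fst by (rule fst_hom_K)
  interpret S: group_hom K G snd by (rule snd_hom_K)
  have "K.ord x = lcm (G.ord (fst x)) (G.ord (snd x))" if x: "x \<in> carrier K" for x
  proof (rule K.ord_unique[THEN iffD2, rule_format, OF x])
    fix k :: nat
    have c: "fst x \<in> carrier G" "snd x \<in> carrier G" using x F.hom_closed S.hom_closed by auto
    have "x [^]\<^bsub>K\<^esub> k = \<one>\<^bsub>K\<^esub> \<longleftrightarrow> fst (x [^]\<^bsub>K\<^esub> k) = \<one>\<^bsub>G\<^esub> \<and> snd (x [^]\<^bsub>K\<^esub> k) = \<one>\<^bsub>G\<^esub>"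
      by (simp add: K_def prod_eq_iff)
    also have "\<dots> \<longleftrightarrow> G.ord (fst x) dvd k \<and> G.ord (snd x) dvd k"
      using x c by (simp add: F.hom_nat_pow S.hom_nat_pow G.pow_eq_id)
    finally show "x [^]\<^bsub>K\<^esub> k = \<one>\<^bsub>K\<^esub> \<longleftrightarrow> lcm (G.ord (fst x)) (G.ord (snd x)) dvd k" by simp
  qed
  then show "K.ord (s 1) = lcm (G.ord a) (G.ord b)" "K.ord (s 2) = lcm (G.ord a) (G.ord b)"
    using s_in_K by (simp_all add: rot_dual lcm.commute)
qed

lemma mix_dual: "mix P (dual P) = coset_poset 3 K s"
  by (simp add: mix_def rank_3 rotation_group_eq rotation_group_dual)

lemma properly_self_dual_mix_dual: "properly_self_dual (mix P (dual P))"
  unfolding mix_dual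
proof (rule K.properly_self_dual_Q[of prod.swap])
  \<comment> \<open>The generators are s_1 = (a, b^-1) and s_2 = (b, a^-1); swapping the coordinates
    of one gives the inverse of the other.\<close>
  have inv: "inv\<^bsub>K\<^esub> (s 1) = prod.swap (s 2)" "inv\<^bsub>K\<^esub> (s 2) = prod.swap (s 1)"
    using inv_K[OF s_in_K(1)] inv_K[OF s_in_K(2)] by (simp_all add: rot_dual)
  then show "prod.swap (s 1) = inv\<^bsub>K\<^esub> (s 2)" "prod.swap (s 2) = inv\<^bsub>K\<^esub> (s 1)" by simp_all
  have "group_hom (G \<times>\<times> G) (G \<times>\<times> G) prod.swap"
    unfolding group_hom_def group_hom_axioms_def using GG.is_group by (auto simp: hom_def)
  then interpret W: group_hom "G \<times>\<times> G" "G \<times>\<times> G" prod.swap .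
  have "prod.swap ` carrier K = generate (G \<times>\<times> G) (prod.swap ` {s 1, s 2})"
    unfolding carrier_K using W.generate_img[OF s_in_GG] by simp
  also have "\<dots> \<subseteq> carrier K"
  proof (rule GG.generate_subgroup_incl)
    show "subgroup (carrier K) (G \<times>\<times> G)"
      unfolding carrier_K by (rule GG.generate_is_subgroup[OF s_in_GG])
    have "inv\<^bsub>K\<^esub> (s 1) \<in> carrier K" "inv\<^bsub>K\<^esub> (s 2) \<in> carrier K" using s_in_K by simp_all
    then show "prod.swap ` {s 1, s 2} \<subseteq> carrier K" unfolding inv by auto
  qed
  finally have "prod.swap ` carrier K \<subseteq> carrier K" .
  then show "prod.swap \<in> hom K K" by (auto simp: hom_def K_def)
qed simp

text \<open>Since ab is its own inverse, a (ab) = a (ab)^-1. The form as a conjugate of b^-1 shows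
  that the second generator of the mirror image has the same order as \<open>b\<close>.\<close>

lemma rot_mirror_2: "rot (mirror P) 2 = a \<otimes>\<^bsub>G\<^esub> inv\<^bsub>G\<^esub> b \<otimes>\<^bsub>G\<^esub> inv\<^bsub>G\<^esub> a"
  using ab_inverse by (simp add: rot_mirror G.inv_mult_group G.m_assoc)

section \<open>Orders of the mixes and of the comixes\<close>

lemma generate_rot_dual: "generate G (rot (dual P) ` {1..<3}) = carrier G"
proof
  show "generate G (rot (dual P) ` {1..<3}) \<subseteq> carrier G"
    by (rule G.generate_incl) (simp add: interval_1_3 rot_dual)
  have "inv\<^bsub>G\<^esub> (inv\<^bsub>G\<^esub> a) \<in> generate G (rot (dual P) ` {1..<3})"
    "inv\<^bsub>G\<^esub> (inv\<^bsub>G\<^esub> b) \<in> generate G (rot (dual P) ` {1..<3})"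
    by (rule generate.inv; simp add: interval_1_3 rot_dual)+
  then have "generate G {a, b} \<subseteq> generate G (rot (dual P) ` {1..<3})"
    by (intro G.generate_subgroup_incl G.generate_is_subgroup) (simp_all add: interval_1_3 rot_dual)
  then show "carrier G \<subseteq> generate G (rot (dual P) ` {1..<3})" by (simp add: generate_rot)
qed

lemma generate_rot_mirror: "generate G (rot (mirror P) ` {1..<3}) = carrier G"
proof
  let ?N = "generate G (rot (mirror P) ` {1..<3})"
  show sub: "?N \<subseteq> carrier G"
    by (rule G.generate_incl) (simp add: interval_1_3 rot_mirror)
  have N: "subgroup ?N G"
    by (rule G.generate_is_subgroup) (simp add: interval_1_3 rot_mirror)
  have i: "inv\<^bsub>G\<^esub> a \<in> ?N" "a \<otimes>\<^bsub>G\<^esub> (a \<otimes>\<^bsub>G\<^esub> b) \<in> ?N"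
    by (rule generate.incl; simp add: interval_1_3 rot_mirror)+
  have "inv\<^bsub>G\<^esub> (inv\<^bsub>G\<^esub> a) \<in> ?N" using subgroup.m_inv_closed[OF N i(1)] .
  moreover have "inv\<^bsub>G\<^esub> a \<otimes>\<^bsub>G\<^esub> (inv\<^bsub>G\<^esub> a \<otimes>\<^bsub>G\<^esub> (a \<otimes>\<^bsub>G\<^esub> (a \<otimes>\<^bsub>G\<^esub> b))) \<in> ?N"
    by (rule subgroup.m_closed[OF N i(1) subgroup.m_closed[OF N i]])
  moreover have "inv\<^bsub>G\<^esub> a \<otimes>\<^bsub>G\<^esub> (inv\<^bsub>G\<^esub> a \<otimes>\<^bsub>G\<^esub> (a \<otimes>\<^bsub>G\<^esub> (a \<otimes>\<^bsub>G\<^esub> b))) = b"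
    by (simp add: G.m_assoc[symmetric])
  ultimately have "generate G {a, b} \<subseteq> ?N"
    by (intro G.generate_subgroup_incl N) simp
  then show "carrier G \<subseteq> ?N" by (simp add: generate_rot)
qed

lemma order_rotation_comix_dual: "order (rotation_comix P (dual P)) * order K = order G * order G"
  unfolding rotation_comix_def rank_3 rotation_group_eq rotation_group_dual
proof (rule order_comix_mult_order_mix_group[OF G.is_group G.is_group _ _ _ generate_rot_dual])
qed (auto simp: interval_1_3 rot_dual generate_rot)

lemma order_rotation_comix_mirror:
  "order (rotation_comix P (mirror P)) * order (mix_group {1..<3} G (rot P) G (rot (mirror P))) =
    order G * order G"
  unfolding rotation_comix_def rank_3 rotation_group_eq rotation_group_mirror
proof (rule order_comix_mult_order_mix_group[OF G.is_group G.is_group _ _ _ generate_rot_mirror])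
qed (auto simp: interval_1_3 rot_mirror generate_rot)

text \<open>
  If the mix with the dual is not chiral, it covers the mix with the mirror image; in the latter
  the generators still have orders \<open>p\<close> and \<open>q\<close>, so that \<open>\<langle>\<sigma>\<^sub>1\<^sup>p\<rangle>\<close> and \<open>\<langle>\<sigma>\<^sub>2\<^sup>q\<rangle>\<close> lie in the kernel.
\<close>

lemma order_mix_of_reflection:
  assumes \<theta>: "\<theta> \<in> hom K K" "\<theta> (s 1) = inv\<^bsub>K\<^esub> (s 1)" "\<theta> (s 2) = s 1 \<otimes>\<^bsub>K\<^esub> (s 1 \<otimes>\<^bsub>K\<^esub> s 2)"
    and l: "l = lcm (G.ord a) (G.ord b)"
  shows "(l div G.ord a) * (l div G.ord b) * order (mix_group {1..<3} G (rot P) G (rot (mirror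
      P))) \<le> order K"
proof -
  let ?M = "mix_group {1..<3} G (rot P) G (rot (mirror P))"
  \<comment> \<open>Keeping only the first coordinate of \<open>\<theta> k\<close> leaves the
    generators of the mirror image: s_1 and s_2 are sent to (a, a^-1) and (b, a (ab)).\<close>
  define \<psi> where "\<psi> k = (fst k, fst (\<theta> k))" for k
  interpret F: group_hom K G fst by (rule fst_hom_K)
  have "\<psi> \<in> hom K (G \<times>\<times> G)"
    using \<theta>(1) F.homh by (auto simp: hom_def \<psi>_def Pi_iff)
  then interpret H: group_hom K "G \<times>\<times> G" \<psi>
    by (simp add: group_hom_def group_hom_axioms_def group_K GG.is_group)
  have \<psi>_s: "\<psi> (s 1) = (rot P 1, rot (mirror P) 1)" "\<psi> (s 2) = (rot P 2, rot (mirror P) 2)"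
    using \<theta> inv_K[OF s_in_K(1)] by (simp_all add: \<psi>_def rot_mirror K_def)
  have "{(rot P 1, rot (mirror P) 1), (rot P 2, rot (mirror P) 2)} \<subseteq> carrier (G \<times>\<times> G)"
    by (simp add: rot_mirror)
  then have "carrier ?M = generate (G \<times>\<times> G) (\<psi> ` {s 1, s 2})"
    unfolding \<psi>_s mix_group_def carrier_subgroup_generated interval_1_3
    using \<psi>_s by (simp add: Int_absorb1)
  also have "\<dots> = \<psi> ` carrier K"
    using H.generate_img[of "{s 1, s 2}"] s_in_K K.generate_s by simp
  finally have card: "order K = card (kernel K (G \<times>\<times> G) \<psi>) * order ?M"
    using H.order_eq_card_kernel_mult_card_image by (simp add: order_def)
  let ?N = "kernel K (G \<times>\<times> G) \<psi>"
  let ?x = "s 1 [^]\<^bsub>K\<^esub> G.ord a" and ?y = "s 2 [^]\<^bsub>K\<^esub> G.ord b"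
  have xy: "?x \<in> carrier K" "?y \<in> carrier K" using s_in_K by (simp_all del: K.s_closed)
  have pow: "\<psi> (x [^]\<^bsub>K\<^esub> k) = (fst (\<psi> x) [^]\<^bsub>G\<^esub> k, snd (\<psi> x) [^]\<^bsub>G\<^esub> k)" if x: "x \<in> carrier K"
      for x and k :: nat
  proof -
    have "\<psi> (x [^]\<^bsub>K\<^esub> k) = \<psi> x [^]\<^bsub>G \<times>\<times> G\<^esub> k" using x by (simp add: H.hom_nat_pow)
    also have "\<dots> = (fst (\<psi> x) [^]\<^bsub>G\<^esub> k, snd (\<psi> x) [^]\<^bsub>G\<^esub> k)"
      by (induction k) (simp_all add: mult_DirProd' nat_pow_def)
    finally show ?thesis .
  qed
  have "\<psi> ?x = \<one>\<^bsub>G \<times>\<times> G\<^esub>"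
    using pow[OF s_in_K(1)] by (simp add: \<psi>_s rot_mirror G.pow_ord_eq_1 G.nat_pow_inv)
  moreover have "\<psi> ?y = \<one>\<^bsub>G \<times>\<times> G\<^esub>"
    using pow[OF s_in_K(2)] by (simp add: \<psi>_s rot_mirror_2 G.conj_nat_pow G.pow_ord_eq_1
        G.nat_pow_inv)
  ultimately have "?x \<in> ?N" "?y \<in> ?N" using xy by (simp_all add: kernel_def)
  then have sub: "generate K {?x} \<subseteq> ?N" "generate K {?y} \<subseteq> ?N"
    using K.generate_subgroup_incl[OF _ H.subgroup_kernel] by simp_all
  have "generate K {x [^]\<^bsub>K\<^esub> k} \<subseteq> generate K {x}" if x: "x \<in> carrier K" for x and k :: nat
  proof (rule K.generate_subgroup_incl[OF _ K.generate_is_subgroup])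
    have "x [^]\<^bsub>K\<^esub> k \<in> generate K {x}"
      by (induction k) (auto intro: generate.one generate.eng generate.incl)
    then show "{x [^]\<^bsub>K\<^esub> k} \<subseteq> generate K {x}" by simp
  qed (use x in simp)
  from Int_mono[OF this[OF s_in_K(1)] this[OF s_in_K(2)]]
  have "generate K {?x} \<inter> generate K {?y} \<subseteq> {\<one>\<^bsub>K\<^esub>}"
    unfolding K.generate_Int .
  then have "generate K {?x} \<inter> generate K {?y} = {\<one>\<^bsub>K\<^esub>}"
    using generate.one[of K "{?x}"] generate.one[of K "{?y}"] by blast
  then have "card (generate K {?x}) * card (generate K {?y}) \<le> card ?N"
    using xy sub K.finite_carrier finite_subset[of ?N "carrier K"]
    by (intro K.card_mult_le_of_trivial_Int H.subgroup_kernel K.generate_is_subgroup) (auto simp: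
        kernel_def)
  \<comment> \<open>Both generators of \<open>K\<close> have order l, a multiple of the orders of
    \<open>a\<close> and \<open>b\<close>, so the powers \<open>?x\<close> and \<open>?y\<close>
    have the stated quotients as orders.\<close>
  moreover have "card (generate K {?x}) = l div G.ord a" "card (generate K {?y}) = l div G.ord b"
  proof -
    have "0 < G.ord a" "0 < G.ord b" by (simp_all add: ord_pos)
    then show "card (generate K {?x}) = l div G.ord a" "card (generate K {?y}) = l div G.ord b"
      using K.generate_pow_card[OF xy(1)] K.generate_pow_card[OF xy(2)] s_in_K
        K.ord_pow[of "s 1" "G.ord a"] K.ord_pow[of "s 2" "G.ord b"] by (simp_all add: ord_s l)
  qed
  ultimately show ?thesis unfolding card by (simp add: mult_le_mono1)
qed

end

theorem theorem5p6:
  fixes P :: "'a based_poset" and p q l1 :: nat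
  assumes "chiral_polyhedron P"
    and "finite (faces P)"
    and "schlafli_type P = [p, q]"
    and "l1 = lcm p q"
    and "real (order (rotation_comix P (mirror P)))
           < (real l1)\<^sup>2 / (real p * real q) * real (order (rotation_comix P (dual P)))"
  shows "chiral_polyhedron (mix P (dual P)) \<and>
         properly_self_dual (mix P (dual P)) \<and>
         schlafli_type (mix P (dual P)) = [l1, l1]"
proof -
  interpret finite_chiral_polyhedron P
    using assms(1,2) by unfold_locales (simp_all add: chiral_polyhedron_def chiral_def)
  have "[1..<3] = [1, 2 :: nat]" by (simp add: upt_rec)
  then have pq: "p = G.ord a" "q = G.ord b"
    using assms(3) by (simp_all add: schlafli_type_def rank_3 rotation_group_eq)
  have pos: "0 < p" "0 < q" by (simp_all add: pq ord_pos)
  have "chiral (coset_poset 3 K s)"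
  proof (rule K.chiral_Q, rule notI)
    let ?M = "mix_group {1..<3} G (rot P) G (rot (mirror P))"
    let ?c = "order (rotation_comix P (mirror P))" and ?d = "order (rotation_comix P (dual P))"
    assume "\<exists>\<theta>\<in>hom K K. \<theta> (s 1) = inv\<^bsub>K\<^esub> (s 1) \<and> \<theta> (s 2) = s 1 \<otimes>\<^bsub>K\<^esub> (s 1 \<otimes>\<^bsub>K\<^esub> s 2)"
    then have le: "(l1 div p) * (l1 div q) * order ?M \<le> order K"
      using order_mix_of_reflection[of _ l1] assms(4) pq by blast
    \<comment> \<open>For either partner, comix order times mix order is the square of
      \<open>order G\<close>. Multiplying by \<open>?d\<close> therefore allows
      \<open>?d * order K\<close> to be traded for \<open>?c * order ?M\<close>.\<close>
    have "?d * ((l1 div p) * (l1 div q)) * order ?M \<le> ?d * order K"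
      using mult_le_mono2[OF le, of ?d] by (simp add: mult.assoc)
    also have "\<dots> = ?c * order ?M"
      using order_rotation_comix_dual order_rotation_comix_mirror by simp
    finally have *: "?d * ((l1 div p) * (l1 div q)) * order ?M \<le> ?c * order ?M" .
    have "0 < order G" using G.order_gt_0_iff_finite finite_G by simp
    \<comment> \<open>It divides the square of \<open>order G\<close>, which is positive by
      finiteness, so it can be cancelled.\<close>
    then have "order ?M \<noteq> 0" using order_rotation_comix_mirror by (metis mult_is_0 neq0_conv)
    with * have "?d * ((l1 div p) * (l1 div q)) \<le> ?c" by simp
    then have "real ?d * (real (l1 div p) * real (l1 div q)) \<le> real ?c"
      by (metis of_nat_le_iff of_nat_mult)
    \<comment> \<open>Both p and q divide their least common multiple, so the division of natural
      numbers is exact.\<close>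
    moreover have "real (l1 div p) = real l1 / real p" "real (l1 div q) = real l1 / real q"
      using assms(4) by (simp_all add: real_of_nat_div)
    ultimately have "(real l1)\<^sup>2 / (real p * real q) * real ?d \<le> real ?c"
      by (simp add: power2_eq_square mult.commute)
    then show False using assms(5) by simp
  qed
  then show ?thesis
    using properly_self_dual_mix_dual K.schlafli_type_Q ord_s pq assms(4)
    by (simp add: chiral_polyhedron_def mix_dual)
qed

end
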